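(* Let $A$ be a C$^*$-algebra, let $X$ be an essential Banach $^*$-$A$-bimodule, and let $T:A\to X$ be a bounded linear operator. Then the following statements are equivalent: (a) $T$ is l-$^*$-anti-derivable at zero, i.e. for all $a,b\in A$, $a^*b=0$ in $A$ implies $T(b)a^*+bT(a)^*=0$ in $X$; (b) There exist a $^*$-derivation $d:A\to X^{**}$ and an element $\eta\in X^{**}$ satisfying the following properties: (i) $d([a,b])+[a,b]\eta^*+\eta[a,b]=0$ for all $a,b\in A$; (ii) $T(ab)=aT(b)+T(a)b-a\eta b$ and $T(a)=d(a)+\eta a$ for all $a,b\in A$. If we further assume that $A$ is unital or that $X$ is a dual Banach $A$-bimodule, then (b) can be replaced with the following: (b$'$) There exist a $^*$-derivation $d:A\to X$ and an element $\eta\in X$ satisfying properties (i) and (ii) above.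
   Context: All algebras and Banach spaces are complex; $A$ need not be unital. A Banach $A$-bimodule $X$ is essential if the linear span of $\{axb: a,b\in A,\ x\in X\}$ is dense in $X$. An $A$-bimodule involution on $X$ is a continuous conjugate-linear map $x\mapsto x^*$ on $X$ with $(x^* )^*=x$, $(ax)^*=x^*a^*$ and $(xa)^*=a^*x^*$ for all $a\in A$, $x\in X$; a Banach $^*$-$A$-bimodule is a Banach $A$-bimodule equipped with an $A$-bimodule involution. The bidual $X^{**}$ is regarded as a Banach $A$-bimodule whose operations $z\mapsto az$ and $z\mapsto za$ ($a\in A$, $z\in X^{**}$) are the second adjoints of the maps $x\mapsto ax$ and $x\mapsto xa$ on $X$; $X$ is identified with its canonical image in $X^{**}$. The involution on $X^{**}$ is given by $\phi^*(x)=\overline{\phi(x^* )}$ for $\phi\in X^*$, $x\in X$, and $z^*(\phi)=\overline{z(\phi^* )}$ for $z\in X^{**}$, $\phi\in X^*$. A derivation $d:A\to Y$ into an $A$-bimodule $Y$ is a linear map with $d(ab)=d(a)b+a\,d(b)$ for all $a,b\in A$; it is a $^*$-derivation (when $Y$ carries an involution) if moreover $d(a^* )=d(a)^*$ for all $a\in A$. A dual Banach $A$-bimodule is one of the form $Y^*$ for a Banach $A$-bimodule $Y$, with operations $(a\phi)(y)=\phi(ya)$, $(\phi a)(y)=\phi(ay)$. The commutator is $[a,b]=ab-ba$. *)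

theory Defs
  imports "HOL-Analysis.Analysis"
begin

section \<open>Complex Banach spaces and C*-algebras\<close>

class complex_vector = real_vector +
  fixes scaleC :: "complex \<Rightarrow> 'a \<Rightarrow> 'a" (infixr \<open>*\<^sub>C\<close> 75)
  assumes scaleC_add_right: "c *\<^sub>C (x + y) = c *\<^sub>C x + c *\<^sub>C y"
    and scaleC_add_left: "(c + d) *\<^sub>C x = c *\<^sub>C x + d *\<^sub>C x"
    and scaleC_scaleC: "c *\<^sub>C (d *\<^sub>C x) = (c * d) *\<^sub>C x"
    and scaleC_of_real: "complex_of_real r *\<^sub>C x = r *\<^sub>R x"

class complex_normed_vector = complex_vector + real_normed_vector +
  assumes norm_scaleC: "norm (c *\<^sub>C x) = cmod c * norm x"

class cbanach = complex_normed_vector + banach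

(* As for real_normed_algebra, no unit is required. *)
class complex_normed_algebra = complex_normed_vector + real_normed_algebra +
  assumes mult_scaleC_left: "(c *\<^sub>C x) * y = c *\<^sub>C (x * y)"
    and mult_scaleC_right: "x * (c *\<^sub>C y) = c *\<^sub>C (x * y)"

class cstar_algebra = complex_normed_algebra + cbanach +
  fixes star :: "'a \<Rightarrow> 'a" (\<open>_\<^sup>\<star>\<close> [1000] 999)
  assumes star_add: "(x + y)\<^sup>\<star> = x\<^sup>\<star> + y\<^sup>\<star>"
    and star_scaleC: "(c *\<^sub>C x)\<^sup>\<star> = cnj c *\<^sub>C x\<^sup>\<star>"
    and star_mult: "(x * y)\<^sup>\<star> = y\<^sup>\<star> * x\<^sup>\<star>"
    and star_star: "(x\<^sup>\<star>)\<^sup>\<star> = x"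
    and cstar_identity: "norm (x\<^sup>\<star> * x) = (norm x)\<^sup>2"

lemma vector_space_scaleC: "vector_space (scaleC :: complex \<Rightarrow> 'a::complex_vector \<Rightarrow> 'a)"
proof
  show "1 *\<^sub>C x = x" for x :: 'a
    using scaleC_of_real[of 1 x] by simp
qed (simp_all add: scaleC_add_right scaleC_add_left scaleC_scaleC)

global_interpretation complex_vector: vector_space "scaleC :: complex \<Rightarrow> 'a::complex_vector \<Rightarrow> 'a"
  by (rule vector_space_scaleC)

abbreviation clinear :: "('a::complex_vector \<Rightarrow> 'b::complex_vector) \<Rightarrow> bool"
  where "clinear \<equiv> Vector_Spaces.linear scaleC scaleC"

definition bounded_clinear :: "('a::complex_normed_vector \<Rightarrow> 'b::complex_normed_vector) \<Rightarrow> bool"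
  where "bounded_clinear f \<longleftrightarrow> clinear f \<and> (\<exists>K. \<forall>x. norm (f x) \<le> K * norm x)"

definition conjugate_linear :: "('a::complex_vector \<Rightarrow> 'b::complex_vector) \<Rightarrow> bool"
  where "conjugate_linear f \<longleftrightarrow>
    (\<forall>x y. f (x + y) = f x + f y) \<and> (\<forall>c x. f (c *\<^sub>C x) = cnj c *\<^sub>C f x)"

lemma clinear_iff:
  "clinear f \<longleftrightarrow> (\<forall>x y. f (x + y) = f x + f y) \<and> (\<forall>c x. f (c *\<^sub>C x) = c *\<^sub>C f x)"
  unfolding Vector_Spaces.linear_def module_hom_def module_hom_axioms_def
  by (simp add: vector_space_scaleC complex_vector.module_axioms)

lemma bounded_clinear_iff:
  "bounded_clinear f \<longleftrightarrow> bounded_linear f \<and> (\<forall>c x. f (c *\<^sub>C x) = c *\<^sub>C f x)"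
proof
  assume f: "bounded_clinear f"
  then obtain K where K: "norm (f x) \<le> K * norm x" for x
    by (auto simp: bounded_clinear_def)
  have "bounded_linear f"
    using f K unfolding bounded_clinear_def clinear_iff
    by (intro bounded_linear_intro[of f K]) (auto simp: scaleC_of_real[symmetric] mult.commute)
  then show "bounded_linear f \<and> (\<forall>c x. f (c *\<^sub>C x) = c *\<^sub>C f x)"
    using f by (simp add: bounded_clinear_def clinear_iff)
next
  assume f: "bounded_linear f \<and> (\<forall>c x. f (c *\<^sub>C x) = c *\<^sub>C f x)"
  then interpret bounded_linear f by simp
  show "bounded_clinear f"
    unfolding bounded_clinear_def clinear_iff
    using f add bounded by (auto simp: mult.commute)
qed

instantiation complex :: complex_normed_algebra
begin
definition scaleC_complex :: "complex \<Rightarrow> complex \<Rightarrow> complex"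
  where "scaleC_complex c z = c * z"
instance
  by standard (auto simp: scaleC_complex_def algebra_simps norm_mult scaleR_conv_of_real)
end


section \<open>The dual space\<close>

typedef (overloaded) ('a::complex_normed_vector) cdual =
  "{f :: 'a \<Rightarrow> complex. bounded_clinear f}"
  morphisms cdual_apply Abs_cdual
proof
  show "(\<lambda>x. 0) \<in> {f :: 'a \<Rightarrow> complex. bounded_clinear f}"
    by (simp add: bounded_clinear_iff scaleC_complex_def)
qed

setup_lifting type_definition_cdual

instantiation cdual :: (complex_normed_vector) complex_normed_vector
begin

lift_definition zero_cdual :: "'a cdual" is "\<lambda>x. 0"
  by (simp add: bounded_clinear_iff scaleC_complex_def)
lift_definition plus_cdual :: "'a cdual \<Rightarrow> 'a cdual \<Rightarrow> 'a cdual" is "\<lambda>f g x. f x + g x"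
  by (simp add: bounded_clinear_iff scaleC_add_right bounded_linear_add)
lift_definition minus_cdual :: "'a cdual \<Rightarrow> 'a cdual \<Rightarrow> 'a cdual" is "\<lambda>f g x. f x - g x"
  by (simp add: bounded_clinear_iff scaleC_complex_def algebra_simps bounded_linear_sub)
lift_definition uminus_cdual :: "'a cdual \<Rightarrow> 'a cdual" is "\<lambda>f x. - f x"
  by (simp add: bounded_clinear_iff scaleC_complex_def bounded_linear_minus)
lift_definition scaleR_cdual :: "real \<Rightarrow> 'a cdual \<Rightarrow> 'a cdual" is "\<lambda>r f x. r *\<^sub>R f x"
  by (simp add: bounded_clinear_iff scaleC_complex_def
      bounded_linear_compose[OF bounded_linear_scaleR_right])
lift_definition scaleC_cdual :: "complex \<Rightarrow> 'a cdual \<Rightarrow> 'a cdual" is "\<lambda>c f x. c * f x"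
  by (simp add: bounded_clinear_iff scaleC_complex_def mult.left_commute
      bounded_linear_compose[OF bounded_linear_mult_right])
lift_definition norm_cdual :: "'a cdual \<Rightarrow> real" is onorm .

definition dist_cdual :: "'a cdual \<Rightarrow> 'a cdual \<Rightarrow> real"
  where "dist_cdual f g = norm (f - g)"
definition sgn_cdual :: "'a cdual \<Rightarrow> 'a cdual"
  where "sgn_cdual f = inverse (norm f) *\<^sub>R f"
definition uniformity_cdual :: "('a cdual \<times> 'a cdual) filter"
  where "uniformity_cdual = (INF e\<in>{0<..}. principal {(x, y). dist x y < e})"
definition open_cdual :: "'a cdual set \<Rightarrow> bool"
  where "open_cdual U = (\<forall>x\<in>U. \<forall>\<^sub>F (x', y) in uniformity. x' = x \<longrightarrow> y \<in> U)"

instance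
proof
  fix f g h :: "'a cdual" and c d :: complex and r s :: real
  show "f + g + h = f + (g + h)" "f + g = g + f" "0 + f = f" "- f + f = 0" "f - g = f + - g"
    by (transfer; simp add: fun_eq_iff)+
  show "r *\<^sub>R (f + g) = r *\<^sub>R f + r *\<^sub>R g" "(r + s) *\<^sub>R f = r *\<^sub>R f + s *\<^sub>R f"
    "r *\<^sub>R s *\<^sub>R f = (r * s) *\<^sub>R f" "1 *\<^sub>R f = f"
    by (transfer; simp add: fun_eq_iff scaleR_add_right scaleR_add_left)+
  show "c *\<^sub>C (f + g) = c *\<^sub>C f + c *\<^sub>C g" "(c + d) *\<^sub>C f = c *\<^sub>C f + d *\<^sub>C f"
    "c *\<^sub>C d *\<^sub>C f = (c * d) *\<^sub>C f" "complex_of_real r *\<^sub>C f = r *\<^sub>R f"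
    by (transfer; simp add: fun_eq_iff algebra_simps scaleR_conv_of_real)+
  show "norm f = 0 \<longleftrightarrow> f = 0"
    by transfer (auto simp: bounded_clinear_iff onorm_eq_0 fun_eq_iff)
  show "norm (f + g) \<le> norm f + norm g"
    by transfer (simp add: bounded_clinear_iff onorm_triangle)
  show "norm (r *\<^sub>R f) = \<bar>r\<bar> * norm f"
    by transfer (simp add: bounded_clinear_iff onorm_scaleR)
  show "norm (c *\<^sub>C f) = cmod c * norm f"
  proof (transfer)
    fix c and f :: "'a \<Rightarrow> complex"
    assume "bounded_clinear f"
    then have f: "bounded_linear f" by (simp add: bounded_clinear_iff)
    have "onorm (\<lambda>x. c * f x) = onorm (\<lambda>x. cmod c *\<^sub>R f x)"
      by (simp add: onorm_def norm_mult)
    then show "onorm (\<lambda>x. c * f x) = cmod c * onorm f"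
      by (simp add: onorm_scaleR[OF f])
  qed
qed (fact dist_cdual_def sgn_cdual_def uniformity_cdual_def open_cdual_def)+

end

lemma bounded_linear_cdual_apply: "bounded_linear (cdual_apply f)"
  using cdual_apply[of f] by (simp add: bounded_clinear_iff)

instance cdual :: (complex_normed_vector) cbanach
proof
  fix F :: "nat \<Rightarrow> 'a cdual"
  assume F: "Cauchy F"
  define G where "G n = Blinfun (cdual_apply (F n))" for n
  have G: "blinfun_apply (G n) = cdual_apply (F n)" for n
    by (simp add: G_def bounded_linear_Blinfun_apply bounded_linear_cdual_apply)
  have "dist (G m) (G n) = dist (F m) (F n)" for m n
    unfolding dist_norm norm_blinfun.rep_eq norm_cdual.rep_eq minus_blinfun.rep_eq
      minus_cdual.rep_eq G ..
  then have "Cauchy G"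
    using F by (simp add: Cauchy_def)
  then obtain L where L: "G \<longlonglongrightarrow> L"
    using Cauchy_convergent[of G] unfolding convergent_def by blast
  have lim: "(\<lambda>n. cdual_apply (F n) x) \<longlonglongrightarrow> blinfun_apply L x" for x
    using blinfun.tendsto[OF L tendsto_const, of x] by (simp add: G)
  have "blinfun_apply L (c *\<^sub>C x) = c * blinfun_apply L x" for c x
  proof (rule LIMSEQ_unique[OF lim])
    have "cdual_apply (F n) (c *\<^sub>C x) = c * cdual_apply (F n) x" for n
      using cdual_apply[of "F n"] by (simp add: bounded_clinear_iff scaleC_complex_def)
    then show "(\<lambda>n. cdual_apply (F n) (c *\<^sub>C x)) \<longlonglongrightarrow> c * blinfun_apply L x"
      by (simp add: tendsto_mult_left lim)
  qed
  then have L': "cdual_apply (Abs_cdual (blinfun_apply L)) = blinfun_apply L"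
    by (intro Abs_cdual_inverse)
      (simp add: bounded_clinear_iff scaleC_complex_def blinfun.bounded_linear_right)
  have "dist (F n) (Abs_cdual (blinfun_apply L)) = dist (G n) L" for n
    unfolding dist_norm norm_blinfun.rep_eq norm_cdual.rep_eq minus_blinfun.rep_eq
      minus_cdual.rep_eq G L' ..
  then have "F \<longlonglongrightarrow> Abs_cdual (blinfun_apply L)"
    using L unfolding tendsto_dist_iff[of F] tendsto_dist_iff[of G] by simp
  then show "convergent F"
    by (auto simp: convergent_def)
qed

text \<open>
  The following three operations are built with \<^const>\<open>Abs_cdual\<close>; the lemmas after them record
  that they have the intended values.
\<close>

definition canonical_embedding :: "'a::complex_normed_vector \<Rightarrow> 'a cdual cdual"
  where "canonical_embedding x = Abs_cdual (\<lambda>\<phi>. cdual_apply \<phi> x)"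

definition adjoint_map ::
    "('a::complex_normed_vector \<Rightarrow> 'b::complex_normed_vector) \<Rightarrow> 'b cdual \<Rightarrow> 'a cdual"
  where "adjoint_map f \<phi> = Abs_cdual (\<lambda>x. cdual_apply \<phi> (f x))"

definition dual_involution ::
    "('a::complex_normed_vector \<Rightarrow> 'a) \<Rightarrow> 'a cdual \<Rightarrow> 'a cdual"
  where "dual_involution s \<phi> = Abs_cdual (\<lambda>x. cnj (cdual_apply \<phi> (s x)))"

lemma canonical_embedding_apply:
  "cdual_apply (canonical_embedding x) \<phi> = cdual_apply \<phi> x"
proof -
  have "norm (cdual_apply \<phi> x) \<le> norm x * norm \<phi>" for \<phi> :: "'a cdual"
    using onorm[OF bounded_linear_cdual_apply, of \<phi> x]
    by (simp add: norm_cdual.rep_eq mult.commute)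
  then have "bounded_clinear (\<lambda>\<phi>. cdual_apply \<phi> x)"
    by (auto simp: bounded_clinear_def clinear_iff plus_cdual.rep_eq scaleC_cdual.rep_eq
        scaleC_complex_def)
  then show ?thesis
    by (simp add: canonical_embedding_def Abs_cdual_inverse)
qed

lemma adjoint_map_apply:
  assumes "bounded_clinear f"
  shows "cdual_apply (adjoint_map f \<phi>) x = cdual_apply \<phi> (f x)"
proof -
  have "bounded_clinear (\<lambda>x. cdual_apply \<phi> (f x))"
    using assms cdual_apply[of \<phi>] bounded_linear_compose[OF bounded_linear_cdual_apply]
    by (auto simp: bounded_clinear_iff)
  then show ?thesis
    by (simp add: adjoint_map_def Abs_cdual_inverse)
qed

lemma bounded_linear_if_conjugate_linear_continuous:
  fixes s :: "'a::complex_normed_vector \<Rightarrow> 'b::complex_normed_vector"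
  assumes "conjugate_linear s" "continuous_on UNIV s"
  shows "bounded_linear s"
proof -
  have lin: "linear s"
    using assms(1) unfolding conjugate_linear_def
    by (intro linearI) (auto simp: scaleC_of_real[symmetric])
  interpret linear s by fact
  obtain e where "e > 0" and e: "norm x < e \<Longrightarrow> norm (s x) < 1" for x
    using assms(2) unfolding continuous_on_iff
    by (metis UNIV_I dist_0_norm dist_commute zero zero_less_one)
  have "norm (s x) \<le> norm x * (2 / e)" for x
  proof (cases "x = 0")
    case False
    define t where "t = e / (2 * norm x)"
    have t: "t > 0" using False \<open>e > 0\<close> by (simp add: t_def)
    have "norm (t *\<^sub>R x) = e / 2"
      using False \<open>e > 0\<close> by (simp add: t_def)
    then have "norm (s (t *\<^sub>R x)) < 1"
      using e \<open>e > 0\<close> by simp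
    then have "norm (s x) < 1 / t"
      using t by (simp add: scale field_simps)
    also have "1 / t = norm x * (2 / e)"
      by (simp add: t_def)
    finally show ?thesis by simp
  qed (simp add: zero)
  then show ?thesis
    using add scale by (intro bounded_linear_intro)
qed

lemma dual_involution_apply:
  assumes "conjugate_linear s" "continuous_on UNIV s"
  shows "cdual_apply (dual_involution s \<phi>) x = cnj (cdual_apply \<phi> (s x))"
proof -
  have "bounded_linear (\<lambda>x. cnj (cdual_apply \<phi> (s x)))"
    by (rule bounded_linear_compose[OF bounded_linear_cnj])
      (rule bounded_linear_compose[OF bounded_linear_cdual_apply
          bounded_linear_if_conjugate_linear_continuous[OF assms]])
  moreover have "cdual_apply \<phi> (c *\<^sub>C y) = c * cdual_apply \<phi> y" for c y
    using cdual_apply[of \<phi>] by (simp add: bounded_clinear_iff scaleC_complex_def)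
  ultimately have "bounded_clinear (\<lambda>x. cnj (cdual_apply \<phi> (s x)))"
    using assms(1) by (simp add: bounded_clinear_iff conjugate_linear_def scaleC_complex_def)
  then show ?thesis
    by (simp add: dual_involution_def Abs_cdual_inverse)
qed


section \<open>Banach bimodules\<close>

locale banach_bimodule =
  fixes lact :: "'a::complex_normed_algebra \<Rightarrow> 'x::cbanach \<Rightarrow> 'x"
    and ract :: "'x \<Rightarrow> 'a \<Rightarrow> 'x"
  assumes clinear_lact_left: "clinear (\<lambda>a. lact a x)"
    and clinear_lact_right: "clinear (\<lambda>x. lact a x)"
    and clinear_ract_left: "clinear (\<lambda>x. ract x a)"
    and clinear_ract_right: "clinear (\<lambda>a. ract x a)"
    and lact_mult: "lact (a * b) x = lact a (lact b x)"
    and ract_mult: "ract x (a * b) = ract (ract x a) b"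
    and lact_ract: "ract (lact a x) b = lact a (ract x b)"
    and bounded_lact: "\<exists>K. \<forall>a x. norm (lact a x) \<le> K * norm a * norm x"
    and bounded_ract: "\<exists>K. \<forall>a x. norm (ract x a) \<le> K * norm x * norm a"

locale banach_star_bimodule = banach_bimodule lact ract
  for lact :: "'a::cstar_algebra \<Rightarrow> 'x::cbanach \<Rightarrow> 'x" and ract :: "'x \<Rightarrow> 'a \<Rightarrow> 'x" +
  fixes invol :: "'x \<Rightarrow> 'x"
  assumes continuous_invol: "continuous_on UNIV invol"
    and conjugate_linear_invol: "conjugate_linear invol"
    and invol_invol: "invol (invol x) = x"
    and invol_lact: "invol (lact a x) = ract (invol x) (a\<^sup>\<star>)"
    and invol_ract: "invol (ract x a) = lact (a\<^sup>\<star>) (invol x)"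

definition essential_bimodule ::
    "('a \<Rightarrow> 'x::complex_normed_vector \<Rightarrow> 'x) \<Rightarrow> ('x \<Rightarrow> 'a \<Rightarrow> 'x) \<Rightarrow> bool"
  where "essential_bimodule lact ract \<longleftrightarrow>
    closure (complex_vector.span {ract (lact a x) b | a b x. True}) = UNIV"

definition dual_lact ::
    "('x::complex_normed_vector \<Rightarrow> 'a \<Rightarrow> 'x) \<Rightarrow> 'a \<Rightarrow> 'x cdual \<Rightarrow> 'x cdual"
  where "dual_lact ract a = adjoint_map (\<lambda>y. ract y a)"

definition dual_ract ::
    "('a \<Rightarrow> 'x::complex_normed_vector \<Rightarrow> 'x) \<Rightarrow> 'x cdual \<Rightarrow> 'a \<Rightarrow> 'x cdual"
  where "dual_ract lact \<phi> a = adjoint_map (\<lambda>y. lact a y) \<phi>"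

definition bidual_lact ::
    "('a \<Rightarrow> 'x::complex_normed_vector \<Rightarrow> 'x) \<Rightarrow> 'a \<Rightarrow> 'x cdual cdual \<Rightarrow> 'x cdual cdual"
  where "bidual_lact lact a = adjoint_map (adjoint_map (\<lambda>x. lact a x))"

definition bidual_ract ::
    "('x::complex_normed_vector \<Rightarrow> 'a \<Rightarrow> 'x) \<Rightarrow> 'x cdual cdual \<Rightarrow> 'a \<Rightarrow> 'x cdual cdual"
  where "bidual_ract ract z a = adjoint_map (adjoint_map (\<lambda>x. ract x a)) z"

definition bidual_involution ::
    "('x::complex_normed_vector \<Rightarrow> 'x) \<Rightarrow> 'x cdual cdual \<Rightarrow> 'x cdual cdual"
  where "bidual_involution invol = dual_involution (dual_involution invol)"

text \<open>
  The bimodule \<open>(lact, ract)\<close> is the dual of the Banach bimodule \<open>(lact', ract')\<close>, up to an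
  isometric bimodule isomorphism.
\<close>

definition is_dual_bimodule_of ::
    "('a::complex_normed_algebra \<Rightarrow> 'x::cbanach \<Rightarrow> 'x) \<Rightarrow> ('x \<Rightarrow> 'a \<Rightarrow> 'x) \<Rightarrow>
     ('a \<Rightarrow> 'y::cbanach \<Rightarrow> 'y) \<Rightarrow> ('y \<Rightarrow> 'a \<Rightarrow> 'y) \<Rightarrow> bool"
  where "is_dual_bimodule_of lact ract lact' ract' \<longleftrightarrow>
    banach_bimodule lact' ract' \<and>
    (\<exists>J :: 'x \<Rightarrow> 'y cdual. clinear J \<and> (\<forall>x. norm (J x) = norm x) \<and> surj J \<and>
      (\<forall>a x. J (lact a x) = dual_lact ract' a (J x)) \<and>
      (\<forall>a x. J (ract x a) = dual_ract lact' (J x) a))"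


section \<open>Derivations and anti-derivable maps\<close>

definition commutator :: "'a::ring \<Rightarrow> 'a \<Rightarrow> 'a"
  where "commutator a b = a * b - b * a"

definition derivation ::
    "('a::complex_normed_algebra \<Rightarrow> 'x::complex_vector \<Rightarrow> 'x) \<Rightarrow> ('x \<Rightarrow> 'a \<Rightarrow> 'x) \<Rightarrow> ('a \<Rightarrow> 'x) \<Rightarrow> bool"
  where "derivation lact ract d \<longleftrightarrow>
    clinear d \<and> (\<forall>a b. d (a * b) = ract (d a) b + lact a (d b))"

definition star_derivation ::
    "('a::cstar_algebra \<Rightarrow> 'x::complex_vector \<Rightarrow> 'x) \<Rightarrow> ('x \<Rightarrow> 'a \<Rightarrow> 'x) \<Rightarrow> ('x \<Rightarrow> 'x) \<Rightarrow>
     ('a \<Rightarrow> 'x) \<Rightarrow> bool"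
  where "star_derivation lact ract invol d \<longleftrightarrow>
    derivation lact ract d \<and> (\<forall>a. d (a\<^sup>\<star>) = invol (d a))"

definition l_star_anti_derivable_at_zero ::
    "('a::cstar_algebra \<Rightarrow> 'x::complex_vector \<Rightarrow> 'x) \<Rightarrow> ('x \<Rightarrow> 'a \<Rightarrow> 'x) \<Rightarrow> ('x \<Rightarrow> 'x) \<Rightarrow>
     ('a \<Rightarrow> 'x) \<Rightarrow> bool"
  where "l_star_anti_derivable_at_zero lact ract invol T \<longleftrightarrow>
    (\<forall>a b. a\<^sup>\<star> * b = 0 \<longrightarrow> ract (T b) (a\<^sup>\<star>) + lact b (invol (T a)) = 0)"

definition unital_algebra :: "'a::complex_normed_algebra itself \<Rightarrow> bool"
  where "unital_algebra (_ :: 'a itself) \<longleftrightarrow> (\<exists>e::'a. \<forall>a. e * a = a \<and> a * e = a)"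

end

theory Submission
  imports Defs
begin

text \<open>
  Write \<open>S a = T(a\<^sup>\<star>)\<^sup>\<star>\<close> and \<open>V x y = T(y) x + y S(x)\<close>. Statement (a) says precisely that the bounded
  bilinear map \<open>V\<close> vanishes on pairs with \<open>x y = 0\<close>. On a C*-algebra such a map is balanced,
  \<open>V (x y) z = V x (y z)\<close> (\<open>zero_product_form_balanced\<close>). Letting one variable at a time run through a
  bounded approximate identity \<open>u\<close> and taking for \<open>\<eta>\<close> a weak-star cluster point of \<open>T(u)\<close> in the
  bidual, this identity becomes \<open>V x y = T(x y) + x y \<eta>\<^sup>\<star>\<close> and \<open>\<eta> w + S(w) = T(w) + w \<eta>\<^sup>\<star>\<close>. The second
  relation says that \<open>d = T - \<eta> \<cdot>\<close> is also \<open>S - \<cdot> \<eta>\<^sup>\<star>\<close>, hence commutes with the involutions; the first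
  one becomes \<open>d(x) y + x d(y) = d(y x) + \<eta> [y, x] + [y, x] \<eta>\<^sup>\<star>\<close>.
  It remains to split this equation into the derivation law and the tracial identity (i), either of
  which implies the other in its presence. The defect \<open>g x y = d(x y) - d(x) y - x d(y)\<close> is a Hochschild
  cocycle and depends on the commutator \<open>[x, y]\<close> only. So \<open>d\<close> is a Jordan derivation, and computing
  \<open>d\<close> on \<open>a b x b a + b a x a b\<close> in two ways shows that \<open>g a b\<close> anticommutes with \<open>p = [a, b]\<close>
  across every \<open>x\<close>. Therefore \<open>p\<^sup>4\<close> annihilates \<open>g a b\<close> on both sides, and so do local units built
  from \<open>p\<^sup>4\<close>. On the other hand \<open>g a b = d(p) + \<eta> p + p \<eta>\<^sup>\<star>\<close> lies, up to small errors, in the sum of a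
  left and a right multiple of \<open>p\<close>, which those local units do reproduce. Hence \<open>g = 0\<close>
  (\<open>g_eq_0\<close>).

  The converse is a direct computation: if \<open>a\<^sup>\<star> b = 0\<close>, then \<open>b a\<^sup>\<star>\<close> is the commutator of \<open>b\<close> and
  \<open>a\<^sup>\<star>\<close>, and the expression in (a) is the left-hand side of (i) at it; the bidual is left again since
  functionals separate points.

  To replace the bidual by \<open>X\<close> it is enough to find \<open>\<eta>' \<in> X\<close> with \<open>\<eta> a = \<eta>' a\<close> for all \<open>a\<close>. If \<open>A\<close> has
  a unit \<open>e\<close>, take \<open>\<eta>' = T(e)\<close>. If \<open>X\<close> is a dual bimodule, take the image of \<open>\<eta>\<close> under the module
  projection \<open>P\<close> of the bidual onto \<open>X\<close>: the derivation \<open>P d - d\<close> is at once a left and a right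
  multiplication by fixed elements, and this forces it to vanish on products, which are dense.
  The involution of \<open>X\<close> need not be weak-star continuous, so that \<open>P\<close> need not respect it; this is
  why the argument treats the left and the right multiplication separately.

  The C*-theory behind these steps is a continuous functional calculus. The bound
  \<open>\<bar>p(h)\<bar> \<le> sup \<bar>p\<bar>\<close> comes from unitaries: for a polynomial \<open>q\<close> and a unitary \<open>u\<close>, the coefficients of
  \<open>q\<^sup>N\<close> are at most \<open>(sup \<bar>q\<bar>)\<^sup>N\<close>, so that \<open>\<bar>q(u)\<^sup>N\<bar>\<close> exceeds this number by a factor that is only
  linear in \<open>N\<close>, while \<open>\<bar>q(u)\<^sup>N\<bar> = \<bar>q(u)\<bar>\<^sup>N\<close> for \<open>N = 2\<^sup>n\<close>; and a self-adjoint \<open>h\<close> of norm less than one is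
  the real part of a unitary \<open>h + \<i> y\<close>, where \<open>y\<close> is a self-adjoint square root of \<open>1 - h\<^sup>2\<close>.
\<close>


section \<open>Complex scalars and the C*-involution\<close>

lemma scaleC_zero_left [simp]: "0 *\<^sub>C x = 0"
  by (rule complex_vector.scale_zero_left)

lemma scaleC_zero_right [simp]: "c *\<^sub>C 0 = 0"
  by (rule complex_vector.scale_zero_right)

lemma scaleC_one [simp]: "1 *\<^sub>C x = x"
  by (rule complex_vector.scale_one)

lemma scaleC_minus_right [simp]: "c *\<^sub>C (- x) = - (c *\<^sub>C x)"
  by (rule complex_vector.scale_minus_right)

lemma scaleC_minus_left [simp]: "(- c) *\<^sub>C x = - (c *\<^sub>C x)"
  by (rule complex_vector.scale_minus_left)

lemma scaleC_diff_right: "c *\<^sub>C (x - y) = c *\<^sub>C x - c *\<^sub>C y"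
  by (rule complex_vector.scale_right_diff_distrib)

lemma scaleC_scaleR: "c *\<^sub>C (r *\<^sub>R x) = r *\<^sub>R (c *\<^sub>C x)"
  by (simp add: scaleC_of_real[symmetric] scaleC_scaleC mult.commute)

lemma scaleR_scaleC: "(r *\<^sub>R c) *\<^sub>C x = r *\<^sub>R (c *\<^sub>C x)"
  by (simp add: scaleC_of_real[symmetric] scaleC_scaleC scaleC_complex_def)

lemma bounded_linear_scaleC: "bounded_linear (\<lambda>x::'a::complex_normed_vector. c *\<^sub>C x)"
  by (rule bounded_linear_intro[where K = "cmod c"])
    (simp_all add: scaleC_add_right scaleC_scaleR norm_scaleC mult.commute)

lemma star_scaleR: "(r *\<^sub>R x)\<^sup>\<star> = r *\<^sub>R x\<^sup>\<star>"
  using star_scaleC[of "complex_of_real r" x] by (simp add: scaleC_of_real)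

lemma star_zero [simp]: "0\<^sup>\<star> = (0::'a::cstar_algebra)"
  using star_scaleR[of 0 "0::'a"] by simp

lemma star_minus: "(- x)\<^sup>\<star> = - (x\<^sup>\<star>)"
  using star_scaleR[of "-1" x] by simp

lemma star_diff: "(x - y)\<^sup>\<star> = x\<^sup>\<star> - y\<^sup>\<star>"
  using star_add[of x "- y"] by (simp add: star_minus)

lemma norm_star [simp]: "norm (x\<^sup>\<star>) = norm x"
proof -
  have le: "norm x \<le> norm (x\<^sup>\<star>)" for x :: 'a
  proof (cases "x = 0")
    case False
    have "norm x * norm x \<le> norm (x\<^sup>\<star>) * norm x"
      using cstar_identity[of x] norm_mult_ineq[of "x\<^sup>\<star>" x] by (simp add: power2_eq_square)
    then show ?thesis using False by simp
  qed simp
  show ?thesis using le[of x] le[of "x\<^sup>\<star>"] by (simp add: star_star)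
qed

lemma cstar_identity': "norm (x * x\<^sup>\<star>) = (norm x)\<^sup>2"
  using cstar_identity[of "x\<^sup>\<star>"] by (simp add: star_star)

lemma bounded_linear_star: "bounded_linear (star :: 'a::cstar_algebra \<Rightarrow> 'a)"
  by (rule bounded_linear_intro[where K = 1]) (simp_all add: star_add star_scaleR)


section \<open>The C*-unitization\<close>

text \<open>
  The pair of \<open>a\<close> and \<open>\<lambda>\<close> stands for \<open>a + \<lambda> 1\<close>. The functional calculus needs a unit, and it has to
  live in a C*-algebra.
\<close>

datatype 'a unitization = Unitization (vec: 'a) (scal: complex)

text \<open>
  The action of the unitization on \<open>A\<close> by left multiplication. Its operator norm satisfies the
  C*-identity because the action is adjointable for \<open>x\<^sup>\<star> y\<close>, but it is only a seminorm when \<open>A\<close>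
  already has a unit \<open>e\<close>, since \<open>1 - e\<close> then acts as zero. The norm below is therefore its
  maximum with the modulus of the scalar part.
\<close>

definition uact :: "'a::cstar_algebra unitization \<Rightarrow> 'a \<Rightarrow> 'a"
  where "uact u x = vec u * x + scal u *\<^sub>C x"

lemma bounded_linear_uact: "bounded_linear (uact u)"
proof -
  have "bounded_linear (\<lambda>x. vec u * x + scal u *\<^sub>C x)"
    by (intro bounded_linear_add bounded_linear_mult_right bounded_linear_scaleC)
  then show ?thesis by (simp add: uact_def[abs_def])
qed

lemma norm_uact_le: "norm (uact u x) \<le> onorm (uact u) * norm x"
  by (rule onorm[OF bounded_linear_uact])

instantiation unitization :: (cstar_algebra) complex_normed_algebra
begin

definition "0 = Unitization 0 0"
definition "u + v = Unitization (vec u + vec v) (scal u + scal v)"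
definition "u - v = Unitization (vec u - vec v) (scal u - scal v)"
definition "- u = Unitization (- vec u) (- scal u)"
definition "u * v =
  Unitization (vec u * vec v + scal u *\<^sub>C vec v + scal v *\<^sub>C vec u) (scal u * scal v)"
definition "r *\<^sub>R u = Unitization (r *\<^sub>R vec u) (r *\<^sub>R scal u)"
definition "c *\<^sub>C u = Unitization (c *\<^sub>C vec u) (c * scal u)"
definition "norm u = max (onorm (uact u)) (cmod (scal u))"
definition "dist (u::'a unitization) v = norm (u - v)"
definition "sgn (u::'a unitization) = inverse (norm u) *\<^sub>R u"
definition "uniformity = (INF e\<in>{0<..}. principal {(u::'a unitization, v). dist u v < e})"
definition "open (U::'a unitization set) =
  (\<forall>u\<in>U. \<forall>\<^sub>F (u', v) in uniformity. u' = u \<longrightarrow> v \<in> U)"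

lemma unitization_sel [simp]:
  "vec (0::'a unitization) = 0" "scal (0::'a unitization) = 0"
  "vec (u + v) = vec u + vec v" "scal (u + v) = scal u + scal v"
  "vec (u - v) = vec u - vec v" "scal (u - v) = scal u - scal v"
  "vec (- u) = - vec u" "scal (- u) = - scal u"
  "vec (r *\<^sub>R u) = r *\<^sub>R vec u" "scal (r *\<^sub>R u) = r *\<^sub>R scal u"
  "vec (c *\<^sub>C u) = c *\<^sub>C vec u" "scal (c *\<^sub>C u) = c * scal u"
  "vec (u * v) = vec u * vec v + scal u *\<^sub>C vec v + scal v *\<^sub>C vec u"
  "scal (u * v) = scal u * scal v"
  for u v :: "'a unitization"
  by (simp_all add: zero_unitization_def plus_unitization_def minus_unitization_def
      uminus_unitization_def scaleR_unitization_def scaleC_unitization_def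
      times_unitization_def)

lemma uact_mult: "uact (u * v) x = uact u (uact v x)"
  by (simp add: uact_def algebra_simps scaleC_add_right mult_scaleC_left mult_scaleC_right
      scaleC_scaleC)

lemma norm_unitization_eqI:
  assumes "scal u = 0" "\<And>x. uact u x = 0"
  shows "u = 0"
proof -
  have "vec u * (vec u)\<^sup>\<star> = 0"
    using assms(2)[of "(vec u)\<^sup>\<star>"] by (simp add: uact_def assms(1))
  then have "vec u = 0" using cstar_identity'[of "vec u"] by simp
  then show ?thesis using assms(1) by (simp add: unitization.expand)
qed

lemma onorm_uact_mult: "onorm (uact (u * v)) \<le> onorm (uact u) * onorm (uact v)"
proof -
  have "uact (u * v) = uact u \<circ> uact v" by (simp add: fun_eq_iff uact_mult)
  then show ?thesis by (simp add: onorm_compose bounded_linear_uact)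
qed

text \<open>
  Together with \<open>norm_unitization_le\<close> below, this makes the norm equivalent to the sum of the norms of
  the two parts, whence completeness.
\<close>

lemma norm_vec_le: "norm (vec u) \<le> 2 * norm u"
proof (cases "vec u = 0")
  case False
  have "(norm (vec u))\<^sup>2 = norm (uact u ((vec u)\<^sup>\<star>) - scal u *\<^sub>C (vec u)\<^sup>\<star>)"
    by (simp add: uact_def cstar_identity')
  also have "\<dots> \<le> onorm (uact u) * norm (vec u) + cmod (scal u) * norm (vec u)"
    using norm_uact_le[of u "(vec u)\<^sup>\<star>"]
    by (intro order_trans[OF norm_triangle_ineq4]) (simp add: norm_scaleC)
  also have "\<dots> \<le> (2 * norm u) * norm (vec u)"
    using False by (simp add: norm_unitization_def distrib_right[symmetric])
  finally show ?thesis using False by (simp add: power2_eq_square)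
qed (simp add: norm_unitization_def onorm_pos_le bounded_linear_uact le_max_iff_disj)

lemma norm_unitization_le: "norm u \<le> norm (vec u) + cmod (scal u)"
proof -
  have "norm (uact u x) \<le> (norm (vec u) + cmod (scal u)) * norm x" for x
    unfolding uact_def
    by (rule order_trans[OF norm_triangle_ineq])
      (simp add: norm_scaleC distrib_right add_mono norm_mult_ineq)
  then have "onorm (uact u) \<le> norm (vec u) + cmod (scal u)"
    by (intro onorm_bound) auto
  then show ?thesis by (simp add: norm_unitization_def)
qed

instance
proof
  fix u v w :: "'a unitization" and c d :: complex and r s :: real
  show "u + v + w = u + (v + w)" "u + v = v + u" "0 + u = u" "- u + u = 0" "u - v = u + - v"
    "r *\<^sub>R (u + v) = r *\<^sub>R u + r *\<^sub>R v" "(r + s) *\<^sub>R u = r *\<^sub>R u + s *\<^sub>R u"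
    "r *\<^sub>R s *\<^sub>R u = (r * s) *\<^sub>R u" "1 *\<^sub>R u = u"
    "c *\<^sub>C (u + v) = c *\<^sub>C u + c *\<^sub>C v" "(c + d) *\<^sub>C u = c *\<^sub>C u + d *\<^sub>C u"
    "c *\<^sub>C d *\<^sub>C u = (c * d) *\<^sub>C u" "complex_of_real r *\<^sub>C u = r *\<^sub>R u"
    by (simp_all add: unitization.expand algebra_simps scaleC_add_right scaleC_add_left
        scaleC_scaleC scaleC_of_real scaleR_conv_of_real)
  show "u * v * w = u * (v * w)" "(u + v) * w = u * w + v * w" "u * (v + w) = u * v + u * w"
    "c *\<^sub>C u * v = c *\<^sub>C (u * v)" "u * c *\<^sub>C v = c *\<^sub>C (u * v)"
    by (simp_all add: unitization.expand algebra_simps scaleC_add_right scaleC_add_left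
        scaleC_scaleC scaleC_of_real[symmetric] scaleR_conv_of_real mult_scaleC_left
        mult_scaleC_right)
  show "r *\<^sub>R u * v = r *\<^sub>R (u * v)" "u * r *\<^sub>R v = r *\<^sub>R (u * v)"
    by (simp_all add: unitization.expand algebra_simps scaleR_scaleC scaleC_scaleR)
  have *: "onorm (uact (u + v)) \<le> onorm (uact u) + onorm (uact v)"
  proof -
    have "uact (u + v) = (\<lambda>x. uact u x + uact v x)"
      by (simp add: fun_eq_iff uact_def algebra_simps scaleC_add_left)
    then show ?thesis by (simp add: onorm_triangle bounded_linear_uact)
  qed
  show "norm (u + v) \<le> norm u + norm v"
    using * norm_triangle_ineq[of "scal u" "scal v"] by (simp add: norm_unitization_def max_def)
  show "norm u = 0 \<longleftrightarrow> u = 0"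
  proof
    assume "norm u = 0"
    then have "onorm (uact u) \<le> 0" "scal u = 0"
      by (simp_all add: norm_unitization_def max_def split: if_splits)
    moreover from this(1) have "uact u x = 0" for x
      using order_trans[OF norm_uact_le mult_right_mono[OF _ norm_ge_zero], of u 0 x] by simp
    ultimately show "u = 0" by (intro norm_unitization_eqI)
  next
    assume "u = 0"
    then show "norm u = 0" using norm_unitization_le[of u]
      by (simp add: norm_unitization_def)
  qed
  have "onorm (uact (c *\<^sub>C u)) = cmod c * onorm (uact u)" for c
  proof -
    have "norm (uact (c *\<^sub>C u) x) = norm (cmod c *\<^sub>R uact u x)" for x
    proof -
      have "uact (c *\<^sub>C u) x = c *\<^sub>C uact u x"
        by (simp add: uact_def scaleC_add_right mult_scaleC_left scaleC_scaleC)
      then show ?thesis by (simp add: norm_scaleC)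
    qed
    then have "onorm (uact (c *\<^sub>C u)) = onorm (\<lambda>x. cmod c *\<^sub>R uact u x)"
      by (simp add: onorm_def)
    then show ?thesis by (simp add: onorm_scaleR[OF bounded_linear_uact])
  qed
  then show nC: "norm (c *\<^sub>C u) = cmod c * norm u" for c
    by (simp add: norm_unitization_def norm_mult max_mult_distrib_left)
  have "r *\<^sub>R u = complex_of_real r *\<^sub>C u"
    by (simp add: unitization.expand scaleC_of_real scaleR_conv_of_real)
  then show "norm (r *\<^sub>R u) = \<bar>r\<bar> * norm u"
    by (simp add: nC)
  show "norm (u * v) \<le> norm u * norm v"
    using onorm_uact_mult[of u v] onorm_pos_le[OF bounded_linear_uact, of u]
      onorm_pos_le[OF bounded_linear_uact, of v]
    by (auto simp: norm_unitization_def norm_mult intro!: mult_mono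
        intro: order_trans[OF onorm_uact_mult])
qed (fact dist_unitization_def sgn_unitization_def uniformity_unitization_def
    open_unitization_def)+

end

instantiation unitization :: (cstar_algebra) cstar_algebra
begin

definition "u\<^sup>\<star> = Unitization ((vec u)\<^sup>\<star>) (cnj (scal u))"

lemma unitization_star_sel [simp]:
  "vec (u\<^sup>\<star>) = (vec u)\<^sup>\<star>" "scal (u\<^sup>\<star>) = cnj (scal u)"
  for u :: "'a unitization"
  by (simp_all add: star_unitization_def)

lemma uact_star_mult: "(uact u x)\<^sup>\<star> * y = x\<^sup>\<star> * uact (u\<^sup>\<star>) y"
  by (simp add: uact_def star_add star_mult star_scaleC algebra_simps mult_scaleC_left
      mult_scaleC_right)

text \<open>
  The usual argument for operators on a Hilbert space, with \<open>x\<^sup>\<star> y\<close> in place of the inner product.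
\<close>

lemma onorm_uact_star_mult: "(onorm (uact u))\<^sup>2 \<le> onorm (uact (u\<^sup>\<star> * u))"
proof -
  have nn: "0 \<le> onorm (uact (u\<^sup>\<star> * u))" by (rule onorm_pos_le[OF bounded_linear_uact])
  have "onorm (uact u) \<le> sqrt (onorm (uact (u\<^sup>\<star> * u)))"
  proof (rule onorm_bound)
    fix x
    have "(norm (uact u x))\<^sup>2 = norm (x\<^sup>\<star> * uact (u\<^sup>\<star> * u) x)"
      by (simp add: cstar_identity[symmetric] uact_star_mult uact_mult)
    also have "\<dots> \<le> norm x * (onorm (uact (u\<^sup>\<star> * u)) * norm x)"
      by (rule order_trans[OF norm_mult_ineq]) (simp add: mult_left_mono norm_uact_le)
    also have "\<dots> = (sqrt (onorm (uact (u\<^sup>\<star> * u))) * norm x)\<^sup>2"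
      using nn by (simp add: power_mult_distrib power2_eq_square)
    finally show "norm (uact u x) \<le> sqrt (onorm (uact (u\<^sup>\<star> * u))) * norm x"
      by (rule power2_le_imp_le) (simp add: nn)
  qed (simp add: nn)
  then have "(onorm (uact u))\<^sup>2 \<le> (sqrt (onorm (uact (u\<^sup>\<star> * u))))\<^sup>2"
    by (rule power_mono) (rule onorm_pos_le[OF bounded_linear_uact])
  then show ?thesis using nn by simp
qed

lemma onorm_uact_star: "onorm (uact (u\<^sup>\<star>)) = onorm (uact u)"
proof -
  have le: "onorm (uact v) \<le> onorm (uact (v\<^sup>\<star>))" for v :: "'a unitization"
  proof (cases "onorm (uact v) = 0")
    case False
    then have "onorm (uact v) > 0" using onorm_pos_le[OF bounded_linear_uact, of v] by simp
    moreover have "onorm (uact v) * onorm (uact v) \<le> onorm (uact (v\<^sup>\<star>)) * onorm (uact v)"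
      using onorm_uact_star_mult[of v] onorm_uact_mult[of "v\<^sup>\<star>" v] by (simp add: power2_eq_square)
    ultimately show ?thesis by simp
  qed (simp add: onorm_pos_le bounded_linear_uact)
  have ss: "(u\<^sup>\<star>)\<^sup>\<star> = u" by (simp add: unitization.expand star_star)
  show ?thesis using le[of u] le[of "u\<^sup>\<star>"] by (simp add: ss)
qed

instance
proof
  fix u v :: "'a unitization" and c :: complex
  show "(u + v)\<^sup>\<star> = u\<^sup>\<star> + v\<^sup>\<star>" "(c *\<^sub>C u)\<^sup>\<star> = cnj c *\<^sub>C u\<^sup>\<star>" "(u\<^sup>\<star>)\<^sup>\<star> = u"
    "(u * v)\<^sup>\<star> = v\<^sup>\<star> * u\<^sup>\<star>"
    by (simp_all add: unitization.expand algebra_simps star_add star_scaleC star_star star_mult)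
  have "onorm (uact (u\<^sup>\<star> * u)) = (onorm (uact u))\<^sup>2"
    using onorm_uact_star_mult[of u] onorm_uact_mult[of "u\<^sup>\<star>" u]
    by (simp add: onorm_uact_star power2_eq_square)
  moreover have "max (a\<^sup>2) (b\<^sup>2) = (max a b)\<^sup>2" if "a \<ge> 0" "b \<ge> 0" for a b :: real
    using that by (simp add: max_def power_mono_iff)
  ultimately show "norm (u\<^sup>\<star> * u) = (norm u)\<^sup>2"
    using onorm_pos_le[OF bounded_linear_uact, of u]
    by (simp add: norm_unitization_def norm_mult power2_eq_square[symmetric])
next
  fix F :: "nat \<Rightarrow> 'a unitization"
  assume F: "Cauchy F"
  have d: "norm (vec u - vec v) \<le> 2 * dist u v" "cmod (scal u - scal v) \<le> dist u v"
    "dist u v \<le> norm (vec u - vec v) + cmod (scal u - scal v)" for u v :: "'a unitization"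
    using norm_vec_le[of "u - v"] norm_unitization_le[of "u - v"]
    by (simp_all add: dist_unitization_def norm_unitization_def)
  have "Cauchy (\<lambda>n. scal (F n))" 
    unfolding Cauchy_def dist_norm
    using F[unfolded Cauchy_def] d(2) by (meson order_le_less_trans)
  moreover have "Cauchy (\<lambda>n. vec (F n))"
    unfolding Cauchy_def dist_norm
  proof (intro allI impI)
    fix e :: real assume "e > 0"
    then obtain M where M: "\<forall>m\<ge>M. \<forall>n\<ge>M. dist (F m) (F n) < e / 2"
      using F[unfolded Cauchy_def] half_gt_zero by blast
    then show "\<exists>M. \<forall>m\<ge>M. \<forall>n\<ge>M. norm (vec (F m) - vec (F n)) < e"
      using d(1) by (intro exI[of _ M]) (smt (verit, best) field_sum_of_halves)
  qed
  ultimately obtain a l where "(\<lambda>n. scal (F n)) \<longlonglongrightarrow> l" "(\<lambda>n. vec (F n)) \<longlonglongrightarrow> a"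
    by (auto simp: Cauchy_convergent_iff convergent_def)
  then have "(\<lambda>n. norm (vec (F n) - a) + cmod (scal (F n) - l)) \<longlonglongrightarrow> 0 + 0"
    by (intro tendsto_add tendsto_norm_zero) (simp_all add: LIM_zero)
  then have lim: "(\<lambda>n. norm (vec (F n) - a) + cmod (scal (F n) - l)) \<longlonglongrightarrow> 0" by simp
  have "(\<lambda>n. dist (F n) (Unitization a l)) \<longlonglongrightarrow> 0"
    by (rule Lim_null_comparison[OF _ lim])
      (use d(3)[of _ "Unitization a l"] in auto)
  then have "F \<longlonglongrightarrow> Unitization a l"
    by (simp add: tendsto_dist_iff[of F])
  then show "convergent F" by (auto simp: convergent_def)
qed

end

instantiation unitization :: (cstar_algebra) real_normed_algebra_1
begin
definition "1 = Unitization 0 1"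
instance
proof
  fix u :: "'a unitization"
  have [simp]: "vec (1::'a unitization) = 0" "scal (1::'a unitization) = 1"
    by (simp_all add: one_unitization_def)
  show "1 * u = u" "u * 1 = u" by (simp_all add: unitization.expand)
  show "(0::'a unitization) \<noteq> 1" by (metis unitization_sel(2) \<open>scal 1 = 1\<close> zero_neq_one)
  have "onorm (uact (1::'a unitization)) \<le> 1"
    by (rule onorm_bound) (simp_all add: uact_def)
  then show "norm (1::'a unitization) = 1" by (simp add: norm_unitization_def)
qed
end

abbreviation emb :: "'a::cstar_algebra \<Rightarrow> 'a unitization" where "emb a \<equiv> Unitization a 0"

lemma one_unitization_sel [simp]:
  "vec (1::'a::cstar_algebra unitization) = 0" "scal (1::'a::cstar_algebra unitization) = 1"
  by (simp_all add: one_unitization_def)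

lemma emb_vec: "scal u = 0 \<Longrightarrow> emb (vec u) = u"
  by (simp add: unitization.expand)

lemma emb_star: "(emb a)\<^sup>\<star> = emb (a\<^sup>\<star>)"
  by (simp add: unitization.expand)

lemma emb_mult: "emb a * emb b = emb (a * b)"
  by (simp add: unitization.expand)

lemma norm_emb: "norm (emb a) = norm a"
proof (rule antisym)
  show "norm (emb a) \<le> norm a" using norm_unitization_le[of "emb a"] by simp
  show "norm a \<le> norm (emb a)"
  proof (cases "a = 0")
    case False
    have "norm a * norm a = norm (uact (emb a) (a\<^sup>\<star>))"
      by (simp add: uact_def cstar_identity' power2_eq_square)
    also have "\<dots> \<le> onorm (uact (emb a)) * norm a" using norm_uact_le[of "emb a" "a\<^sup>\<star>"] by simp
    finally have "norm a \<le> onorm (uact (emb a))" using False by simp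
    then show ?thesis by (simp add: norm_unitization_def)
  qed simp
qed

lemma bounded_linear_vec: "bounded_linear (vec :: 'a::cstar_algebra unitization \<Rightarrow> 'a)"
  by (rule bounded_linear_intro[where K = 2])
    (use norm_vec_le in \<open>simp_all add: mult.commute\<close>)


section \<open>Polynomials evaluated at unitary elements\<close>

definition aeval :: "'b::real_algebra_1 \<Rightarrow> real poly \<Rightarrow> 'b"
  where "aeval x p = (\<Sum>i\<le>degree p. coeff p i *\<^sub>R x ^ i)"

lemma aeval_eq_sum: "degree p \<le> n \<Longrightarrow> aeval x p = (\<Sum>i\<le>n. coeff p i *\<^sub>R x ^ i)"
  unfolding aeval_def by (intro sum.mono_neutral_left) (auto simp: coeff_eq_0)

lemma aeval_0 [simp]: "aeval x 0 = 0"
  by (simp add: aeval_def)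

lemma aeval_pCons: "aeval x (pCons a p) = a *\<^sub>R 1 + x * aeval x p"
proof -
  have "aeval x (pCons a p) = (\<Sum>i\<le>Suc (degree p). coeff (pCons a p) i *\<^sub>R x ^ i)"
    by (rule aeval_eq_sum) (rule degree_pCons_le)
  also have "\<dots> = a *\<^sub>R 1 + x * aeval x p"
    by (simp add: sum.atMost_Suc_shift aeval_def sum_distrib_left del: sum.atMost_Suc)
  finally show ?thesis .
qed

lemma aeval_add: "aeval x (p + q) = aeval x p + aeval x q"
proof -
  define n where "n = max (degree p) (degree q)"
  have "degree p \<le> n" "degree q \<le> n" "degree (p + q) \<le> n"
    by (simp_all add: n_def degree_add_le_max)
  then show ?thesis by (simp add: aeval_eq_sum[of _ n] scaleR_add_left sum.distrib)
qed

lemma aeval_smult: "aeval x (smult c p) = c *\<^sub>R aeval x p"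
  by (induction p) (simp_all add: aeval_pCons scaleR_add_right)

lemma aeval_mult: "aeval x (p * q) = aeval x p * aeval x q"
  by (induction p) (simp_all add: aeval_pCons aeval_add aeval_smult algebra_simps)

lemma aeval_1 [simp]: "aeval x 1 = 1"
  by (simp add: one_pCons aeval_pCons)

lemma aeval_power: "aeval x (p ^ n) = aeval x p ^ n"
  by (induction n) (simp_all add: aeval_mult)

lemma aeval_sum: "aeval x (\<Sum>i\<in>A. f i) = (\<Sum>i\<in>A. aeval x (f i))"
  by (induction A rule: infinite_finite_induct) (simp_all add: aeval_add)

lemma aeval_complex_of_real: "aeval (complex_of_real t) p = complex_of_real (poly p t)"
  by (induction p) (simp_all add: aeval_pCons scaleR_conv_of_real)

lemma sum_powers_root_of_unity:
  assumes "0 < n" "n < 2 * M" "n \<noteq> M"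
  shows "(\<Sum>j<M. (cis (2 * pi / M) ^ n) ^ j) = 0"
proof -
  define z where "z = cis (2 * pi / M) ^ n"
  have M: "M > 0" using assms by simp
  have "cis (2 * pi / M) ^ M = 1" using M by (simp only: Complex.DeMoivre) simp
  then have zM: "z ^ M = 1"
    unfolding z_def by (metis power_commuting_commutes power_mult mult.commute power_one)
  have "z \<noteq> 1"
  proof
    assume "z = 1"
    then have "cos (2 * pi / M * n) = 1"
      by (auto simp: z_def Complex.DeMoivre complex_eq_iff mult.commute)
    then obtain k :: int where "2 * pi / M * n = k * 2 * pi"
      by (auto simp: cos_one_2pi_int)
    then have "real n = real_of_int k * real M" using M by (simp add: field_simps)
    then have k: "int n = k * int M" by (metis of_int_eq_iff of_int_mult of_int_of_nat_eq)
    then have "0 < k" using assms(1) M by (metis of_nat_0_less_iff zero_less_mult_pos2)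
    moreover have "k < 2" using k assms(2) M 
      by (metis mult_less_cancel_right_pos of_nat_0_less_iff of_nat_less_iff of_nat_mult of_nat_numeral)
    ultimately have "k = 1" by simp
    then show False using k assms(3) by simp
  qed
  then show ?thesis using zM by (simp add: geometric_sum z_def[symmetric])
qed

text \<open>
  A coefficient is an average of the polynomial over roots of unity.
\<close>

lemma coeff_bound:
  assumes B: "\<And>z::complex. norm z = 1 \<Longrightarrow> norm (aeval z p) \<le> B"
  shows "\<bar>coeff p k\<bar> \<le> B"
proof (cases "k \<le> degree p")
  case False
  then show ?thesis using order_trans[OF norm_ge_zero B[of 1]] by (simp add: coeff_eq_0)
next
  case True
  define M where "M = Suc (degree p)"
  define w where "w = cis (2 * pi / M)"
  \<comment> \<open>The factor \<open>(w ^ j) ^ (M - k)\<close> is the inverse of \<open>(w ^ j) ^ k\<close>, as \<open>w ^ M = 1\<close>.\<close>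
  have "(\<Sum>j<M. (w ^ j) ^ (M - k) * aeval (w ^ j) p)
      = (\<Sum>j<M. \<Sum>i\<le>degree p. of_real (coeff p i) * (w ^ (i + (M - k))) ^ j)"
    by (intro sum.cong refl)
      (simp add: aeval_def sum_distrib_left scaleR_conv_of_real power_mult[symmetric]
        power_add mult_ac distrib_left power_mult_distrib)
  also have "\<dots> = (\<Sum>i\<le>degree p. of_real (coeff p i) * (\<Sum>j<M. (w ^ (i + (M - k))) ^ j))"
    by (subst sum.swap) (simp add: sum_distrib_left)
  also have "\<dots> = (\<Sum>i\<le>degree p. if i = k then of_real (coeff p k) * of_nat M else 0)"
  proof (intro sum.cong refl)
    fix i assume i: "i \<in> {..degree p}"
    show "of_real (coeff p i) * (\<Sum>j<M. (w ^ (i + (M - k))) ^ j)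
        = (if i = k then of_real (coeff p k) * of_nat M else 0)"
    proof (cases "i = k")
      case True
      have "w ^ M = 1" by (simp only: w_def Complex.DeMoivre) (simp add: M_def)
      then show ?thesis using True \<open>k \<le> degree p\<close> by (simp add: M_def)
    next
      case False
      then have "(\<Sum>j<M. (w ^ (i + (M - k))) ^ j) = 0"
        unfolding w_def using i \<open>k \<le> degree p\<close>
        by (intro sum_powers_root_of_unity) (auto simp: M_def)
      then show ?thesis using False by simp
    qed
  qed
  also have "\<dots> = of_real (coeff p k) * of_nat M" using True by simp
  finally have eq: "of_real (coeff p k) * of_nat M = (\<Sum>j<M. (w ^ j) ^ (M - k) * aeval (w ^ j) p)"
    by simp
  have "\<bar>coeff p k\<bar> * real M = norm (of_real (coeff p k) * of_nat M :: complex)"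
    by (simp add: norm_mult)
  also have "\<dots> \<le> (\<Sum>j<M. B)"
    unfolding eq
    by (rule sum_norm_le) (simp add: norm_mult norm_power w_def B)
  finally show ?thesis by (simp add: M_def mult.commute)
qed

lemma star_1 [simp]: "1\<^sup>\<star> = (1::'b::{cstar_algebra,real_normed_algebra_1})"
  by (metis mult_1_left mult_1_right star_mult star_star)

lemma star_power: "(x ^ n)\<^sup>\<star> = (x\<^sup>\<star>) ^ n" for x :: "'b::{cstar_algebra,real_normed_algebra_1}"
  by (induction n) (simp_all add: star_mult power_commutes)

lemma star_aeval: "(aeval x p)\<^sup>\<star> = aeval (x\<^sup>\<star>) p" for x :: "'b::{cstar_algebra,real_normed_algebra_1}"
proof (induction p)
  case (pCons a p)
  have "aeval x p * x = x * aeval x p" for x :: 'b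
    by (simp add: aeval_def sum_distrib_left sum_distrib_right power_commutes)
  then show ?case by (simp add: aeval_pCons star_add star_scaleR star_mult pCons.IH)
qed simp

lemma aeval_commute:
  assumes "x * y = y * x"
  shows "aeval x p * aeval y q = aeval y q * aeval x p"
proof -
  have 1: "x * aeval y q = aeval y q * x" if xy: "x * y = y * x" for x y :: 'a and q
  proof (induction q)
    case (pCons a q)
    have "x * (y * aeval y q) = y * (x * aeval y q)" by (simp add: mult.assoc[symmetric] xy)
    then show ?case by (simp add: aeval_pCons algebra_simps pCons.IH)
  qed simp
  show ?thesis using 1[of "aeval y q" x p] 1[OF assms] by simp
qed

text \<open>
  The C*-identity gives \<open>\<bar>x\<^sup>2\<bar> = \<bar>x\<bar>\<^sup>2\<close> for a normal element, and squares of normal elements are normal.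
\<close>

lemma norm_power_of_2_normal:
  fixes x :: "'b::{cstar_algebra,real_normed_algebra_1}"
  assumes "x\<^sup>\<star> * x = x * x\<^sup>\<star>"
  shows "norm (x ^ (2 ^ n)) = norm x ^ (2 ^ n)"
  using assms
proof (induction n arbitrary: x)
  case (Suc n)
  have "x\<^sup>\<star> * (x * y) = x * (x\<^sup>\<star> * y)" for y
    by (simp add: mult.assoc[symmetric] Suc.prems)
  note eq = this Suc.prems mult.assoc
  have "(norm (x * x))\<^sup>2 = norm ((x\<^sup>\<star> * x)\<^sup>\<star> * (x\<^sup>\<star> * x))"
    unfolding cstar_identity[symmetric] by (simp add: star_mult star_star eq)
  also have "\<dots> = ((norm x)\<^sup>2)\<^sup>2"
    by (simp only: cstar_identity)
  finally have "norm (x * x) = (norm x)\<^sup>2" by (simp only: power2_eq_iff_nonneg norm_ge_zero zero_le_power2)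
  moreover have "(x * x)\<^sup>\<star> * (x * x) = (x * x) * (x * x)\<^sup>\<star>"
    by (simp add: star_mult eq)
  ultimately show ?case
    using Suc.IH[of "x * x"] by (simp add: power_mult power2_eq_square)
qed simp

lemma norm_unitary_power_le:
  fixes u :: "'b::{cstar_algebra,real_normed_algebra_1}"
  assumes "u\<^sup>\<star> * u = 1"
  shows "norm (u ^ n) \<le> 1"
proof -
  have "(norm u)\<^sup>2 = 1" using cstar_identity[of u] assms by simp
  then have "norm u = 1" using norm_ge_zero[of u] by (simp only: power2_eq_1_iff) linarith
  then show ?thesis using norm_power_ineq[of u n] by simp
qed

lemma power_le_linear_imp_le_1:
  fixes r c :: real
  assumes "r \<ge> 0" and "\<And>n. r ^ (2 ^ n) \<le> c * 2 ^ n + 1"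
  shows "r \<le> 1"
proof (rule ccontr)
  assume "\<not> r \<le> 1"
  then have r: "r > 1" by simp
  have "(\<lambda>n. c * (of_nat n / r ^ n) + inverse r ^ n) \<longlonglongrightarrow> c * 0 + 0"
    using r by (intro tendsto_intros lim_n_over_pown LIMSEQ_power_zero) (auto simp: inverse_less_1_iff)
  then have "\<forall>\<^sub>F n in sequentially. c * (of_nat n / r ^ n) + inverse r ^ n < 1"
    by (rule order_tendstoD) simp
  then obtain N where N: "\<And>n. n \<ge> N \<Longrightarrow> c * (of_nat n / r ^ n) + inverse r ^ n < 1"
    by (auto simp: eventually_sequentially)
  have "N \<le> 2 ^ N" by (simp add: less_imp_le)
  then have "c * (of_nat (2 ^ N) / r ^ (2 ^ N)) + inverse r ^ (2 ^ N) < 1" by (rule N)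
  then have "(c * 2 ^ N + 1) / r ^ (2 ^ N) < 1" by (simp add: add_divide_distrib divide_simps)
  then have "c * 2 ^ N + 1 < r ^ (2 ^ N)" using r by (simp add: divide_less_eq)
  then show False using assms(2)[of N] by simp
qed

text \<open>
  All powers of \<open>u\<close> have norm at most one, so a crude estimate of \<open>p\<^sup>N(u)\<close> through the coefficients of
  \<open>p\<^sup>N\<close> loses only a factor linear in \<open>N\<close>, and this factor disappears when the root of order \<open>N\<close> is taken.
\<close>

lemma norm_aeval_unitary_le:
  fixes u :: "'b::{cstar_algebra,real_normed_algebra_1}"
  assumes u: "u\<^sup>\<star> * u = 1" "u * u\<^sup>\<star> = 1"
    and B: "\<And>z::complex. norm z = 1 \<Longrightarrow> norm (aeval z p) \<le> B"
  shows "norm (aeval u p) \<le> B"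
proof (rule dense_ge)
  fix C assume "B < C"
  then have C: "C > 0" using order_trans[OF norm_ge_zero B[of 1]] by simp
  define y where "y = aeval u p"
  have "y\<^sup>\<star> * y = y * y\<^sup>\<star>"
    unfolding y_def star_aeval using u by (intro aeval_commute) simp
  then have y: "norm (y ^ (2 ^ n)) = norm y ^ (2 ^ n)" for n by (rule norm_power_of_2_normal)
  have "(norm y / C) ^ (2 ^ n) \<le> real (degree p) * 2 ^ n + 1" for n
  proof -
    define N :: nat where "N = 2 ^ n"
    have "norm (coeff (p ^ N) i *\<^sub>R u ^ i) \<le> C ^ N" for i
    proof -
      have "norm (aeval z (p ^ N)) \<le> C ^ N" if "norm z = 1" for z :: complex
        using B[OF that] \<open>B < C\<close> by (simp add: aeval_power norm_power power_mono)
      then have "\<bar>coeff (p ^ N) i\<bar> \<le> C ^ N" by (rule coeff_bound)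
      then show ?thesis
        using norm_unitary_power_le[OF u(1), of i] mult_mono[of "\<bar>coeff (p ^ N) i\<bar>" "C ^ N" "norm (u ^ i)" 1] C
        by simp
    qed
    then have "norm (aeval u (p ^ N)) \<le> (\<Sum>i\<le>degree (p ^ N). C ^ N)"
      unfolding aeval_def by (intro sum_norm_le) simp
    also have "\<dots> = (real (degree (p ^ N)) + 1) * C ^ N" by simp
    also have "\<dots> \<le> (real (degree p * N) + 1) * C ^ N"
      using C degree_power_le[of p N] by (intro mult_right_mono) (auto simp del: of_nat_mult)
    finally have "norm y ^ N \<le> (real (degree p * N) + 1) * C ^ N"
      using y[of n] by (simp add: y_def aeval_power N_def)
    then show ?thesis using C by (simp add: power_divide field_simps N_def)
  qed
  then have "norm y / C \<le> 1" using C by (intro power_le_linear_imp_le_1) auto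
  then show "norm (aeval u p) \<le> C" using C by (simp add: y_def)
qed


section \<open>Continuous functional calculus of a self-adjoint element\<close>

text \<open>
  The unitary is \<open>u = h + \<i> y\<close> with \<open>y\<close> the square root of \<open>1 - h\<^sup>2\<close> given by the binomial series. The last
  two conclusions express \<open>2 h = u + u\<^sup>-\<^sup>1\<close> without inverses.
\<close>

lemma self_adjoint_average_of_unitary:
  fixes h :: "'b::{cstar_algebra,real_normed_algebra_1}"
  assumes h: "h\<^sup>\<star> = h" "norm h < 1"
  obtains u where "u\<^sup>\<star> * u = 1" "u * u\<^sup>\<star> = 1" "h * u = u * h" "u * u + 1 = 2 *\<^sub>R (h * u)"
proof -
  define x where "x = - (h * h)"
  define c where "c k = ((1/2::real) gchoose k)" for k
  define y where "y = (\<Sum>k. c k *\<^sub>R x ^ k)"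
  have "norm x \<le> norm h * norm h" unfolding x_def using norm_mult_ineq[of h h] by simp
  also have "\<dots> < 1" using mult_strict_mono[of "norm h" 1 "norm h" 1] h(2) by simp
  finally have x: "norm x < 1" .
  have "(1/2::real) \<notin> \<nat>"
  proof
    assume "(1/2::real) \<in> \<nat>"
    then obtain n where "1/2 = real n" by (auto elim: Nats_cases)
    then show False by (cases n) auto
  qed
  then have "summable (\<lambda>k. norm (c k * norm x ^ k))"
    unfolding c_def using x by (intro abs_summable_in_conv_radius) (simp add: conv_radius_gchoose)
  then have sm: "summable (\<lambda>k. norm (c k *\<^sub>R x ^ k))"
    by (rule summable_comparison_test'[of _ 0])
      (simp add: abs_mult mult_left_mono norm_power_ineq)
  have "(\<lambda>k. \<Sum>i\<le>k. (c i *\<^sub>R x ^ i) * (c (k - i) *\<^sub>R x ^ (k - i))) sums (y * y)"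
    unfolding y_def by (rule Cauchy_product_sums[OF sm sm])
  \<comment> \<open>By Vandermonde's identity the coefficients of the square are the binomial coefficients of 1.\<close>
  moreover have "(\<Sum>i\<le>k. (c i *\<^sub>R x ^ i) * (c (k - i) *\<^sub>R x ^ (k - i)))
      = (if k = 0 then 1 else if k = 1 then x else 0)" for k
  proof -
    have "(\<Sum>i\<le>k. (c i *\<^sub>R x ^ i) * (c (k - i) *\<^sub>R x ^ (k - i))) = (\<Sum>i\<le>k. c i * c (k - i)) *\<^sub>R x ^ k"
      by (simp add: scaleR_sum_left power_add[symmetric] mult.commute)
    also have "(\<Sum>i\<le>k. c i * c (k - i)) = real (1 choose k)"
      using gbinomial_Vandermonde[of "1/2::real" "1/2" k] binomial_gbinomial[of 1 k, where 'a = real]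
      by (simp add: c_def atMost_atLeast0)
    finally show ?thesis by (cases k) (auto simp: binomial_eq_0)
  qed
  moreover have "(\<lambda>k. if k = 0 then 1 else if k = 1 then x else 0) sums (1 + x)"
    using sums_finite[of "{0,1::nat}" "\<lambda>k. if k = 0 then 1 else if k = 1 then x else 0"] by simp
  ultimately have yy: "y * y = 1 - h * h"
    by (simp add: sums_iff x_def)
  have s: "summable (\<lambda>k. c k *\<^sub>R x ^ k)" by (rule summable_norm_cancel[OF sm])
  have xs: "x\<^sup>\<star> = x" by (simp add: x_def star_minus star_mult h)
  have "y\<^sup>\<star> = (\<Sum>k. (c k *\<^sub>R x ^ k)\<^sup>\<star>)"
    unfolding y_def by (rule bounded_linear.suminf[OF bounded_linear_star s])
  then have ys: "y\<^sup>\<star> = y" by (simp add: y_def star_scaleR star_power xs)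
  have "x ^ k * h = h * x ^ k" for k
    by (rule power_commuting_commutes) (simp add: x_def mult.assoc)
  then have xh: "(c k *\<^sub>R x ^ k) * h = h * (c k *\<^sub>R x ^ k)" for k by simp
  have "h * y = (\<Sum>k. h * (c k *\<^sub>R x ^ k))"
    unfolding y_def by (rule bounded_linear.suminf[OF bounded_linear_mult_right s])
  moreover have "y * h = (\<Sum>k. (c k *\<^sub>R x ^ k) * h)"
    unfolding y_def by (rule bounded_linear.suminf[OF bounded_linear_mult_left s])
  ultimately have "h * y = y * h" by (simp only: xh)
  note hy = this
  define u where "u = h + \<i> *\<^sub>C y"
  have us: "u\<^sup>\<star> = h - \<i> *\<^sub>C y" by (simp add: u_def star_add star_scaleC ys h)
  have uu: "u * u = h * h - y * y + 2 *\<^sub>R (\<i> *\<^sub>C (h * y))"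
    unfolding u_def
    by (simp add: algebra_simps mult_scaleC_left mult_scaleC_right scaleC_scaleC hy scaleR_2
        complex_vector.scale_minus_left)
  show ?thesis
  proof (rule that)
    show "u\<^sup>\<star> * u = 1" "u * u\<^sup>\<star> = 1"
      unfolding us by (simp_all add: u_def algebra_simps mult_scaleC_left mult_scaleC_right
          scaleC_scaleC hy yy)
    show "h * u = u * h"
      by (simp add: u_def algebra_simps mult_scaleC_left mult_scaleC_right hy)
    show "u * u + 1 = 2 *\<^sub>R (h * u)"
      unfolding uu by (simp add: u_def yy algebra_simps mult_scaleC_right scaleR_2)
  qed
qed

text \<open>
  The polynomial \<open>z ^ n * p ((z + 1/z) / 2)\<close> with \<open>n\<close> the degree of \<open>p\<close>. On the unit circle it has the
  modulus of \<open>p (Re z)\<close>, and at the unitary \<open>u\<close> above it is \<open>u ^ n\<close> times \<open>p\<close> at \<open>h\<close>.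
\<close>

definition joukowski :: "real poly \<Rightarrow> real poly"
  where "joukowski p = (\<Sum>i\<le>degree p. smult (coeff p i * (1/2) ^ i)
    (([:0, 1:] ^ 2 + 1) ^ i * [:0, 1:] ^ (degree p - i)))"

lemma aeval_joukowski:
  assumes hu: "h * u = u * h" and eq: "u * u + 1 = 2 *\<^sub>R (h * u)"
  shows "aeval u (joukowski p) = u ^ degree p * aeval h p"
proof -
  have comm: "u * h ^ i = h ^ i * u" for i
    using power_commuting_commutes[OF hu] by simp
  have pw: "(u * u + 1) ^ i = 2 ^ i *\<^sub>R (h ^ i * u ^ i)" for i
  proof (induction i)
    case (Suc i)
    have "(u * u + 1) ^ Suc i = (2 * 2 ^ i) *\<^sub>R (h * (u * h ^ i) * u ^ i)"
      unfolding power_Suc Suc.IH unfolding eq by (simp add: mult.assoc)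
    also have "h * (u * h ^ i) * u ^ i = h ^ Suc i * u ^ Suc i"
      unfolding comm by (simp add: mult.assoc)
    finally show ?case by simp
  qed simp
  have "(u * u + 1) ^ i * u ^ (degree p - i) = 2 ^ i *\<^sub>R (u ^ degree p * h ^ i)" if "i \<le> degree p" for i
  proof -
    have "u ^ n * h ^ i = h ^ i * u ^ n" for n
      by (rule power_commuting_commutes) (rule comm)
    then show ?thesis using that by (simp add: pw mult.assoc power_add[symmetric])
  qed
  then have "aeval u (joukowski p)
      = (\<Sum>i\<le>degree p. (coeff p i * (1/2) ^ i) *\<^sub>R 2 ^ i *\<^sub>R (u ^ degree p * h ^ i))"
    unfolding joukowski_def aeval_sum aeval_smult aeval_mult aeval_power aeval_add
    by (intro sum.cong refl) (simp add: aeval_pCons power2_eq_square)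
  also have "\<dots> = (\<Sum>i\<le>degree p. u ^ degree p * (coeff p i *\<^sub>R h ^ i))"
    by (intro sum.cong refl) (simp add: power_divide)
  finally show ?thesis by (simp add: aeval_def sum_distrib_left)
qed

lemma norm_aeval_self_adjoint_le:
  fixes h :: "'b::{cstar_algebra,real_normed_algebra_1}"
  assumes h: "h\<^sup>\<star> = h" "norm h < 1"
    and B: "\<And>t. \<bar>t\<bar> \<le> 1 \<Longrightarrow> \<bar>poly p t\<bar> \<le> B"
  shows "norm (aeval h p) \<le> B"
proof -
  obtain u where u: "u\<^sup>\<star> * u = 1" "u * u\<^sup>\<star> = 1" "h * u = u * h" "u * u + 1 = 2 *\<^sub>R (h * u)"
    using self_adjoint_average_of_unitary[OF h] .
  have "norm (aeval z (joukowski p)) \<le> B" if z: "norm z = 1" for z :: complex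
  proof -
    have "z * z + z * cnj z = 2 *\<^sub>R (of_real (Re z) * z)"
      by (simp add: distrib_left[symmetric] complex_add_cnj scaleR_conv_of_real)
    moreover have "z * cnj z = 1" using z by (simp add: complex_norm_square[symmetric])
    ultimately have "aeval z (joukowski p) = z ^ degree p * aeval (of_real (Re z)) p"
      by (intro aeval_joukowski) (simp_all add: mult.commute)
    moreover have "\<bar>Re z\<bar> \<le> 1" using abs_Re_le_cmod[of z] z by simp
    ultimately show ?thesis
      using B[of "Re z"] z by (simp add: norm_mult norm_power aeval_complex_of_real)
  qed
  then have "norm (aeval u (joukowski p)) \<le> B" by (rule norm_aeval_unitary_le[OF u(1,2)])
  then have le: "norm (u ^ degree p * aeval h p) \<le> B" using aeval_joukowski[OF u(3,4)] by simp
  have "(u\<^sup>\<star>) ^ n * u ^ n = 1" for n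
  proof (induction n)
    case (Suc n)
    have "(u\<^sup>\<star>) ^ Suc n * u ^ Suc n = (u\<^sup>\<star>) ^ n * (u\<^sup>\<star> * u) * u ^ n"
      by (simp only: power_Suc2[of "u\<^sup>\<star>"] power_Suc[of u] mult.assoc)
    then show ?case using Suc u(1) by simp
  qed simp
  then have "aeval h p = (u\<^sup>\<star>) ^ degree p * (u ^ degree p * aeval h p)"
    by (simp add: mult.assoc[symmetric])
  then have "norm (aeval h p) \<le> norm ((u\<^sup>\<star>) ^ degree p) * norm (u ^ degree p * aeval h p)"
    using norm_mult_ineq[of "(u\<^sup>\<star>) ^ degree p" "u ^ degree p * aeval h p"] by simp
  also have "\<dots> \<le> 1 * B"
    using le u(2) norm_unitary_power_le[of "u\<^sup>\<star>"]
    by (intro mult_mono) (auto simp: star_star)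
  finally show ?thesis by simp
qed

text \<open>
  By the polynomial bound, evaluation at \<open>h\<close> extends from polynomials to continuous functions on
  \<open>[-1, 1]\<close>. At a function that is not continuous there, the value of \<open>\<Psi>\<close> is arbitrary.
\<close>

lemma continuous_functional_calculus:
  fixes h :: "'b::{cstar_algebra,real_normed_algebra_1}"
  assumes h: "h\<^sup>\<star> = h" "norm h < 1"
  obtains \<Psi> :: "(real \<Rightarrow> real) \<Rightarrow> 'b"
  where "\<And>p. \<Psi> (poly p) = aeval h p"
    and "\<And>f g. continuous_on {-1..1} f \<Longrightarrow> continuous_on {-1..1} g \<Longrightarrow> \<Psi> (\<lambda>t. f t + g t) = \<Psi> f + \<Psi> g"
    and "\<And>f g. continuous_on {-1..1} f \<Longrightarrow> continuous_on {-1..1} g \<Longrightarrow> \<Psi> (\<lambda>t. f t * g t) = \<Psi> f * \<Psi> g"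
    and "\<And>f B. continuous_on {-1..1} f \<Longrightarrow> (\<And>t. \<bar>t\<bar> \<le> 1 \<Longrightarrow> \<bar>f t\<bar> \<le> B) \<Longrightarrow> norm (\<Psi> f) \<le> B"
proof -
  define approx where "approx f p \<longleftrightarrow> (\<forall>n t. \<bar>t\<bar> \<le> 1 \<longrightarrow> \<bar>poly (p n) t - f t\<bar> \<le> inverse (Suc n))" for f p
  define \<Psi> where "\<Psi> f = lim (\<lambda>n. aeval h ((SOME p. approx f p) n))" for f
  have ex: "\<exists>p. approx f p" if f: "continuous_on {-1..1} f" for f
  proof -
    have "\<forall>n. \<exists>p. \<forall>t. \<bar>t\<bar> \<le> 1 \<longrightarrow> \<bar>poly p t - f t\<bar> \<le> inverse (Suc n)"
    proof
      fix n
      obtain g where g: "real_polynomial_function g" "\<And>t. t \<in> {-1..1} \<Longrightarrow> \<bar>f t - g t\<bar> < inverse (Suc n)"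
        using Stone_Weierstrass_real_polynomial_function[of "{-1..1::real}" f "inverse (Suc n)"] f by auto
      obtain a m where "g = (\<lambda>x. \<Sum>i\<le>m. a i * x^i)"
        using g(1) by (auto simp: real_polynomial_function_iff_sum)
      then have gp: "g = poly (\<Sum>i\<le>m. monom (a i) i)"
        by (simp add: fun_eq_iff poly_sum poly_monom)
      have "\<bar>g t - f t\<bar> \<le> inverse (Suc n)" if "\<bar>t\<bar> \<le> 1" for t
        using g(2)[of t] that by (auto simp: abs_le_iff abs_minus_commute)
      then show "\<exists>p. \<forall>t. \<bar>t\<bar> \<le> 1 \<longrightarrow> \<bar>poly p t - f t\<bar> \<le> inverse (Suc n)"
        unfolding gp by blast
    qed
    then show ?thesis unfolding approx_def by (rule choice)
  qed
  have close: "norm (aeval h p - aeval h q) \<le> B" if "\<And>t. \<bar>t\<bar> \<le> 1 \<Longrightarrow> \<bar>poly p t - poly q t\<bar> \<le> B" for p q B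
  proof -
    have "aeval h p = aeval h (p - q) + aeval h q" by (simp add: aeval_add[symmetric])
    moreover have "norm (aeval h (p - q)) \<le> B" using that by (intro norm_aeval_self_adjoint_le[OF h]) simp
    ultimately show ?thesis by simp
  qed
  \<comment> \<open>The limit does not depend on the approximating polynomials; the constant \<open>C\<close> accommodates
    sums and products of approximations.\<close>
  have lim_unique: "(\<lambda>n. aeval h (p n)) \<longlonglongrightarrow> \<Psi> f"
    if p: "\<And>n t. \<bar>t\<bar> \<le> 1 \<Longrightarrow> \<bar>poly (p n) t - f t\<bar> \<le> C * inverse (Suc n)"
      and f: "continuous_on {-1..1} f" for p f C
  proof -
    define q where "q = (SOME p. approx f p)"
    have "approx f q" unfolding q_def by (rule someI_ex[OF ex[OF f]])
    then have q: "\<bar>poly (q n) t - f t\<bar> \<le> inverse (Suc n)" if "\<bar>t\<bar> \<le> 1" for n t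
      using that by (auto simp: approx_def)
    have "Cauchy (\<lambda>n. aeval h (q n))"
    proof (rule CauchyI)
      fix e :: real assume "e > 0"
      then obtain N where N: "inverse (real (Suc N)) < e / 2"
        using reals_Archimedean half_gt_zero by blast
      show "\<exists>M. \<forall>m\<ge>M. \<forall>n\<ge>M. norm (aeval h (q m) - aeval h (q n)) < e"
      proof (intro exI allI impI)
        fix m n assume mn: "m \<ge> N" "n \<ge> N"
        have i: "inverse (real (Suc k)) \<le> inverse (real (Suc N))" if "k \<ge> N" for k
          using that by (simp add: le_imp_inverse_le)
        have "norm (aeval h (q m) - aeval h (q n)) \<le> 2 * inverse (real (Suc N))"
        proof (rule close)
          fix t :: real assume t: "\<bar>t\<bar> \<le> 1"
          show "\<bar>poly (q m) t - poly (q n) t\<bar> \<le> 2 * inverse (real (Suc N))"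
            using q[OF t, of m] q[OF t, of n] i[OF mn(1)] i[OF mn(2)] by linarith
        qed
        then show "norm (aeval h (q m) - aeval h (q n)) < e" using N by linarith
      qed
    qed
    then have L: "(\<lambda>n. aeval h (q n)) \<longlonglongrightarrow> \<Psi> f"
      unfolding \<Psi>_def q_def[symmetric] by (simp add: Cauchy_convergent_iff convergent_LIMSEQ_iff)
    have "(\<lambda>n. aeval h (p n) - aeval h (q n)) \<longlonglongrightarrow> 0"
    proof (rule Lim_null_comparison)
      show "\<forall>\<^sub>F n in sequentially. norm (aeval h (p n) - aeval h (q n)) \<le> (C + 1) * inverse (Suc n)"
      proof (intro always_eventually allI close)
        fix n and t :: real assume t: "\<bar>t\<bar> \<le> 1"
        show "\<bar>poly (p n) t - poly (q n) t\<bar> \<le> (C + 1) * inverse (Suc n)"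
          using p[OF t, of n] q[OF t, of n] unfolding distrib_right mult_1 by linarith
      qed
      show "(\<lambda>n. (C + 1) * inverse (Suc n)) \<longlonglongrightarrow> 0"
        using tendsto_mult_right_zero[OF LIMSEQ_inverse_real_of_nat] .
    qed
    from tendsto_add[OF this L] show ?thesis by simp
  qed
  have cont: "continuous_on {-1..1} (poly p)" for p :: "real poly" by (intro continuous_intros)
  have bdd: "\<exists>M\<ge>0. \<forall>t. \<bar>t\<bar> \<le> 1 \<longrightarrow> \<bar>f t\<bar> \<le> M" if "continuous_on {-1..1} f" for f :: "real \<Rightarrow> real"
  proof -
    have "bounded (f ` {-1..1})" by (intro compact_imp_bounded compact_continuous_image that) simp
    then obtain M where M: "\<forall>x\<in>f ` {-1..1}. norm x \<le> M" by (auto simp: bounded_iff)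
    have "\<bar>f t\<bar> \<le> \<bar>M\<bar>" if "\<bar>t\<bar> \<le> 1" for t
    proof -
      have "f t \<in> f ` {-1..1}" using that by (intro imageI) auto
      then have "norm (f t) \<le> M" using M by blast
      then show ?thesis by simp
    qed
    then show ?thesis by (intro exI[of _ "\<bar>M\<bar>"]) simp
  qed
  have i1: "inverse (real (Suc n)) \<le> 1" for n by (simp add: field_simps)
  show ?thesis
  proof (rule that)
    show "\<Psi> (poly p) = aeval h p" for p
      using LIMSEQ_unique[OF lim_unique[of "\<lambda>_. p" "poly p" 0] tendsto_const] cont by simp
  next
    fix f g :: "real \<Rightarrow> real"
    assume f: "continuous_on {-1..1} f" and g: "continuous_on {-1..1} g"
    obtain p q where "approx f p" "approx g q" using ex[OF f] ex[OF g] by blast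
    then have p: "\<bar>poly (p n) t - f t\<bar> \<le> inverse (Suc n)" and q: "\<bar>poly (q n) t - g t\<bar> \<le> inverse (Suc n)"
      if "\<bar>t\<bar> \<le> 1" for n t using that by (auto simp: approx_def)
    have lp: "(\<lambda>n. aeval h (p n)) \<longlonglongrightarrow> \<Psi> f" and lq: "(\<lambda>n. aeval h (q n)) \<longlonglongrightarrow> \<Psi> g"
      using p q by (auto intro!: lim_unique[where C = 1] f g)
    have "(\<lambda>n. aeval h (p n + q n)) \<longlonglongrightarrow> \<Psi> (\<lambda>t. f t + g t)"
    proof (rule lim_unique[where C = 2])
      show "\<bar>poly (p n + q n) t - (f t + g t)\<bar> \<le> 2 * inverse (Suc n)" if "\<bar>t\<bar> \<le> 1" for n t
        using p[OF that, of n] q[OF that, of n] unfolding poly_add by linarith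
    qed (intro continuous_intros f g)
    then show "\<Psi> (\<lambda>t. f t + g t) = \<Psi> f + \<Psi> g"
      using LIMSEQ_unique[OF _ tendsto_add[OF lp lq]] by (simp add: aeval_add)
    obtain M N where M: "M \<ge> 0" "\<And>t. \<bar>t\<bar> \<le> 1 \<Longrightarrow> \<bar>f t\<bar> \<le> M" and N: "\<And>t. \<bar>t\<bar> \<le> 1 \<Longrightarrow> \<bar>g t\<bar> \<le> N"
      using bdd[OF f] bdd[OF g] by blast
    have "(\<lambda>n. aeval h (p n * q n)) \<longlonglongrightarrow> \<Psi> (\<lambda>t. f t * g t)"
    proof (rule lim_unique[where C = "(N + 1) + M"])
      fix n and t :: real assume t: "\<bar>t\<bar> \<le> 1"
      have "\<bar>poly (q n) t\<bar> \<le> N + 1" using q[OF t, of n] N[OF t] i1[of n] by linarith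
      then have "\<bar>(poly (p n) t - f t) * poly (q n) t\<bar> \<le> inverse (Suc n) * (N + 1)"
        unfolding abs_mult using p[OF t, of n] by (intro mult_mono) auto
      moreover have "\<bar>f t * (poly (q n) t - g t)\<bar> \<le> M * inverse (Suc n)"
        unfolding abs_mult using q[OF t, of n] M t by (intro mult_mono) auto
      moreover have "poly (p n * q n) t - f t * g t
          = (poly (p n) t - f t) * poly (q n) t + f t * (poly (q n) t - g t)"
        by (simp add: algebra_simps)
      moreover have "(N + 1 + M) * inverse (Suc n) = inverse (Suc n) * (N + 1) + M * inverse (Suc n)"
        by (simp add: algebra_simps)
      ultimately show "\<bar>poly (p n * q n) t - f t * g t\<bar> \<le> (N + 1 + M) * inverse (Suc n)"
        by linarith
    qed (intro continuous_intros f g)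
    then show "\<Psi> (\<lambda>t. f t * g t) = \<Psi> f * \<Psi> g"
      using LIMSEQ_unique[OF _ tendsto_mult[OF lp lq]] by (simp add: aeval_mult)
  next
    fix f :: "real \<Rightarrow> real" and B
    assume f: "continuous_on {-1..1} f" and B: "\<And>t. \<bar>t\<bar> \<le> 1 \<Longrightarrow> \<bar>f t\<bar> \<le> B"
    obtain p where "approx f p" using ex[OF f] by blast
    then have p: "\<bar>poly (p n) t - f t\<bar> \<le> inverse (Suc n)" if "\<bar>t\<bar> \<le> 1" for n t
      using that by (auto simp: approx_def)
    have lp: "(\<lambda>n. aeval h (p n)) \<longlonglongrightarrow> \<Psi> f"
      using p by (auto intro!: lim_unique[where C = 1] f)
    have "norm (aeval h (p n)) \<le> B + inverse (Suc n)" for n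
    proof (rule norm_aeval_self_adjoint_le[OF h])
      show "\<bar>poly (p n) t\<bar> \<le> B + inverse (Suc n)" if "\<bar>t\<bar> \<le> 1" for t
        using p[OF that, of n] B[OF that] by linarith
    qed
    moreover have "(\<lambda>n. B + inverse (Suc n)) \<longlonglongrightarrow> B + 0"
      by (intro tendsto_intros LIMSEQ_inverse_real_of_nat)
    ultimately show "norm (\<Psi> f) \<le> B"
      using LIMSEQ_le[OF tendsto_norm[OF lp], of "\<lambda>n. B + inverse (Suc n)" B] by auto
  qed
qed


section \<open>Bilinear maps that vanish on zero products\<close>

text \<open>
  The hat function of width \<open>2 / n\<close> around \<open>k / n - 1\<close>, written as the difference of two consecutive
  clamped ramps so that the sum over \<open>k\<close> telescopes.
\<close>

definition tent :: "nat \<Rightarrow> nat \<Rightarrow> real \<Rightarrow> real"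
  where "tent n k t = max 0 (min 1 (n * (t + 1) - k + 1)) - max 0 (min 1 (n * (t + 1) - k))"

lemma continuous_tent: "continuous_on A (tent n k)"
  unfolding tent_def[abs_def] by (intro continuous_intros)

lemma tent_nonneg: "tent n k t \<ge> 0"
  by (simp add: tent_def max_def min_def)

lemma tent_eq_0: "\<bar>n * (t + 1) - k\<bar> \<ge> 1 \<Longrightarrow> tent n k t = 0"
  by (auto simp: tent_def max_def min_def)

lemma sum_tent:
  assumes "\<bar>t\<bar> \<le> 1"
  shows "(\<Sum>k\<le>2 * n. tent n k t) = 1"
proof -
  define p where "p k = max 0 (min 1 (n * (t + 1) - real k + 1))" for k
  have "(\<Sum>k\<le>2 * n. tent n k t) = (\<Sum>k\<le>2 * n. p k - p (Suc k))"
    by (intro sum.cong refl) (simp add: tent_def p_def)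
  also have "\<dots> = p 0 - p (Suc (2 * n))" by (rule sum_telescope)
  also have "0 \<le> n * (t + 1)" "n * (t + 1) \<le> 2 * real n"
    using assms mult_left_mono[of "t + 1" 2 "real n"] by (simp_all add: mult.commute)
  then have "p 0 - p (Suc (2 * n)) = 1" by (simp add: p_def)
  finally show ?thesis .
qed

text \<open>
  Let \<open>q k\<close> be the tents and \<open>\<tau> k\<close> their centres. Up to an error of order \<open>1 / n\<close>, the difference of the
  two sides is the double sum of \<open>(\<tau> k - \<tau> l) \<Phi> (q k) (q l)\<close>, in which only the terms with
  \<open>\<bar>k - l\<bar> \<le> 1\<close> survive. For these, \<open>n (\<tau> k - \<tau> l) = k - l\<close> equals \<open>sin (\<pi> (k - l) / 2)\<close>, and the addition
  theorem turns the double sum into \<open>(\<Phi> S C - \<Phi> C S) / n\<close> for two functions \<open>S\<close> and \<open>C\<close> bounded by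
  one. Estimating the \<open>n\<close> terms one by one would give no decay.
\<close>

lemma zero_product_form_swap_identity:
  fixes \<Phi> :: "(real \<Rightarrow> real) \<Rightarrow> (real \<Rightarrow> real) \<Rightarrow> 'x::real_normed_vector"
  defines "cont \<equiv> continuous_on {-1..1::real}"
  assumes addl: "\<And>f f' g. cont f \<Longrightarrow> cont f' \<Longrightarrow> cont g \<Longrightarrow> \<Phi> (\<lambda>t. f t + f' t) g = \<Phi> f g + \<Phi> f' g"
    and addr: "\<And>f g g'. cont f \<Longrightarrow> cont g \<Longrightarrow> cont g' \<Longrightarrow> \<Phi> f (\<lambda>t. g t + g' t) = \<Phi> f g + \<Phi> f g'"
    and scl: "\<And>f g c. cont f \<Longrightarrow> cont g \<Longrightarrow> \<Phi> (\<lambda>t. c * f t) g = c *\<^sub>R \<Phi> f g"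
    and scr: "\<And>f g c. cont f \<Longrightarrow> cont g \<Longrightarrow> \<Phi> f (\<lambda>t. c * g t) = c *\<^sub>R \<Phi> f g"
    and bd: "\<And>f g A B. cont f \<Longrightarrow> cont g \<Longrightarrow> (\<And>t. \<bar>t\<bar> \<le> 1 \<Longrightarrow> \<bar>f t\<bar> \<le> A) \<Longrightarrow>
      (\<And>t. \<bar>t\<bar> \<le> 1 \<Longrightarrow> \<bar>g t\<bar> \<le> B) \<Longrightarrow> norm (\<Phi> f g) \<le> K * A * B"
    and zp: "\<And>f g. cont f \<Longrightarrow> cont g \<Longrightarrow> (\<And>t. f t * g t = 0) \<Longrightarrow> \<Phi> f g = 0"
  shows "\<Phi> (\<lambda>t. t) (\<lambda>t. 1) = \<Phi> (\<lambda>t. 1) (\<lambda>t. t)"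
proof -
  have suml: "\<Phi> (\<lambda>t. \<Sum>k\<in>I. c k * f k t) g = (\<Sum>k\<in>I. c k *\<^sub>R \<Phi> (f k) g)"
    if "finite I" "\<And>k. cont (f k)" "cont g" for I :: "nat set" and c f g
    using that(1)
  proof (induction I)
    case empty
    then show ?case using scl[of g g 0] that by simp
  next
    case (insert i I)
    have "cont (\<lambda>t. \<Sum>k\<in>I. c k * f k t)" "cont (\<lambda>t. c i * f i t)"
      using that unfolding cont_def by (intro continuous_intros; simp)+
    then show ?case using insert that by (simp add: addl scl)
  qed
  have sumr: "\<Phi> f (\<lambda>t. \<Sum>k\<in>I. c k * g k t) = (\<Sum>k\<in>I. c k *\<^sub>R \<Phi> f (g k))"
    if "finite I" "\<And>k. cont (g k)" "cont f" for I :: "nat set" and c f g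
    using that(1)
  proof (induction I)
    case empty
    then show ?case using scr[of f f 0] that by simp
  next
    case (insert i I)
    have "cont (\<lambda>t. \<Sum>k\<in>I. c k * g k t)" "cont (\<lambda>t. c i * g i t)"
      using that unfolding cont_def by (intro continuous_intros; simp)+
    then show ?case using insert that by (simp add: addr scr)
  qed
  define D where "D = \<Phi> (\<lambda>t. t) (\<lambda>t. 1) - \<Phi> (\<lambda>t. 1) (\<lambda>t. t)"
  have D: "norm D \<le> 4 * K * inverse (real (Suc N))" for N
  proof -
    define n where "n = Suc N"
    define I where "I = {..2 * n}"
    define q where "q = tent n"
    define comb where "comb c t = (\<Sum>k\<in>I. c k * q k t)" for c :: "nat \<Rightarrow> real" and t
    have n: "real n > 0" and fI: "finite I" by (simp_all add: n_def I_def)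
    have cq: "cont (q k)" for k by (simp add: q_def cont_def continuous_tent)
    have cc: "cont (comb c)" for c
      unfolding comb_def[abs_def] cont_def using cq unfolding cont_def by (intro continuous_intros)
    have sq: "(\<Sum>k\<in>I. q k t) = 1" if "\<bar>t\<bar> \<le> 1" for t using sum_tent[OF that] by (simp add: I_def q_def)
    have qn: "q k t \<ge> 0" for k t by (simp add: q_def tent_nonneg)
    have comb_le: "\<bar>comb c t\<bar> \<le> 1" if "\<bar>t\<bar> \<le> 1" "\<And>k. \<bar>c k\<bar> \<le> 1" for c t
    proof -
      have "\<bar>comb c t\<bar> \<le> (\<Sum>k\<in>I. \<bar>c k * q k t\<bar>)" unfolding comb_def by (rule sum_abs)
      also have "\<dots> \<le> (\<Sum>k\<in>I. q k t)"
        using mult_right_mono[OF that(2) qn] by (intro sum_mono) (simp add: abs_mult qn)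
      finally show ?thesis using sq[OF that(1)] by simp
    qed
    have comb\<Phi>: "\<Phi> (comb a) (comb b) = (\<Sum>k\<in>I. \<Sum>l\<in>I. (a k * b l) *\<^sub>R \<Phi> (q k) (q l))" for a b
      unfolding comb_def[abs_def] using cc[of b] cq
      by (simp add: suml sumr fI scaleR_sum_right comb_def[abs_def])
    define \<tau> where "\<tau> k = real k / n - 1" for k :: nat
    define F where "F = comb \<tau>"
    define E where "E = comb (\<lambda>_. 1)"
    define S where "S = comb (\<lambda>k. sin (pi * k / 2))"
    define C where "C = comb (\<lambda>k. cos (pi * k / 2))"
    have cont: "cont F" "cont E" "cont S" "cont C" "cont (\<lambda>t. t)" "cont (\<lambda>t. 1)"
      by (simp_all add: F_def E_def S_def C_def cc) (simp_all add: cont_def)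
    have E1: "E t = 1" if "\<bar>t\<bar> \<le> 1" for t using sq[OF that] by (simp add: E_def comb_def)
    have F1: "\<bar>t - F t\<bar> \<le> inverse n" if t: "\<bar>t\<bar> \<le> 1" for t
    proof -
      have "t - F t = (\<Sum>k\<in>I. (t - \<tau> k) * q k t)"
        using sq[OF t] by (simp add: F_def comb_def left_diff_distrib sum_subtractf sum_distrib_left[symmetric])
      also have "\<bar>\<dots>\<bar> \<le> (\<Sum>k\<in>I. \<bar>(t - \<tau> k) * q k t\<bar>)" by (rule sum_abs)
      also have "\<dots> \<le> (\<Sum>k\<in>I. inverse n * q k t)"
      proof (rule sum_mono)
        fix k
        have "n * (t - \<tau> k) = n * (t + 1) - k" using n by (simp add: \<tau>_def field_simps)
        then have "\<bar>n * (t - \<tau> k)\<bar> < 1 \<or> q k t = 0" unfolding q_def using tent_eq_0[of n t k] by linarith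
        moreover have "\<bar>t - \<tau> k\<bar> \<le> inverse n" if "\<bar>n * (t - \<tau> k)\<bar> < 1"
        proof -
          have "n * \<bar>t - \<tau> k\<bar> < 1" using that by (simp add: abs_mult)
          then show ?thesis
            using n by (simp add: inverse_eq_divide pos_le_divide_eq mult.commute)
        qed
        ultimately show "\<bar>(t - \<tau> k) * q k t\<bar> \<le> inverse n * q k t"
          using qn[of k t] by (auto simp: abs_mult intro: mult_right_mono)
      qed
      finally show ?thesis using sq[OF t] by (simp add: sum_distrib_left[symmetric])
    qed
    have "\<Phi> F E - \<Phi> E F = (\<Sum>k\<in>I. \<Sum>l\<in>I. (\<tau> k - \<tau> l) *\<^sub>R \<Phi> (q k) (q l))"
      by (simp add: F_def E_def comb\<Phi> sum_subtractf[symmetric] scaleR_left_diff_distrib)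
    also have "\<dots> = (\<Sum>k\<in>I. \<Sum>l\<in>I. inverse n *\<^sub>R
        (sin (pi * k / 2) * cos (pi * l / 2) - cos (pi * k / 2) * sin (pi * l / 2)) *\<^sub>R \<Phi> (q k) (q l))"
    proof (intro sum.cong refl)
      fix k l
      show "(\<tau> k - \<tau> l) *\<^sub>R \<Phi> (q k) (q l) = inverse n *\<^sub>R
        (sin (pi * k / 2) * cos (pi * l / 2) - cos (pi * k / 2) * sin (pi * l / 2)) *\<^sub>R \<Phi> (q k) (q l)"
      proof (cases "k = l \<or> k = Suc l \<or> l = Suc k")
        case True
        have "sin (pi * k / 2 - pi * l / 2) = real k - real l"
        proof -
          from True consider "k = l" | "k = Suc l" | "l = Suc k" by blast
          then show ?thesis
          proof cases
            case 2
            then have eq: "pi * k / 2 - pi * l / 2 = pi / 2" by (simp add: field_simps)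
            show ?thesis unfolding eq using 2 by simp
          next
            case 3
            then have eq: "pi * k / 2 - pi * l / 2 = - (pi / 2)" by (simp add: field_simps)
            show ?thesis unfolding eq using 3 by simp
          qed simp
        qed
        moreover have "\<tau> k - \<tau> l = inverse n * (real k - real l)"
          by (simp add: \<tau>_def divide_inverse right_diff_distrib mult.commute)
        ultimately show ?thesis by (simp add: sin_diff)
      next
        case False
        have "\<Phi> (q k) (q l) = 0"
        proof (rule zp[OF cq cq])
          fix t :: real
          have "\<bar>real k - real l\<bar> \<ge> 2" using False by (cases "k \<le> l") auto
          then have "\<bar>n * (t + 1) - k\<bar> \<ge> 1 \<or> \<bar>n * (t + 1) - l\<bar> \<ge> 1" by linarith
          then show "q k t * q l t = 0"
            unfolding q_def using tent_eq_0[of n t k] tent_eq_0[of n t l] by auto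
        qed
        then show ?thesis by simp
      qed
    qed
    also have "\<dots> = inverse n *\<^sub>R (\<Phi> S C - \<Phi> C S)"
      by (simp add: S_def C_def comb\<Phi> sum_subtractf[symmetric] scaleR_left_diff_distrib
          scaleR_sum_right scaleR_right_diff_distrib)
    finally have main: "\<Phi> F E - \<Phi> E F = inverse n *\<^sub>R (\<Phi> S C - \<Phi> C S)" .
    have "norm (\<Phi> S C) \<le> K * 1 * 1" "norm (\<Phi> C S) \<le> K * 1 * 1"
      unfolding S_def C_def by (intro bd cc comb_le; simp)+
    then have "norm (\<Phi> S C - \<Phi> C S) \<le> 2 * K"
      using norm_triangle_ineq4[of "\<Phi> S C" "\<Phi> C S"] by simp
    then have m: "norm (\<Phi> F E - \<Phi> E F) \<le> inverse n * (2 * K)"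
      unfolding main norm_scaleR using n by (simp del: divide_inverse)
    define G where "G t = t + - 1 * F t" for t
    define H where "H t = 1 + - 1 * E t" for t
    have cGH: "cont G" "cont H" unfolding G_def[abs_def] H_def[abs_def]
      using cont unfolding cont_def by (intro continuous_intros; simp)+
    have Gb: "\<bar>t\<bar> \<le> 1 \<Longrightarrow> \<bar>G t\<bar> \<le> inverse n" and Hb: "\<bar>t\<bar> \<le> 1 \<Longrightarrow> \<bar>H t\<bar> \<le> 0" for t
      using F1[of t] E1[of t] by (simp_all add: G_def H_def)
    have Fb: "\<bar>t\<bar> \<le> 1 \<Longrightarrow> \<bar>F t\<bar> \<le> 2" for t
    proof -
      assume t: "\<bar>t\<bar> \<le> 1"
      have "inverse (real n) \<le> 1" by (simp add: n_def field_simps)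
      then show "\<bar>F t\<bar> \<le> 2" using F1[OF t] t by linarith
    qed
    have "norm (\<Phi> G (\<lambda>t. 1)) \<le> K * inverse n * 1" "norm (\<Phi> (\<lambda>t. 1) G) \<le> K * 1 * inverse n"
      "norm (\<Phi> F H) \<le> K * 2 * 0" "norm (\<Phi> H F) \<le> K * 0 * 2"
      by (intro bd cont cGH Gb Hb Fb; simp)+
    moreover have "\<Phi> G (\<lambda>t. 1) = \<Phi> (\<lambda>t. t) (\<lambda>t. 1) - \<Phi> F (\<lambda>t. 1)"
      and "\<Phi> (\<lambda>t. 1) G = \<Phi> (\<lambda>t. 1) (\<lambda>t. t) - \<Phi> (\<lambda>t. 1) F"
      and "\<Phi> F H = \<Phi> F (\<lambda>t. 1) - \<Phi> F E" and "\<Phi> H F = \<Phi> (\<lambda>t. 1) F - \<Phi> E F"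
    proof -
      have c: "cont (\<lambda>t. - 1 * F t)" "cont (\<lambda>t. - 1 * E t)"
        using cont unfolding cont_def by (intro continuous_intros; simp)+
      show "\<Phi> G (\<lambda>t. 1) = \<Phi> (\<lambda>t. t) (\<lambda>t. 1) - \<Phi> F (\<lambda>t. 1)"
        unfolding G_def[abs_def] by (subst addl[OF cont(5) c(1) cont(6)], subst scl[OF cont(1,6)]) simp
      show "\<Phi> (\<lambda>t. 1) G = \<Phi> (\<lambda>t. 1) (\<lambda>t. t) - \<Phi> (\<lambda>t. 1) F"
        unfolding G_def[abs_def] by (subst addr[OF cont(6,5) c(1)], subst scr[OF cont(6,1)]) simp
      show "\<Phi> F H = \<Phi> F (\<lambda>t. 1) - \<Phi> F E"
        unfolding H_def[abs_def] by (subst addr[OF cont(1,6) c(2)], subst scr[OF cont(1,2)]) simp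
      show "\<Phi> H F = \<Phi> (\<lambda>t. 1) F - \<Phi> E F"
        unfolding H_def[abs_def] by (subst addl[OF cont(6) c(2) cont(1)], subst scl[OF cont(2,1)]) simp
    qed
    ultimately have "D = \<Phi> G (\<lambda>t. 1) - \<Phi> (\<lambda>t. 1) G + (\<Phi> F E - \<Phi> E F)"
      and b: "norm (\<Phi> G (\<lambda>t. 1)) \<le> K * inverse n" "norm (\<Phi> (\<lambda>t. 1) G) \<le> K * inverse n"
      by (simp_all add: D_def)
    then have "norm D \<le> norm (\<Phi> G (\<lambda>t. 1)) + norm (\<Phi> (\<lambda>t. 1) G) + norm (\<Phi> F E - \<Phi> E F)"
      by (metis add_mono_thms_linordered_semiring(3) norm_triangle_ineq norm_triangle_ineq4 order_trans)
    also have "\<dots> \<le> 4 * K * inverse n" using b m by (simp add: algebra_simps)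
    finally show ?thesis by (simp add: n_def)
  qed
  have "(\<lambda>N. 4 * K * inverse (real (Suc N))) \<longlonglongrightarrow> 0"
    using tendsto_mult_right_zero[OF LIMSEQ_inverse_real_of_nat] .
  then have "norm D \<le> 0" by (rule LIMSEQ_le_const) (use D in auto)
  then show ?thesis by (simp add: D_def)
qed

lemma self_adjoint_decomposition:
  fixes x :: "'a::cstar_algebra"
  obtains a b where "a\<^sup>\<star> = a" "b\<^sup>\<star> = b" "x = a + \<i> *\<^sub>C b"
proof (rule that)
  show "((1/2) *\<^sub>C (x + x\<^sup>\<star>))\<^sup>\<star> = (1/2) *\<^sub>C (x + x\<^sup>\<star>)"
    by (simp add: star_scaleC star_add star_star add.commute)
  show "((- \<i>/2) *\<^sub>C (x - x\<^sup>\<star>))\<^sup>\<star> = (- \<i>/2) *\<^sub>C (x - x\<^sup>\<star>)"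
    by (simp add: star_scaleC star_diff star_star scaleC_diff_right)
  have "(1/2) *\<^sub>C x + (1/2) *\<^sub>C x = x"
    by (simp add: scaleC_add_left[symmetric])
  then show "x = (1/2) *\<^sub>C (x + x\<^sup>\<star>) + \<i> *\<^sub>C (- \<i>/2) *\<^sub>C (x - x\<^sup>\<star>)"
    by (simp add: scaleC_scaleC scaleC_add_right scaleC_diff_right)
qed

text \<open>
  The functional calculus of \<open>h\<close> turns \<open>V\<close> into the form \<open>\<Phi> f g = V (x f(h)) (g(h) z)\<close> on functions. The
  elements \<open>f(h)\<close> belong to the unitization, in which \<open>A\<close> is an ideal.
\<close>

lemma zero_product_form_balanced_self_adjoint:
  fixes V :: "'a::cstar_algebra \<Rightarrow> 'a \<Rightarrow> 'x::real_normed_vector"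
  assumes V: "bounded_bilinear V" and zp: "\<And>x y. x * y = 0 \<Longrightarrow> V x y = 0"
    and h: "h\<^sup>\<star> = h" "norm h < 1"
  shows "V (x * h) z = V x (h * z)"
proof -
  have "(emb h)\<^sup>\<star> = emb h" "norm (emb h) < 1" using h by (simp_all add: emb_star norm_emb)
  then obtain \<Psi> :: "(real \<Rightarrow> real) \<Rightarrow> 'a unitization"
    where \<Psi>_poly: "\<And>p. \<Psi> (poly p) = aeval (emb h) p"
    and \<Psi>_add: "\<And>f g. continuous_on {-1..1} f \<Longrightarrow> continuous_on {-1..1} g \<Longrightarrow> \<Psi> (\<lambda>t. f t + g t) = \<Psi> f + \<Psi> g"
    and \<Psi>_mult: "\<And>f g. continuous_on {-1..1} f \<Longrightarrow> continuous_on {-1..1} g \<Longrightarrow> \<Psi> (\<lambda>t. f t * g t) = \<Psi> f * \<Psi> g"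
    and \<Psi>_bound: "\<And>f B. continuous_on {-1..1} f \<Longrightarrow> (\<And>t. \<bar>t\<bar> \<le> 1 \<Longrightarrow> \<bar>f t\<bar> \<le> B) \<Longrightarrow> norm (\<Psi> f) \<le> B"
    using continuous_functional_calculus by blast
  have const: "\<Psi> (\<lambda>t. c) = c *\<^sub>R 1" for c
  proof -
    have "poly [:c:] = (\<lambda>t. c)" by (simp add: fun_eq_iff)
    then show ?thesis using \<Psi>_poly[of "[:c:]"] by (simp add: aeval_pCons)
  qed
  have ident: "\<Psi> (\<lambda>t. t) = emb h"
  proof -
    have "poly [:0, 1:] = (\<lambda>t::real. t)" by (simp add: fun_eq_iff)
    then show ?thesis using \<Psi>_poly[of "[:0, 1:]"] by (simp add: aeval_pCons)
  qed
  have scale: "\<Psi> (\<lambda>t. c * f t) = c *\<^sub>R \<Psi> f" if "continuous_on {-1..1} f" for c f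
    using \<Psi>_mult[of "\<lambda>t. c" f] that by (simp add: const)
  interpret V: bounded_bilinear V by (rule V)
  interpret vec: bounded_linear "vec :: 'a unitization \<Rightarrow> 'a" by (rule bounded_linear_vec)
  obtain K where K: "K \<ge> 0" "\<And>x y. norm (V x y) \<le> norm x * norm y * K"
    using V.nonneg_bounded by blast
  define L where "L f = vec (emb x * \<Psi> f)" for f
  define R where "R f = vec (\<Psi> f * emb z)" for f
  have L: "norm (L f) \<le> (2 * norm x) * A" and R: "norm (R f) \<le> (2 * norm z) * A"
    if "continuous_on {-1..1} f" "\<And>t. \<bar>t\<bar> \<le> 1 \<Longrightarrow> \<bar>f t\<bar> \<le> A" for f A
  proof -
    have f: "norm (\<Psi> f) \<le> A" using \<Psi>_bound that by blast
    have "norm (L f) \<le> 2 * (norm (emb x) * norm (\<Psi> f))"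
      unfolding L_def by (rule order_trans[OF norm_vec_le]) (simp add: norm_mult_ineq)
    then show "norm (L f) \<le> (2 * norm x) * A"
      using mult_left_mono[OF f, of "norm x"] by (simp add: norm_emb)
    have "norm (R f) \<le> 2 * (norm (\<Psi> f) * norm (emb z))"
      unfolding R_def by (rule order_trans[OF norm_vec_le]) (simp add: norm_mult_ineq)
    then show "norm (R f) \<le> (2 * norm z) * A"
      using mult_right_mono[OF f, of "norm z"] by (simp add: norm_emb mult_ac)
  qed
  have "V (L (\<lambda>t. t)) (R (\<lambda>t. 1)) = V (L (\<lambda>t. 1)) (R (\<lambda>t. t))"
  proof (rule zero_product_form_swap_identity[where K = "K * (2 * norm x) * (2 * norm z)"])
    fix f f' g :: "real \<Rightarrow> real"
    assume c: "continuous_on {-1..1} f" "continuous_on {-1..1} f'" "continuous_on {-1..1} g"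
    show "V (L (\<lambda>t. f t + f' t)) (R g) = V (L f) (R g) + V (L f') (R g)"
      by (simp add: L_def \<Psi>_add c distrib_left V.add_left)
    show "V (L g) (R (\<lambda>t. f t + f' t)) = V (L g) (R f) + V (L g) (R f')"
      by (simp add: R_def \<Psi>_add c distrib_right V.add_right)
  next
    fix f g :: "real \<Rightarrow> real" and c
    assume c: "continuous_on {-1..1} f" "continuous_on {-1..1} g"
    show "V (L (\<lambda>t. c * f t)) (R g) = c *\<^sub>R V (L f) (R g)"
      using scale[OF c(1)] by (simp add: L_def vec.scaleR V.scaleR_left)
    show "V (L f) (R (\<lambda>t. c * g t)) = c *\<^sub>R V (L f) (R g)"
      using scale[OF c(2)] by (simp add: R_def vec.scaleR V.scaleR_right)
  next
    fix f g :: "real \<Rightarrow> real" and A B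
    assume c: "continuous_on {-1..1} f" "continuous_on {-1..1} g"
      and b: "\<And>t. \<bar>t\<bar> \<le> 1 \<Longrightarrow> \<bar>f t\<bar> \<le> A" "\<And>t. \<bar>t\<bar> \<le> 1 \<Longrightarrow> \<bar>g t\<bar> \<le> B"
    have "norm (V (L f) (R g)) \<le> norm (L f) * norm (R g) * K" by (rule K)
    also have "\<dots> \<le> ((2 * norm x) * A) * ((2 * norm z) * B) * K"
      using L[OF c(1) b(1)] R[OF c(2) b(2)] K(1)
      by (intro mult_right_mono mult_mono') auto
    finally show "norm (V (L f) (R g)) \<le> K * (2 * norm x) * (2 * norm z) * A * B"
      by (simp add: mult_ac)
  next
    fix f g :: "real \<Rightarrow> real"
    assume c: "continuous_on {-1..1} f" "continuous_on {-1..1} g" and fg: "\<And>t. f t * g t = 0"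
    have "emb (L f) = emb x * \<Psi> f" "emb (R g) = \<Psi> g * emb z"
      unfolding L_def R_def by (rule emb_vec; simp)+
    then have "emb (L f * R g) = (emb x * \<Psi> f) * (\<Psi> g * emb z)"
      by (simp only: emb_mult[symmetric])
    also have "\<dots> = emb x * \<Psi> (\<lambda>t. f t * g t) * emb z"
      by (simp add: \<Psi>_mult[OF c] mult.assoc)
    also have "\<dots> = 0" by (simp add: fg const)
    finally show "V (L f) (R g) = 0" by (intro zp) (simp add: zero_unitization_def)
  qed
  then show ?thesis by (simp add: L_def R_def const ident)
qed

theorem zero_product_form_balanced:
  fixes V :: "'a::cstar_algebra \<Rightarrow> 'a \<Rightarrow> 'x::real_normed_vector"
  assumes V: "bounded_bilinear V" and zp: "\<And>x y. x * y = 0 \<Longrightarrow> V x y = 0"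
    and c: "\<And>c x y. V (c *\<^sub>C x) y = V x (c *\<^sub>C y)"
  shows "V (x * y) z = V x (y * z)"
proof -
  interpret V: bounded_bilinear V by (rule V)
  have sa: "V (x * h) z = V x (h * z)" if "h\<^sup>\<star> = h" for x h z
  proof -
    have pos: "norm h + 1 > 0" using norm_ge_zero[of h] by linarith
    define r where "r = inverse (norm h + 1)"
    have r: "r > 0" "norm (r *\<^sub>R h) < 1"
      using pos by (simp_all add: r_def divide_simps)
    have "V (x * (r *\<^sub>R h)) z = V x ((r *\<^sub>R h) * z)"
      using r(2) that by (intro zero_product_form_balanced_self_adjoint V zp) (simp_all add: star_scaleR)
    then show ?thesis using r(1) by (simp add: V.scaleR_left V.scaleR_right)
  qed
  obtain a b where "a\<^sup>\<star> = a" "b\<^sup>\<star> = b" and y: "y = a + \<i> *\<^sub>C b"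
    by (rule self_adjoint_decomposition)
  then show ?thesis
    by (simp add: y distrib_left distrib_right V.add_left V.add_right sa mult_scaleC_left
        mult_scaleC_right c)
qed


section \<open>Local units and approximate identities\<close>

text \<open>
  The element \<open>1 - (1 - k)\<^sup>n\<close>, in a form that makes sense without a unit.
\<close>

primrec local_unit :: "'a::ring \<Rightarrow> nat \<Rightarrow> 'a" where
  "local_unit k 0 = 0"
| "local_unit k (Suc n) = local_unit k n + k - local_unit k n * k"

lemma emb_local_unit: "emb (local_unit k n) = 1 - (1 - emb k) ^ n"
proof (induction n)
  case 0
  then show ?case by (simp add: zero_unitization_def)
next
  case (Suc n)
  have "emb (local_unit k (Suc n)) = emb (local_unit k n) + emb k - emb (local_unit k n) * emb k"
    by (simp add: unitization.expand)
  then show ?case by (simp add: Suc power_Suc2 algebra_simps del: power_Suc)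
qed

text \<open>
  The factor \<open>\<bar>t\<bar>\<close> is small near zero, and \<open>1 - t ^ 4\<close> is bounded away from one elsewhere.
\<close>

lemma decay_away_from_zero:
  fixes e :: real
  assumes "e > 0"
  obtains n where "\<And>t. \<bar>t\<bar> \<le> 1 \<Longrightarrow> \<bar>t\<bar> * (1 - t ^ 4) ^ n \<le> e"
proof (cases "e \<le> 1")
  case False
  then show ?thesis using that[of 0] by simp
next
  case True
  have "(\<lambda>n. (1 - e ^ 4) ^ n) \<longlonglongrightarrow> 0"
    using assms True power_le_one[of e 4] zero_less_power[of e 4]
    by (intro LIMSEQ_power_zero) simp
  then have "\<forall>\<^sub>F n in sequentially. (1 - e ^ 4) ^ n < e"
    using assms by (rule order_tendstoD)
  then obtain n where n: "(1 - e ^ 4) ^ n < e" by (auto simp: eventually_sequentially)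
  show ?thesis
  proof (rule that[of n])
    fix t :: real assume t: "\<bar>t\<bar> \<le> 1"
    have t4: "0 \<le> t ^ 4" "t ^ 4 \<le> 1" using power_le_one[of "\<bar>t\<bar>" 4] t by simp_all
    show "\<bar>t\<bar> * (1 - t ^ 4) ^ n \<le> e"
    proof (cases "\<bar>t\<bar> \<le> e")
      case True
      have "\<bar>t\<bar> * (1 - t ^ 4) ^ n \<le> \<bar>t\<bar> * 1" using t4 by (intro mult_left_mono power_le_one) auto
      then show ?thesis using True by simp
    next
      case False
      then have "e ^ 4 \<le> t ^ 4" using power_mono[of e "\<bar>t\<bar>" 4] assms by simp
      then have "(1 - t ^ 4) ^ n \<le> (1 - e ^ 4) ^ n" using t4 by (intro power_mono) auto
      moreover have "\<bar>t\<bar> * (1 - t ^ 4) ^ n \<le> 1 * (1 - t ^ 4) ^ n"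
        using t t4 by (intro mult_right_mono) auto
      ultimately show ?thesis using n by linarith
    qed
  qed
qed

text \<open>
  The fourth power is dictated by the vanishing argument for the defect of a twisted derivation, where
  \<open>p x p y\<close> with \<open>x = y = p\<close> annihilates the defect.
\<close>

lemma local_unit_approximates:
  fixes h :: "'a::cstar_algebra"
  assumes h: "h\<^sup>\<star> = h" "norm h < 1" and e: "e > 0"
  defines "k \<equiv> h * (h * (h * h))"
  obtains n where "(local_unit k n)\<^sup>\<star> = local_unit k n" "norm (local_unit k n) \<le> 1"
    "norm (h - local_unit k n * h) \<le> e" "norm (h - h * local_unit k n) \<le> e"
proof -
  obtain n where n: "\<And>t. \<bar>t\<bar> \<le> 1 \<Longrightarrow> \<bar>t\<bar> * (1 - t ^ 4) ^ n \<le> e" by (rule decay_away_from_zero[OF e]) blast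
  define H where "H = emb h"
  have H: "H\<^sup>\<star> = H" "norm H < 1" using h by (simp_all add: H_def emb_star norm_emb)
  define p :: "real poly" where "p = (1 - [:0, 1:] ^ 4) ^ n"
  have k: "emb k = H ^ 4"
    unfolding k_def emb_mult[symmetric] H_def[symmetric] by (simp add: power4_eq_xxxx mult.assoc)
  have pH: "aeval H p = (1 - H ^ 4) ^ n"
  proof -
    have "aeval H (1 - [:0, 1:] ^ 4) + H ^ 4 = 1"
      using aeval_add[of H "1 - [:0,1:] ^ 4" "[:0,1:] ^ 4"] by (simp add: aeval_power aeval_pCons)
    then have "aeval H (1 - [:0, 1:] ^ 4) = 1 - H ^ 4" by (simp only: eq_diff_eq)
    then show ?thesis by (simp add: p_def aeval_power)
  qed
  have u: "emb (local_unit k n) = aeval H (1 - p)"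
  proof -
    have "aeval H (1 - p) + (1 - H ^ 4) ^ n = 1" using aeval_add[of H "1 - p" p] by (simp add: pH)
    then have "aeval H (1 - p) = 1 - (1 - H ^ 4) ^ n" by (simp only: eq_diff_eq)
    then show ?thesis by (simp add: emb_local_unit k)
  qed
  have t4: "0 \<le> 1 - t ^ 4" "1 - t ^ 4 \<le> 1" if "\<bar>t\<bar> \<le> 1" for t :: real
    using power_le_one[of "\<bar>t\<bar>" 4] that by simp_all
  have "(emb (local_unit k n))\<^sup>\<star> = emb (local_unit k n)" by (simp add: u star_aeval H)
  then have s: "(local_unit k n)\<^sup>\<star> = local_unit k n" by (simp add: emb_star)
  have "norm (aeval H (1 - p)) \<le> 1"
  proof (rule norm_aeval_self_adjoint_le[OF H])
    fix t :: real assume "\<bar>t\<bar> \<le> 1"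
    then show "\<bar>poly (1 - p) t\<bar> \<le> 1"
      using zero_le_power[OF t4(1), of t n] power_le_one[OF t4, of t n] by (simp add: p_def)
  qed
  then have nb: "norm (local_unit k n) \<le> 1" by (simp add: u[symmetric] norm_emb)
  have 1: "norm (aeval H (p * [:0, 1:])) \<le> e"
  proof (rule norm_aeval_self_adjoint_le[OF H])
    fix t :: real assume t: "\<bar>t\<bar> \<le> 1"
    then show "\<bar>poly (p * [:0, 1:]) t\<bar> \<le> e"
      using n[OF t] zero_le_power[OF t4(1)[OF t], of n] by (simp add: p_def abs_mult mult.commute)
  qed
  have emb_diff: "emb a - emb b = emb (a - b)" for a b :: 'a by (simp add: unitization.expand)
  have "emb (h - local_unit k n * h) = aeval H (p * [:0, 1:])"
    unfolding emb_diff[symmetric] emb_mult[symmetric] emb_local_unit k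
    unfolding aeval_mult pH by (simp add: aeval_pCons H_def left_diff_distrib)
  then have l: "norm (h - local_unit k n * h) \<le> e" using 1 by (metis norm_emb)
  have "(h - local_unit k n * h)\<^sup>\<star> = h - h * local_unit k n"
    by (simp add: star_diff star_mult s h)
  then have "norm (h - h * local_unit k n) \<le> e" using l by (metis norm_star)
  with s nb l show ?thesis by (rule that)
qed

text \<open>
  A local unit for \<open>a a\<^sup>\<star>\<close> is a left unit for \<open>a\<close>, as
  \<open>\<bar>a - u a\<bar>\<^sup>2 = \<bar>(1 - u) a a\<^sup>\<star> (1 - u)\<bar>\<close>.
\<close>

lemma self_adjoint_left_unit:
  fixes a :: "'a::cstar_algebra"
  assumes "e > 0"
  obtains u where "u\<^sup>\<star> = u" "norm u \<le> 1" "norm (a - u * a) < e"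
proof -
  have pos: "norm a + 1 > 0" using norm_ge_zero[of a] by linarith
  define r where "r = inverse (norm a + 1)"
  have r: "r > 0" "norm (r *\<^sub>R a) < 1"
    using pos by (simp_all add: r_def divide_simps)
  define b where "b = r *\<^sub>R a"
  define \<delta> where "\<delta> = (r * e)\<^sup>2 / 4"
  have \<delta>: "\<delta> > 0" using r(1) assms by (simp add: \<delta>_def)
  have "norm (b * b\<^sup>\<star>) < 1"
    using r(2) unfolding cstar_identity' b_def[symmetric] by (simp add: power_less_one_iff abs_square_less_1)
  moreover have "(b * b\<^sup>\<star>)\<^sup>\<star> = b * b\<^sup>\<star>" by (simp add: star_mult star_star)
  ultimately obtain u where u: "u\<^sup>\<star> = u" "norm u \<le> 1" "norm (b * b\<^sup>\<star> - u * (b * b\<^sup>\<star>)) \<le> \<delta>"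
    using local_unit_approximates[OF _ _ \<delta>, of "b * b\<^sup>\<star>"] by metis
  define w where "w = b * b\<^sup>\<star> - u * (b * b\<^sup>\<star>)"
  have "(norm (b - u * b))\<^sup>2 = norm (w - w * u)"
    unfolding cstar_identity'[symmetric] w_def
    by (simp add: star_diff star_mult u algebra_simps)
  also have "\<dots> \<le> norm w + norm w * norm u"
    by (rule order_trans[OF norm_triangle_ineq4]) (simp add: norm_mult_ineq)
  also have "\<dots> \<le> \<delta> + \<delta> * 1"
    using u \<delta> unfolding w_def by (intro add_mono mult_mono) auto
  also have "\<dots> < (r * e)\<^sup>2" using r(1) assms by (simp add: \<delta>_def)
  finally have "norm (b - u * b) < r * e" using r(1) assms by (simp add: power2_less_imp_less)
  moreover have "b - u * b = r *\<^sub>R (a - u * a)" by (simp add: b_def algebra_simps)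
  ultimately have "norm (a - u * a) < e" using r(1) by simp
  with u(1,2) show ?thesis by (rule that)
qed

text \<open>
  The factorization \<open>1 - g = (1 - f) (1 - u)\<close> lets a left unit \<open>u\<close> for \<open>S\<close> also serve \<open>b\<close>, but \<open>g\<close> is
  neither self-adjoint nor a contraction. A self-adjoint contraction \<open>v\<close> with \<open>v g\<close> close to \<open>g\<close>
  inherits the approximation property of \<open>g\<close>.
\<close>

lemma self_adjoint_left_unit_finite:
  fixes S :: "'a::cstar_algebra set"
  assumes "finite S" "e > 0"
  shows "\<exists>u. u\<^sup>\<star> = u \<and> norm u \<le> 1 \<and> (\<forall>a\<in>S. norm (a - u * a) < e)"
  using assms
proof (induction S arbitrary: e)
  case empty
  then show ?case by (intro exI[of _ 0]) simp
next
  case (insert b S)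
  obtain u where u: "norm u \<le> 1" "\<And>a. a \<in> S \<Longrightarrow> norm (a - u * a) < e / 8"
    using insert.IH[of "e / 8"] insert.prems by auto
  obtain f where f: "norm f \<le> 1" "norm ((b - u * b) - f * (b - u * b)) < e / 4"
    using self_adjoint_left_unit[of "e / 4" "b - u * b"] insert.prems by auto
  define g where "g = f + u - f * u"
  have eq: "a - g * a = (a - u * a) - f * (a - u * a)" for a
    by (simp add: g_def algebra_simps)
  have contr: "norm (x - v * x) \<le> 2 * norm x" if "norm v \<le> 1" for v x :: 'a
  proof -
    have "norm (v * x) \<le> 1 * norm x"
      by (rule order_trans[OF norm_mult_ineq mult_right_mono[OF that norm_ge_zero]])
    then show ?thesis using norm_triangle_ineq4[of x "v * x"] by simp
  qed
  have g: "norm (a - g * a) < e / 4" if "a \<in> insert b S" for a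
  proof (cases "a = b")
    case False
    then have "norm (a - u * a) < e / 8" using that u(2) by simp
    then show ?thesis unfolding eq using contr[OF f(1), of "a - u * a"] by linarith
  next
    case True
    then show ?thesis using f(2) by (simp only: eq)
  qed
  define M where "M = (\<Sum>a\<in>insert b S. norm a) + 1"
  have M: "M > 0" "\<And>a. a \<in> insert b S \<Longrightarrow> norm a \<le> M"
  proof -
    show "M > 0" unfolding M_def using sum_nonneg[of "insert b S" norm] by simp
    fix a assume "a \<in> insert b S"
    then have "norm a \<le> (\<Sum>a\<in>insert b S. norm a)"
      using insert.hyps(1) by (intro member_le_sum) auto
    then show "norm a \<le> M" by (simp add: M_def)
  qed
  obtain v where v: "v\<^sup>\<star> = v" "norm v \<le> 1" "norm (g - v * g) < e / (2 * M)"
    using self_adjoint_left_unit[of "e / (2 * M)" g] insert.prems M(1) by auto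
  show ?case
  proof (intro exI[of _ v] conjI ballI v)
    fix a assume a: "a \<in> insert b S"
    have "a - v * a = ((a - g * a) - v * (a - g * a)) + (g - v * g) * a"
      by (simp add: algebra_simps)
    then have "norm (a - v * a) \<le> norm ((a - g * a) - v * (a - g * a)) + norm ((g - v * g) * a)"
      by (metis norm_triangle_ineq)
    moreover have "norm ((g - v * g) * a) \<le> e / (2 * M) * M"
      using v(3) M a insert.prems by (intro order_trans[OF norm_mult_ineq] mult_mono) auto
    ultimately show "norm (a - v * a) < e"
      using contr[OF v(2), of "a - g * a"] g[OF a] M(1) by simp
  qed
qed

theorem approximate_identity:
  obtains E :: "'a::cstar_algebra filter"
  where "E \<noteq> bot" "\<forall>\<^sub>F u in E. u\<^sup>\<star> = u \<and> norm u \<le> 1"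
    "\<And>a. ((\<lambda>u. u * a) \<longlongrightarrow> a) E" "\<And>a. ((\<lambda>u. a * u) \<longlongrightarrow> a) E"
proof -
  define U where "U = (\<lambda>(S::'a set, e::real). {u::'a. u\<^sup>\<star> = u \<and> norm u \<le> 1 \<and> (\<forall>a\<in>S. norm (a - u * a) < e)})"
  define I where "I = {(S::'a set, e::real). finite S \<and> e > 0}"
  define E where "E = (INF i\<in>I. principal (U i))"
  have "\<exists>k\<in>I. principal (U k) \<le> inf (principal (U i)) (principal (U j))" if ij: "i \<in> I" "j \<in> I" for i j
  proof -
    obtain S e S' e' where "i = (S, e)" "j = (S', e')" by (cases i, cases j)
    then show ?thesis
      using ij by (intro bexI[of _ "(S \<union> S', min e e')"]) (auto simp: I_def U_def)
  qed
  then have "E = bot \<longleftrightarrow> (\<exists>i\<in>I. principal (U i) = bot)"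
    unfolding E_def by (rule INF_filter_bot_base)
  moreover have "U i \<noteq> {}" if "i \<in> I" for i
    using that self_adjoint_left_unit_finite by (fastforce simp: I_def U_def)
  ultimately have 1: "E \<noteq> bot" by (metis principal_eq_bot_iff)
  have ev: "\<forall>\<^sub>F u in E. u \<in> U (S, e)" if "finite S" "e > 0" for S e
  proof -
    have "E \<le> principal (U (S, e))"
      unfolding E_def using that by (intro INF_lower) (simp add: I_def)
    then show ?thesis by (rule filter_leD) (simp add: eventually_principal)
  qed
  have 2: "\<forall>\<^sub>F u in E. u\<^sup>\<star> = u \<and> norm u \<le> 1"
    by (rule eventually_mono[OF ev[of "{}" 1]]) (auto simp: U_def)
  have 3: "((\<lambda>u. u * a) \<longlongrightarrow> a) E" for a
  proof (rule tendstoI)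
    fix e :: real assume "e > 0"
    then show "\<forall>\<^sub>F u in E. dist (u * a) a < e"
      by (intro eventually_mono[OF ev[of "{a}" e]]) (auto simp: U_def dist_norm norm_minus_commute)
  qed
  have "((\<lambda>u. a * u) \<longlongrightarrow> a) E" for a
  proof -
    have "((\<lambda>u. (u * a\<^sup>\<star>)\<^sup>\<star>) \<longlongrightarrow> (a\<^sup>\<star>)\<^sup>\<star>) E"
      by (rule bounded_linear.tendsto[OF bounded_linear_star 3])
    moreover have "\<forall>\<^sub>F u in E. (u * a\<^sup>\<star>)\<^sup>\<star> = a * u"
      by (rule eventually_mono[OF 2]) (simp add: star_mult star_star)
    ultimately show ?thesis by (simp add: star_star tendsto_cong)
  qed
  with 1 2 3 show ?thesis by (rule that)
qed


section \<open>Twisted derivations\<close>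

context banach_bimodule begin

lemma bounded_bilinear_lact: "bounded_bilinear lact"
proof
  obtain K where "\<And>a x. norm (lact a x) \<le> K * norm a * norm x" using bounded_lact by blast
  then show "\<exists>K. \<forall>a x. norm (lact a x) \<le> norm a * norm x * K" by (intro exI[of _ K]) (simp add: mult_ac)
qed (use clinear_lact_left clinear_lact_right in \<open>auto simp: clinear_iff scaleC_of_real[symmetric]\<close>)

lemma bounded_bilinear_ract: "bounded_bilinear ract"
proof
  obtain K where "\<And>a x. norm (ract x a) \<le> K * norm x * norm a" using bounded_ract by blast
  then show "\<exists>K. \<forall>x a. norm (ract x a) \<le> norm x * norm a * K" by (intro exI[of _ K]) (simp add: mult_ac)
qed (use clinear_ract_left clinear_ract_right in \<open>auto simp: clinear_iff scaleC_of_real[symmetric]\<close>)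

sublocale lact: bounded_bilinear lact by (rule bounded_bilinear_lact)
sublocale ract: bounded_bilinear ract by (rule bounded_bilinear_ract)

lemma lact_scaleC: "lact (c *\<^sub>C a) x = c *\<^sub>C lact a x" "lact a (c *\<^sub>C x) = c *\<^sub>C lact a x"
  using clinear_lact_left[of x] clinear_lact_right[of a] by (simp_all add: clinear_iff)

lemma ract_scaleC: "ract x (c *\<^sub>C a) = c *\<^sub>C ract x a" "ract (c *\<^sub>C x) a = c *\<^sub>C ract x a"
  using clinear_ract_left[of a] clinear_ract_right[of x] by (simp_all add: clinear_iff)

lemmas act_simps = lact_mult ract_mult lact_ract lact.add_left lact.add_right ract.add_left
  ract.add_right lact.diff_left lact.diff_right ract.diff_left ract.diff_right lact.minus_left
  lact.minus_right ract.minus_left ract.minus_right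

end

lemma local_unit_factor: "\<exists>w. local_unit (h * k) n = h * (w::'a::ring)"
proof (induction n)
  case 0
  then show ?case by (intro exI[of _ 0]) simp
next
  case (Suc n)
  then obtain w where "local_unit (h * k) n = h * w" by blast
  then have "local_unit (h * k) (Suc n) = h * (w + k - w * (h * k))"
    by (simp add: algebra_simps)
  then show ?case by blast
qed

text \<open>
  The identity satisfied by \<open>d = T - \<eta> \<cdot>\<close> when the form \<open>T(y) x + y T(x\<^sup>\<star>)\<^sup>\<star>\<close> is balanced; there, \<open>\<zeta>\<close> is the
  adjoint of \<open>\<eta>\<close>.
\<close>

locale twisted_derivation = banach_bimodule lact ract
  for lact :: "'a::cstar_algebra \<Rightarrow> 'x::cbanach \<Rightarrow> 'x" and ract +
  fixes d :: "'a \<Rightarrow> 'x" and \<eta> \<zeta> :: 'x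
  assumes bounded_clinear_d: "bounded_clinear d"
    and twisted: "ract (d x) y + lact x (d y)
      = d (y * x) + ract \<eta> (commutator y x) + lact (commutator y x) \<zeta>"
begin

definition G :: "'a \<Rightarrow> 'x"
  where "G w = d w + ract \<eta> w + lact w \<zeta>"

text \<open>
  The defect of \<open>d\<close> as a derivation, see \<open>d_mult\<close>. All that follows exploits the fact that it is a
  linear function of the commutator.
\<close>

definition g :: "'a \<Rightarrow> 'a \<Rightarrow> 'x"
  where "g x y = G (commutator x y)"

sublocale d: bounded_linear d
  using bounded_clinear_d by (simp add: bounded_clinear_iff)

lemma d_scaleC: "d (c *\<^sub>C x) = c *\<^sub>C d x"
  using bounded_clinear_d by (simp add: bounded_clinear_iff)

lemma G_scaleC: "G (c *\<^sub>C x) = c *\<^sub>C G x"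
  by (simp add: G_def d_scaleC lact_scaleC ract_scaleC scaleC_add_right)

lemma G_add: "G (x + y) = G x + G y"
  by (simp add: G_def d.add lact.add_left ract.add_right)

lemma G_minus: "G (- x) = - G x"
  by (simp add: G_def d.neg lact.minus_left ract.minus_right)

lemma G_diff: "G (x - y) = G x - G y"
  using G_add[of x "- y"] by (simp add: G_minus)

lemma g_swap: "g x y = - g y x"
  by (simp add: g_def commutator_def G_diff)

lemma g_same [simp]: "g x x = 0"
  by (simp add: g_def commutator_def G_def d.zero lact.zero_left ract.zero_right)

lemma d_mult: "d (x * y) = ract (d x) y + lact x (d y) + g x y"
proof -
  have "d (y * x) = d (x * y) + d (commutator y x)"
    by (simp add: commutator_def d.diff)
  then have "ract (d x) y + lact x (d y) = d (x * y) + g y x"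
    unfolding twisted by (simp add: g_def G_def)
  then show ?thesis unfolding g_swap[of x y] by simp
qed

text \<open>
  Evaluation of \<open>d\<close> on \<open>z y w\<close> with both bracketings.
\<close>

lemma g_cocycle: "lact z (g y w) + g z (y * w) = ract (g z y) w + g (z * y) w"
proof -
  have "d (z * (y * w)) = d (z * y * w)" by (simp only: mult.assoc)
  then show ?thesis by (simp only: d_mult act_simps) (simp add: algebra_simps)
qed

text \<open>
  Since \<open>[z, y w] - [z y, w] = [w z, y]\<close>, the cocycle identity determines \<open>g (w z) y\<close>.
\<close>

lemma g_antiderivation: "g (w * z) y = ract (g z y) w + lact z (g w y)"
proof -
  have "g z (y * w) - g (z * y) w = g (w * z) y"
    unfolding g_def G_diff[symmetric] by (simp add: commutator_def algebra_simps)
  moreover have "g z (y * w) - g (z * y) w = ract (g z y) w - lact z (g y w)"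
    using g_cocycle[of z y w] by (simp add: algebra_simps)
  ultimately show ?thesis unfolding g_swap[of w y] by (simp add: lact.minus_right)
qed

lemma d_triple: "d (u * (x * v)) = ract (d u) (x * v) + lact u (ract (d x) v) + lact u (lact x (d v))
  + ract (g u x) v + ract (g x v) u + lact x (g u v)"
  using d_mult[of "u * x" v] unfolding d_mult[of u x] g_antiderivation[of u x v]
  by (simp add: act_simps mult.assoc)

lemma d_jordan_triple: "d (u * (x * u)) = ract (d u) (x * u) + lact u (ract (d x) u) + lact u (lact x (d u))"
  unfolding d_triple g_swap[of x u] by (simp add: act_simps lact.zero_right)

lemma d_jordan_triple2: "d (u * (x * v)) + d (v * (x * u))
  = ract (d u) (x * v) + lact u (ract (d x) v) + lact u (lact x (d v))
  + ract (d v) (x * u) + lact v (ract (d x) u) + lact v (lact x (d u))"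
  unfolding d_triple g_swap[of x u] g_swap[of x v] g_swap[of v u] by (simp add: act_simps)

text \<open>
  The two ways of evaluating \<open>d\<close> on \<open>a b x b a + b a x a b\<close>: as a symmetrized triple product of \<open>a b\<close>
  and \<open>b a\<close> around \<open>x\<close>, and as two nested triple products.
\<close>

lemma g_commutator_anticommute:
  fixes a b :: 'a
  defines "p \<equiv> commutator a b"
  shows "ract (g a b) (x * p) = - lact (p * x) (g a b)"
proof -
  have e: "d ((a * b) * (x * (b * a))) + d ((b * a) * (x * (a * b)))
      = d (a * ((b * (x * b)) * a)) + d (b * ((a * (x * a)) * b))"
    by (simp only: mult.assoc)
  have "ract (g a b) (x * (b * a)) + ract (g b a) (x * (a * b))
      + lact (a * b) (lact x (g b a)) + lact (b * a) (lact x (g a b)) = 0"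
    using e unfolding d_jordan_triple2[of "a * b" x "b * a"] d_jordan_triple d_mult[of a b] d_mult[of b a]
    by (simp add: act_simps add_ac)
  then show ?thesis
    unfolding g_swap[of b a] p_def commutator_def by (simp add: act_simps algebra_simps)
qed

text \<open>
  Moving \<open>g a b\<close> across \<open>x p y p\<close> in one step costs one sign, in two steps it costs two.
\<close>

lemma g_annihilated:
  fixes a b :: 'a
  defines "p \<equiv> commutator a b"
  shows "lact (p * (x * (p * y))) (g a b) = 0" "ract (g a b) (x * (p * (y * p))) = 0"
proof -
  note ac = g_commutator_anticommute[of a b, folded p_def]
  have "ract (g a b) (x * (p * (y * p))) = - lact (p * (x * (p * y))) (g a b)"
    using ac[of "x * (p * y)"] by (simp add: mult.assoc)
  moreover have "ract (g a b) (x * (p * (y * p))) = ract (ract (g a b) (x * p)) (y * p)"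
    by (simp add: ract_mult)
  moreover have "\<dots> = - lact (p * x) (ract (g a b) (y * p))"
    by (simp add: ac[of x] ract.minus_left lact_ract)
  moreover have "\<dots> = lact (p * (x * (p * y))) (g a b)"
    by (simp add: ac[of y] lact.minus_right lact_mult)
  ultimately have *: "lact (p * (x * (p * y))) (g a b) = - lact (p * (x * (p * y))) (g a b)"
    by simp
  then have "2 *\<^sub>R lact (p * (x * (p * y))) (g a b) = 0"
    by (simp only: scaleR_2 eq_neg_iff_add_eq_0)
  then show "lact (p * (x * (p * y))) (g a b) = 0" by simp
  then show "ract (g a b) (x * (p * (y * p))) = 0"
    using ac[of "x * (p * y)"] by (simp add: mult.assoc)
qed

lemma local_unit_annihilates:
  assumes "lact k z = 0" "ract z k = 0"
  shows "lact (local_unit k n) z = 0" "ract z (local_unit k n) = 0"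
  by (induction n) (simp_all add: act_simps assms lact.zero_left lact.zero_right ract.zero_left ract.zero_right)

text \<open>
  The element \<open>(1 - e) z (1 - e)\<close>.
\<close>

definition corner :: "'a \<Rightarrow> 'x \<Rightarrow> 'x"
  where "corner e z = (z - lact e z) - ract (z - lact e z) e"

lemma corner_add: "corner e (y + z) = corner e y + corner e z"
  by (simp add: corner_def act_simps algebra_simps)

text \<open>
  The local units \<open>e\<close> for \<open>c\<close> annihilate \<open>G c\<close> on both sides, so \<open>G c\<close> equals its own corner
  \<open>(1 - e) (G c) (1 - e)\<close>. On the other hand \<open>G c = d(c) + \<eta> c + c \<zeta>\<close>, and the corner of
  \<open>y c\<close> or \<open>c y\<close> tends to zero as \<open>e\<close> improves. The term \<open>d(c)\<close> is replaced by \<open>d(c w c)\<close>, which by the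
  triple identity is a sum of such elements; here \<open>w\<close> comes from a fixed local unit \<open>c w\<close>, so that
  \<open>c w c\<close> is close to \<open>c\<close>.
\<close>

lemma G_eq_0_if_annihilated:
  fixes c :: 'a
  assumes c: "c\<^sup>\<star> = c" "norm c < 1"
  defines "k \<equiv> c * (c * (c * c))"
  assumes k: "lact k (G c) = 0" "ract (G c) k = 0"
  shows "G c = 0"
proof -
  obtain L where L: "L \<ge> 0" "\<And>a x. norm (lact a x) \<le> norm a * norm x * L"
    using lact.nonneg_bounded by blast
  obtain R where R: "R \<ge> 0" "\<And>x a. norm (ract x a) \<le> norm x * norm a * R"
    using ract.nonneg_bounded by blast
  obtain M where M: "M \<ge> 0" "\<And>x. norm (d x) \<le> norm x * M"
    using d.nonneg_bounded by blast
  have "\<exists>n. norm (local_unit k n) \<le> 1 \<and> norm (c - local_unit k n * c) \<le> inverse (Suc j)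
      \<and> norm (c - c * local_unit k n) \<le> inverse (Suc j)" for j
    using local_unit_approximates[OF c, of "inverse (Suc j)"] unfolding k_def by auto
  then obtain n where n: "\<And>j. norm (local_unit k (n j)) \<le> 1"
    "\<And>j. norm (c - local_unit k (n j) * c) \<le> inverse (Suc j)"
    "\<And>j. norm (c - c * local_unit k (n j)) \<le> inverse (Suc j)"
    by metis
  define e where "e j = local_unit k (n j)" for j
  have e: "norm (e j) \<le> 1" "norm (c - e j * c) \<le> inverse (Suc j)"
    "norm (c - c * e j) \<le> inverse (Suc j)" for j
    using n by (simp_all add: e_def)
  have lim0: "(\<lambda>j. C * inverse (real (Suc j))) \<longlonglongrightarrow> 0" for C
    using tendsto_mult_right_zero[OF LIMSEQ_inverse_real_of_nat] .
  have Lb: "norm (z - lact (e j) z) \<le> (1 + L) * norm z" for j z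
  proof -
    have "norm (lact (e j) z) \<le> 1 * norm z * L"
      using e(1)[of j] L(1) by (intro order_trans[OF L(2)] mult_right_mono) auto
    then show ?thesis using norm_triangle_ineq4[of z "lact (e j) z"] by (simp add: algebra_simps)
  qed
  have Rb: "norm (z - ract z (e j)) \<le> (1 + R) * norm z" for j z
  proof -
    have "norm (ract z (e j)) \<le> norm z * 1 * R"
      using e(1)[of j] R(1) by (intro order_trans[OF R(2)] mult_right_mono mult_left_mono) auto
    then show ?thesis using norm_triangle_ineq4[of z "ract z (e j)"] by (simp add: algebra_simps)
  qed
  have corner_le: "norm (corner (e j) z) \<le> (1 + R) * ((1 + L) * norm z)" for j z
    unfolding corner_def using Rb Lb R(1) by (intro order_trans[OF Rb] mult_left_mono) auto
  have lim_r: "(\<lambda>j. corner (e j) (ract y c)) \<longlonglongrightarrow> 0" for y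
  proof (rule Lim_null_comparison[OF _ lim0[of "(1 + L) * norm y * R"]], rule always_eventually, rule allI)
    fix j
    have "corner (e j) (ract y c) = ract (y - lact (e j) y) (c - c * e j)"
      by (simp add: corner_def act_simps algebra_simps)
    also have "norm \<dots> \<le> ((1 + L) * norm y) * inverse (Suc j) * R"
      using R(1) L(1) Lb e(3) by (intro order_trans[OF R(2)] mult_right_mono mult_mono) auto
    finally show "norm (corner (e j) (ract y c)) \<le> (1 + L) * norm y * R * inverse (Suc j)"
      by (simp add: mult_ac)
  qed
  have lim_l: "(\<lambda>j. corner (e j) (lact c y)) \<longlonglongrightarrow> 0" for y
  proof (rule Lim_null_comparison[OF _ lim0[of "(1 + R) * (norm y * L)"]], rule always_eventually, rule allI)
    fix j
    have eq: "corner (e j) (lact c y) = lact (c - e j * c) y - ract (lact (c - e j * c) y) (e j)"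
      by (simp add: corner_def act_simps algebra_simps)
    have "norm (corner (e j) (lact c y)) \<le> (1 + R) * norm (lact (c - e j * c) y)"
      unfolding eq by (rule Rb)
    also have "\<dots> \<le> (1 + R) * (inverse (Suc j) * norm y * L)"
      using R(1) L(1) e(2) by (intro mult_left_mono order_trans[OF L(2)] mult_right_mono) auto
    finally show "norm (corner (e j) (lact c y)) \<le> (1 + R) * (norm y * L) * inverse (Suc j)"
      by (simp add: mult_ac)
  qed
  have "norm (G c) \<le> (1 + R) * ((1 + L) * (M * inverse (Suc i)))" for i
  proof -
    \<comment> \<open>The index \<open>i\<close> fixes the replacement of \<open>c\<close>; afterwards \<open>j\<close> tends to infinity.\<close>
    obtain w where w: "e i = c * w"
      using local_unit_factor[of c "c * (c * c)" "n i"] unfolding e_def k_def by blast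
    define x where "x = c * (w * c)"
    have cx: "norm (c - x) \<le> inverse (Suc i)" using e(2)[of i] by (simp add: w x_def mult.assoc)
    have dx: "d x = ract (ract (d c) w) c + lact c (ract (d w) c) + lact c (lact w (d c))"
      by (simp add: x_def d_jordan_triple ract_mult)
    have Gc: "G c = d (c - x) + (d x + ract \<eta> c + lact c \<zeta>)"
      by (simp add: G_def d.diff)
    have "corner (e j) (G c) = G c" for j
      using local_unit_annihilates[OF k] by (simp add: corner_def e_def)
    then have cG: "G c = corner (e j) (d (c - x)) + corner (e j) (d x + ract \<eta> c + lact c \<zeta>)" for j
      using Gc corner_add by metis
    have "(\<lambda>j. corner (e j) (d x + ract \<eta> c + lact c \<zeta>)) \<longlonglongrightarrow> 0 + 0 + 0 + 0 + 0"
      unfolding dx corner_add by (intro tendsto_add lim_l lim_r)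
    then have "(\<lambda>j. (1 + R) * ((1 + L) * (M * inverse (Suc i)))
        + norm (corner (e j) (d x + ract \<eta> c + lact c \<zeta>))) \<longlonglongrightarrow> (1 + R) * ((1 + L) * (M * inverse (Suc i))) + 0"
      by (intro tendsto_add tendsto_const tendsto_norm_zero) simp
    moreover have "norm (G c) \<le> (1 + R) * ((1 + L) * (M * inverse (Suc i)))
        + norm (corner (e j) (d x + ract \<eta> c + lact c \<zeta>))" for j
    proof -
      have "norm (d (c - x)) \<le> M * inverse (Suc i)"
        using mult_right_mono[OF cx M(1)] M(2)[of "c - x"] by (simp add: mult.commute)
      then have "norm (corner (e j) (d (c - x))) \<le> (1 + R) * ((1 + L) * (M * inverse (Suc i)))"
        using R(1) L(1) by (intro order_trans[OF corner_le] mult_left_mono) auto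
      then show ?thesis
        using norm_triangle_ineq[of "corner (e j) (d (c - x))" "corner (e j) (d x + ract \<eta> c + lact c \<zeta>)"]
        unfolding cG[of j, symmetric] by linarith
    qed
    ultimately show ?thesis
      using LIMSEQ_le_const[of _ "(1 + R) * ((1 + L) * (M * inverse (Suc i))) + 0" "norm (G c)"] by auto
  qed
  moreover have "(\<lambda>i. (1 + R) * ((1 + L) * (M * inverse (Suc i)))) \<longlonglongrightarrow> 0"
    using lim0[of "(1 + R) * (1 + L) * M"] by (simp add: mult.assoc)
  ultimately have "norm (G c) \<le> 0" using LIMSEQ_le_const by blast
  then show ?thesis by simp
qed

text \<open>
  The commutator of self-adjoint elements is skew-adjoint, so that a multiple by an imaginary scalar is
  self-adjoint and falls under the previous lemma.
\<close>

lemma g_self_adjoint_eq_0: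
  assumes "a\<^sup>\<star> = a" "b\<^sup>\<star> = b"
  shows "g a b = 0"
proof -
  define p where "p = commutator a b"
  have pos: "norm p + 1 > 0" using norm_ge_zero[of p] by linarith
  define r where "r = inverse (norm p + 1)"
  define s where "s = complex_of_real r * \<i>"
  define c where "c = s *\<^sub>C p"
  have r: "r > 0" using pos by (simp add: r_def)
  then have s: "s \<noteq> 0" "cmod s = r" by (simp_all add: s_def norm_mult)
  have c: "norm c < 1" using pos by (simp add: c_def norm_scaleC s r_def divide_simps)
  have "p\<^sup>\<star> = - p" by (simp add: p_def commutator_def star_diff star_mult assms)
  then have cs: "c\<^sup>\<star> = c" by (simp add: c_def star_scaleC s_def)
  have Gc: "G c = s *\<^sub>C g a b" by (simp add: c_def G_scaleC g_def p_def)
  have "lact (c * (c * (c * c))) (G c) = 0"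
    using g_annihilated(1)[of a b c c, folded p_def]
    unfolding Gc by (simp add: c_def mult_scaleC_left mult_scaleC_right lact_scaleC)
  moreover have "ract (G c) (c * (c * (c * c))) = 0"
    using g_annihilated(2)[of a b c c, folded p_def]
    unfolding Gc by (simp add: c_def mult_scaleC_left mult_scaleC_right ract_scaleC)
  ultimately have "G c = 0" by (intro G_eq_0_if_annihilated cs c)
  then have "inverse s *\<^sub>C s *\<^sub>C g a b = 0" unfolding Gc by simp
  then show ?thesis using s by (simp add: scaleC_scaleC)
qed

theorem g_eq_0: "g x y = 0"
proof -
  obtain a b where ab: "a\<^sup>\<star> = a" "b\<^sup>\<star> = b" and x: "x = a + \<i> *\<^sub>C b"
    by (rule self_adjoint_decomposition)
  obtain a' b' where ab': "a'\<^sup>\<star> = a'" "b'\<^sup>\<star> = b'" and y: "y = a' + \<i> *\<^sub>C b'"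
    by (rule self_adjoint_decomposition)
  have "commutator x y = commutator a a' + \<i> *\<^sub>C commutator a b'
      + (\<i> *\<^sub>C commutator b a' + \<i> *\<^sub>C \<i> *\<^sub>C commutator b b')"
    by (simp add: x y commutator_def algebra_simps mult_scaleC_left mult_scaleC_right scaleC_diff_right)
  then show ?thesis
    using g_self_adjoint_eq_0[OF ab(1) ab'(1)] g_self_adjoint_eq_0[OF ab(1) ab'(2)]
      g_self_adjoint_eq_0[OF ab(2) ab'(1)] g_self_adjoint_eq_0[OF ab(2) ab'(2)]
    by (simp add: g_def G_add G_diff G_scaleC)
qed

corollary derivation_d: "derivation lact ract d"
  using bounded_clinear_d by (simp add: derivation_def bounded_clinear_def d_mult g_eq_0)

end


section \<open>Functionals that separate points\<close>

definition sublinear :: "('a::real_vector \<Rightarrow> real) \<Rightarrow> bool"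
  where "sublinear p \<longleftrightarrow> (\<forall>x y. p (x + y) \<le> p x + p y) \<and> (\<forall>r>0. \<forall>x. p (r *\<^sub>R x) = r * p x)"

lemma sublinearI:
  assumes "\<And>x y. p (x + y) \<le> p x + p y" "\<And>r x. r > 0 \<Longrightarrow> p (r *\<^sub>R x) \<le> r * p x"
  shows "sublinear p"
  unfolding sublinear_def
proof (intro conjI allI impI antisym assms)
  fix r :: real and x assume r: "r > 0"
  then have "p (inverse r *\<^sub>R r *\<^sub>R x) \<le> inverse r * p (r *\<^sub>R x)" by (intro assms) simp
  then show "r * p x \<le> p (r *\<^sub>R x)" using r by (simp add: field_simps)
qed

lemma sublinear_0:
  assumes "sublinear p"
  shows "p 0 = 0"
proof -
  have "p (2 *\<^sub>R 0) = 2 * p 0" using assms unfolding sublinear_def by (metis zero_less_numeral)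
  then show ?thesis by simp
qed

text \<open>
  The largest sublinear function below \<open>p\<close> that is at most \<open>- p y\<close> at \<open>- y\<close>. It serves both to
  prescribe the value of a functional at \<open>y\<close> and to show that minimal sublinear functions are odd.
\<close>

definition lower :: "('a::real_vector \<Rightarrow> real) \<Rightarrow> 'a \<Rightarrow> 'a \<Rightarrow> real"
  where "lower p y x = (INF t\<in>{0..}. p (x + t *\<^sub>R y) - t * p y)"

context
  fixes p :: "'a::real_vector \<Rightarrow> real"
  assumes p: "sublinear p"
begin

lemma sublinear_add: "p (x + y) \<le> p x + p y"
  using p by (simp add: sublinear_def)

lemma sublinear_scale: "r \<ge> 0 \<Longrightarrow> p (r *\<^sub>R x) = r * p x"
  using p sublinear_0[OF p] by (cases "r = 0") (auto simp: sublinear_def)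

lemma lower_le: "t \<ge> 0 \<Longrightarrow> lower p y x \<le> p (x + t *\<^sub>R y) - t * p y"
  unfolding lower_def
proof (rule cINF_lower)
  have "- p (- x) \<le> p (x + t *\<^sub>R y) - t * p y" if "t \<ge> 0" for t
    using sublinear_add[of "x + t *\<^sub>R y" "- x"] that by (simp add: sublinear_scale)
  then show "bdd_below ((\<lambda>t. p (x + t *\<^sub>R y) - t * p y) ` {0..})"
    by (intro bdd_belowI2[of _ "- p (- x)"]) auto
qed simp

lemma le_lower: "(\<And>t. t \<ge> 0 \<Longrightarrow> m \<le> p (x + t *\<^sub>R y) - t * p y) \<Longrightarrow> m \<le> lower p y x"
  unfolding lower_def by (rule cINF_greatest) auto

lemma lower_le_self: "lower p y x \<le> p x"
  using lower_le[of 0 y x] by simp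

lemma lower_minus_le: "lower p y (- y) \<le> - p y"
  using lower_le[of 1 y "- y"] sublinear_0[OF p] by simp

lemma sublinear_lower: "sublinear (lower p y)"
proof (rule sublinearI)
  fix x x'
  have "lower p y (x + x') - (p (x + t *\<^sub>R y) - t * p y) \<le> lower p y x'" if t: "t \<ge> 0" for t
  proof (rule le_lower)
    fix s :: real assume s: "s \<ge> 0"
    have eq: "x + x' + (t + s) *\<^sub>R y = (x + t *\<^sub>R y) + (x' + s *\<^sub>R y)"
      by (simp add: scaleR_add_left)
    show "lower p y (x + x') - (p (x + t *\<^sub>R y) - t * p y) \<le> p (x' + s *\<^sub>R y) - s * p y"
      using lower_le[of "t + s" y "x + x'"] sublinear_add[of "x + t *\<^sub>R y" "x' + s *\<^sub>R y"] s t
      unfolding eq by (simp add: distrib_right)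
  qed
  then have "lower p y (x + x') - lower p y x' \<le> lower p y x"
    by (intro le_lower) (simp add: algebra_simps)
  then show "lower p y (x + x') \<le> lower p y x + lower p y x'" by simp
next
  fix r :: real and x assume r: "r > 0"
  have "inverse r * lower p y (r *\<^sub>R x) \<le> lower p y x"
  proof (rule le_lower)
    fix t :: real assume t: "t \<ge> 0"
    have "lower p y (r *\<^sub>R x) \<le> p (r *\<^sub>R x + (r * t) *\<^sub>R y) - (r * t) * p y"
      using r t by (intro lower_le) simp
    also have "r *\<^sub>R x + (r * t) *\<^sub>R y = r *\<^sub>R (x + t *\<^sub>R y)" by (simp add: scaleR_add_right)
    finally have "lower p y (r *\<^sub>R x) \<le> r * (p (x + t *\<^sub>R y) - t * p y)"
      using r by (simp add: sublinear_scale right_diff_distrib mult.assoc)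
    then show "inverse r * lower p y (r *\<^sub>R x) \<le> p (x + t *\<^sub>R y) - t * p y"
      using r by (simp add: field_simps)
  qed
  then show "lower p y (r *\<^sub>R x) \<le> r * lower p y x" using r by (simp add: field_simps)
qed

end

text \<open>
  The theorem of Hahn and Banach, through minimal sublinear functions: Zorn's lemma gives a minimal
  function \<open>f\<close> below \<open>q\<close>, and \<open>lower f y = f\<close> shows that \<open>f\<close> is odd, hence linear. This avoids
  functionals on subspaces.
\<close>

lemma ex_linear_below_sublinear:
  fixes q :: "'a::real_vector \<Rightarrow> real"
  assumes q: "sublinear q"
  obtains f where "linear f" "\<And>x. f x \<le> q x"
proof -
  define A where "A = {p. sublinear p \<and> p \<le> q}"
  have "\<exists>m\<in>A. \<forall>a\<in>A. m \<ge> a \<longrightarrow> a = m"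
  proof (rule predicate_Zorn)
    show "partial_order_on A (relation_of (\<ge>) A)"
      by (rule partial_order_on_relation_ofI) auto
    fix C assume C: "C \<in> Chains (relation_of (\<ge>) A)"
    then have CA: "C \<subseteq> A" and ch: "\<And>p p'. p \<in> C \<Longrightarrow> p' \<in> C \<Longrightarrow> p \<le> p' \<or> p' \<le> p"
      by (auto simp: Chains_def relation_of_def)
    show "\<exists>u\<in>A. \<forall>a\<in>C. a \<ge> u"
    proof (cases "C = {}")
      case True
      then show ?thesis using q by (auto simp: A_def)
    next
      case False
      define u where "u x = (INF p\<in>C. p x)" for x
      have sub: "sublinear p" "p \<le> q" if "p \<in> C" for p using that CA by (auto simp: A_def)
      have "- q (- x) \<le> p x" if "p \<in> C" for p x
        using sublinear_add[OF sub(1)[OF that], of x "- x"] le_funD[OF sub(2)[OF that], of "- x"]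
          sublinear_0[OF sub(1)[OF that]] by simp
      then have "bdd_below ((\<lambda>p. p x) ` C)" for x
        by (intro bdd_belowI2[of _ "- q (- x)"])
      then have low: "u x \<le> p x" if "p \<in> C" for p x unfolding u_def using that by (intro cINF_lower)
      have great: "m \<le> u x" if "\<And>p. p \<in> C \<Longrightarrow> m \<le> p x" for m x
        unfolding u_def using that False by (intro cINF_greatest)
      have "sublinear u"
      proof (rule sublinearI)
        fix x y
        have *: "u (x + y) \<le> p x + p' y" if pp: "p \<in> C" "p' \<in> C" for p p'
        proof -
          obtain r where r: "r \<in> C" "r \<le> p" "r \<le> p'" using ch[OF pp] pp by blast
          have "u (x + y) \<le> r x + r y"
            using low[OF r(1), of "x + y"] sublinear_add[OF sub(1)[OF r(1)], of x y] by simp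
          then show ?thesis using le_funD[OF r(2), of x] le_funD[OF r(3), of y] by simp
        qed
        have "u (x + y) - p x \<le> u y" if "p \<in> C" for p
        proof (rule great)
          fix p' assume "p' \<in> C"
          then show "u (x + y) - p x \<le> p' y" using * [OF that, of p'] by simp
        qed
        then have "u (x + y) - u y \<le> u x" by (intro great) (simp add: algebra_simps)
        then show "u (x + y) \<le> u x + u y" by simp
      next
        fix r :: real and x assume r: "r > 0"
        have "inverse r * u (r *\<^sub>R x) \<le> u x"
        proof (rule great)
          fix p assume p: "p \<in> C"
          show "inverse r * u (r *\<^sub>R x) \<le> p x"
            using low[OF p, of "r *\<^sub>R x"] sublinear_scale[OF sub(1)[OF p], of r x] r by (simp add: field_simps)
        qed
        then show "u (r *\<^sub>R x) \<le> r * u x" using r by (simp add: field_simps)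
      qed
      moreover have "u \<le> q"
        using False low sub(2) by (metis all_not_in_conv le_fun_def order_trans)
      ultimately show ?thesis using low by (intro bexI[of _ u]) (auto simp: A_def le_fun_def)
    qed
  qed
  then obtain f where f: "sublinear f" "f \<le> q" and min: "\<And>p. sublinear p \<Longrightarrow> p \<le> f \<Longrightarrow> p = f"
    unfolding A_def by (metis (mono_tags, lifting) mem_Collect_eq order_trans)
  have "lower f y = f" for y
    using sublinear_lower[OF f(1)] lower_le_self[OF f(1)] by (intro min) (auto simp: le_fun_def)
  then have "f (- y) \<le> - f y" for y using lower_minus_le[OF f(1), of y] by simp
  moreover have "f (- y) \<ge> - f y" for y
    using sublinear_add[OF f(1), of y "- y"] sublinear_0[OF f(1)] by simp
  ultimately have neg: "f (- y) = - f y" for y by (simp add: antisym)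
  have "linear f"
  proof (rule linearI)
    fix x y
    show "f (x + y) = f x + f y"
      using sublinear_add[OF f(1), of x y] sublinear_add[OF f(1), of "x + y" "- y"] neg[of y] by simp
  next
    fix r x
    show "f (r *\<^sub>R x) = r *\<^sub>R f x"
    proof (cases "r \<ge> 0")
      case False
      then have "f (- r *\<^sub>R x) = - r * f x" by (intro sublinear_scale[OF f(1)]) simp
      then show ?thesis using neg[of "r *\<^sub>R x"] by simp
    qed (simp add: sublinear_scale[OF f(1)])
  qed
  then show ?thesis using le_funD[OF f(2)] by (rule that)
qed

lemma cdual_eqI: "(\<And>x. cdual_apply \<phi> x = cdual_apply \<psi> x) \<Longrightarrow> \<phi> = \<psi>"
  by (simp add: cdual_apply_inject[symmetric] fun_eq_iff)

lemma cdual_apply_scaleC: "cdual_apply \<phi> (c *\<^sub>C x) = c * cdual_apply \<phi> x"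
  using cdual_apply[of \<phi>] by (simp add: bounded_clinear_iff scaleC_complex_def)

lemmas cdual_apply_linear =
  bounded_linear.axioms(1)[OF bounded_linear_cdual_apply, THEN linear_add]
  bounded_linear.axioms(1)[OF bounded_linear_cdual_apply, THEN linear_diff]
  bounded_linear.axioms(1)[OF bounded_linear_cdual_apply, THEN linear_neg]
  bounded_linear.axioms(1)[OF bounded_linear_cdual_apply, THEN linear_0]
  cdual_apply_scaleC

lemmas cdual_rep_eq = plus_cdual.rep_eq minus_cdual.rep_eq uminus_cdual.rep_eq zero_cdual.rep_eq
  scaleC_cdual.rep_eq

lemma norm_cdual_apply_le: "cmod (cdual_apply \<phi> x) \<le> norm \<phi> * norm x"
  unfolding norm_cdual.rep_eq by (rule onorm[OF bounded_linear_cdual_apply])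

lemma norm_cdual_le: "0 \<le> B \<Longrightarrow> (\<And>x. cmod (cdual_apply \<phi> x) \<le> B * norm x) \<Longrightarrow> norm \<phi> \<le> B"
  unfolding norm_cdual.rep_eq by (rule onorm_bound)

text \<open>
  A real functional below \<open>lower norm x\<close> is at least \<open>norm x\<close> at \<open>x\<close>; it is the real part of a complex
  one.
\<close>

lemma cdual_separates_points:
  fixes x :: "'x::complex_normed_vector"
  assumes "x \<noteq> 0"
  obtains \<phi> where "cdual_apply \<phi> x \<noteq> 0"
proof -
  have nsub: "sublinear (norm :: 'x \<Rightarrow> real)"
    by (simp add: sublinear_def norm_triangle_ineq)
  obtain f where f: "linear f" "\<And>y. f y \<le> lower norm x y"
    using ex_linear_below_sublinear[OF sublinear_lower[OF nsub, of x]] by blast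
  have "f (- x) \<le> - norm x" using f(2)[of "- x"] lower_minus_le[OF nsub, of x] by simp
  then have fx: "f x \<ge> norm x" by (simp add: linear_neg[OF f(1)])
  have le: "f y \<le> norm y" for y using f(2)[of y] lower_le_self[OF nsub, of x y] by simp
  have fb: "\<bar>f y\<bar> \<le> norm y" for y using le[of y] le[of "- y"] by (simp add: linear_neg[OF f(1)] abs_le_iff)
  define F where "F y = Complex (f y) (- f (\<i> *\<^sub>C y))" for y
  have scale: "f (c *\<^sub>C y) = Re c * f y + Im c * f (\<i> *\<^sub>C y)" for c y
  proof -
    have "c *\<^sub>C y = Re c *\<^sub>R y + Im c *\<^sub>R \<i> *\<^sub>C y"
      by (simp add: scaleC_of_real[symmetric] scaleC_scaleC scaleC_add_left[symmetric] complex_eq mult.commute)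
    then show ?thesis by (simp add: linear_add[OF f(1)] linear_cmul[OF f(1)])
  qed
  have "bounded_clinear F"
    unfolding bounded_clinear_def clinear_iff
  proof (intro conjI allI exI)
    show "F (y + z) = F y + F z" for y z
      by (simp add: F_def linear_add[OF f(1)] scaleC_add_right complex_eq_iff)
    show "F (c *\<^sub>C y) = c *\<^sub>C F y" for c y
      using scale[of c y] scale[of "\<i> * c" y]
      by (simp add: F_def scaleC_complex_def complex_eq_iff scaleC_scaleC)
    show "norm (F y) \<le> 2 * norm y" for y
      using cmod_le[of "F y"] fb[of y] fb[of "\<i> *\<^sub>C y"] by (simp add: F_def norm_scaleC)
  qed
  then have "cdual_apply (Abs_cdual F) x = F x" by (simp add: Abs_cdual_inverse)
  moreover have "F x \<noteq> 0" using fx assms by (auto simp: F_def complex_eq_iff)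
  ultimately show ?thesis using that by metis
qed

lemma canonical_embedding_eq_0: "canonical_embedding x = 0 \<Longrightarrow> x = 0"
  using cdual_separates_points by (metis canonical_embedding_apply zero_cdual.rep_eq)


section \<open>Weak-star cluster points\<close>

text \<open>
  The theorem of Banach and Alaoglu, through Tychonoff's theorem for the functions on the dual that are
  dominated by a multiple of the norm. The filter is refined so that the cluster point becomes a limit.
\<close>

lemma weak_star_cluster_point:
  fixes f :: "'i \<Rightarrow> 'x::complex_normed_vector"
  assumes E: "E \<noteq> bot" and bd: "\<forall>\<^sub>F u in E. norm (f u) \<le> M"
  obtains E' \<eta> where "E' \<noteq> bot" "E' \<le> E"
    "\<And>\<phi>. ((\<lambda>u. cdual_apply \<phi> (f u)) \<longlongrightarrow> cdual_apply \<eta> \<phi>) E'"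
proof -
  define m where "m u \<phi> = cdual_apply \<phi> (f u)" for u \<phi>
  define K where "K = Pi\<^sub>E UNIV (\<lambda>\<phi>::'x cdual. cball (0::complex) (norm \<phi> * M))"
  have "compact K"
    unfolding K_def compactin_euclidean_iff[symmetric] euclidean_product_topology[symmetric]
    by (simp add: compactin_PiE)
  moreover have "\<forall>\<^sub>F g in filtermap m E. g \<in> K"
    unfolding eventually_filtermap
  proof (rule eventually_mono[OF bd])
    fix u assume "norm (f u) \<le> M"
    then show "m u \<in> K"
      by (auto simp: K_def m_def intro!: order_trans[OF norm_cdual_apply_le] mult_left_mono)
  qed
  moreover have "filtermap m E \<noteq> bot" using E by (simp add: filtermap_bot_iff)
  ultimately obtain g where g: "g \<in> K" "inf (nhds g) (filtermap m E) \<noteq> bot"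
    unfolding compact_filter by blast
  define E' where "E' = inf E (filtercomap m (nhds g))"
  have nb: "E' \<noteq> bot"
  proof
    assume "E' = bot"
    then have "eventually (\<lambda>u. False) E'" by simp
    then obtain P Q where PQ: "eventually P E" "eventually Q (nhds g)" "\<And>u. P u \<Longrightarrow> Q (m u) \<Longrightarrow> False"
      unfolding E'_def eventually_inf eventually_filtercomap by blast
    have "eventually (\<lambda>h. \<not> Q h) (filtermap m E)"
      unfolding eventually_filtermap by (rule eventually_mono[OF PQ(1)]) (use PQ(3) in blast)
    then have "eventually (\<lambda>h. False) (inf (nhds g) (filtermap m E))"
      using PQ(2) unfolding eventually_inf by blast
    then show False using g(2) by (simp add: trivial_limit_def)
  qed
  have "filterlim m (nhds g) E'"
    unfolding filterlim_def E'_def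
    by (rule order_trans[OF filtermap_mono[OF inf_le2] filtermap_filtercomap])
  then have lim: "((\<lambda>u. m u \<phi>) \<longlongrightarrow> g \<phi>) E'" for \<phi>
    using continuous_on_tendsto_compose[OF continuous_on_product_coordinates[of \<phi>], of m g E'] by simp
  have "bounded_clinear g"
    unfolding bounded_clinear_def clinear_iff
  proof (intro conjI allI exI)
    show "g (\<phi> + \<psi>) = g \<phi> + g \<psi>" for \<phi> \<psi>
      using tendsto_unique[OF nb lim[of "\<phi> + \<psi>"]] tendsto_add[OF lim[of \<phi>] lim[of \<psi>]]
      by (simp add: m_def cdual_rep_eq)
    show "g (c *\<^sub>C \<phi>) = c *\<^sub>C g \<phi>" for c \<phi>
      using tendsto_unique[OF nb lim[of "c *\<^sub>C \<phi>"]] tendsto_mult_left[OF lim[of \<phi>], of c]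
      by (simp add: m_def cdual_rep_eq scaleC_complex_def)
    show "norm (g \<phi>) \<le> M * norm \<phi>" for \<phi>
      using g(1) by (auto simp: K_def PiE_iff mult.commute)
  qed
  then have "cdual_apply (Abs_cdual g) = g" by (simp add: Abs_cdual_inverse)
  then have "((\<lambda>u. cdual_apply \<phi> (f u)) \<longlongrightarrow> cdual_apply (Abs_cdual g) \<phi>) E'" for \<phi>
    using lim[of \<phi>] by (simp add: m_def)
  moreover have "E' \<le> E" by (simp add: E'_def)
  ultimately show ?thesis using nb that by blast
qed


section \<open>Dual and bidual bimodules\<close>

lemma bounded_clinear_adjoint_map:
  assumes f: "bounded_clinear f"
  shows "bounded_clinear (adjoint_map f)"
proof -
  note ap = adjoint_map_apply[OF f]
  obtain K where K: "K \<ge> 0" "\<And>x. norm (f x) \<le> norm x * K"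
    using bounded_linear.nonneg_bounded[of f] f by (auto simp: bounded_clinear_iff)
  have "norm (adjoint_map f \<phi>) \<le> K * norm \<phi>" for \<phi>
  proof (rule norm_cdual_le)
    fix x
    have "cmod (cdual_apply \<phi> (f x)) \<le> norm \<phi> * (norm x * K)"
      by (rule order_trans[OF norm_cdual_apply_le]) (simp add: K mult_left_mono)
    then show "cmod (cdual_apply (adjoint_map f \<phi>) x) \<le> K * norm \<phi> * norm x"
      by (simp add: ap mult_ac)
  qed (simp add: K)
  then show ?thesis
    unfolding bounded_clinear_def clinear_iff
    by (auto intro!: cdual_eqI simp: ap cdual_rep_eq)
qed

lemma bounded_clinear_canonical_embedding:
  "bounded_clinear (canonical_embedding :: 'a::complex_normed_vector \<Rightarrow> _)"
proof -
  have "norm (canonical_embedding x) \<le> 1 * norm x" for x :: 'a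
  proof (rule norm_cdual_le)
    show "cmod (cdual_apply (canonical_embedding x) \<phi>) \<le> 1 * norm x * norm \<phi>" for \<phi>
      using norm_cdual_apply_le[of \<phi> x] by (simp add: canonical_embedding_apply mult.commute)
  qed simp
  then show ?thesis
    unfolding bounded_clinear_def clinear_iff
    by (auto intro!: cdual_eqI exI[of _ 1] simp: canonical_embedding_apply cdual_rep_eq cdual_apply_linear)
qed

lemma bounded_linear_canonical_embedding:
  "bounded_linear (canonical_embedding :: 'a::complex_normed_vector \<Rightarrow> _)"
  using bounded_clinear_canonical_embedding[unfolded bounded_clinear_iff] by (rule conjunct1)

lemma canonical_embedding_scaleC: "canonical_embedding (c *\<^sub>C x) = c *\<^sub>C canonical_embedding x"
  using bounded_clinear_canonical_embedding[unfolded bounded_clinear_iff] by blast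

lemmas canonical_embedding_linear =
  linear_add[OF bounded_linear.linear[OF bounded_linear_canonical_embedding]]
  linear_diff[OF bounded_linear.linear[OF bounded_linear_canonical_embedding]]
  linear_0[OF bounded_linear.linear[OF bounded_linear_canonical_embedding]]
  canonical_embedding_scaleC

lemma canonical_embedding_inject: "canonical_embedding x = canonical_embedding y \<longleftrightarrow> x = y"
  using canonical_embedding_eq_0[of "x - y"] by (auto simp: canonical_embedding_linear)

context banach_bimodule begin

lemma bounded_clinear_act: "bounded_clinear (lact a)" "bounded_clinear (\<lambda>x. ract x a)"
  by (simp_all add: bounded_clinear_iff lact_scaleC ract_scaleC lact.bounded_linear_right
      ract.bounded_linear_left)

lemma dual_lact_apply: "cdual_apply (dual_lact ract a \<phi>) y = cdual_apply \<phi> (ract y a)"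
  by (simp add: dual_lact_def adjoint_map_apply bounded_clinear_act)

lemma dual_ract_apply: "cdual_apply (dual_ract lact \<phi> a) y = cdual_apply \<phi> (lact a y)"
  using adjoint_map_apply[OF bounded_clinear_act(1)] by (simp add: dual_ract_def)

lemma banach_bimodule_dual: "banach_bimodule (dual_lact ract) (dual_ract lact)"
proof
  obtain K where K: "K \<ge> 0" "\<And>a x. norm (lact a x) \<le> norm a * norm x * K"
    using lact.nonneg_bounded by blast
  have "norm (dual_ract lact \<phi> a) \<le> K * norm \<phi> * norm a" for \<phi> a
  proof (rule norm_cdual_le)
    fix x
    have "cmod (cdual_apply \<phi> (lact a x)) \<le> norm \<phi> * (norm a * norm x * K)"
      by (rule order_trans[OF norm_cdual_apply_le]) (simp add: K mult_left_mono)
    then show "cmod (cdual_apply (dual_ract lact \<phi> a) x) \<le> K * norm \<phi> * norm a * norm x"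
      by (simp add: dual_ract_apply mult_ac)
  qed (simp add: K)
  then show "\<exists>K. \<forall>a x. norm (dual_ract lact x a) \<le> K * norm x * norm a" by blast
  obtain M where M: "M \<ge> 0" "\<And>x a. norm (ract x a) \<le> norm x * norm a * M"
    using ract.nonneg_bounded by blast
  have "norm (dual_lact ract a \<phi>) \<le> M * norm a * norm \<phi>" for \<phi> a
  proof (rule norm_cdual_le)
    fix x
    have "cmod (cdual_apply \<phi> (ract x a)) \<le> norm \<phi> * (norm x * norm a * M)"
      by (rule order_trans[OF norm_cdual_apply_le]) (simp add: M mult_left_mono)
    then show "cmod (cdual_apply (dual_lact ract a \<phi>) x) \<le> M * norm a * norm \<phi> * norm x"
      by (simp add: dual_lact_apply mult_ac)
  qed (simp add: M)
  then show "\<exists>K. \<forall>a x. norm (dual_lact ract a x) \<le> K * norm a * norm x" by blast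
qed (auto simp: clinear_iff dual_lact_apply dual_ract_apply cdual_rep_eq cdual_apply_linear act_simps
    lact_scaleC ract_scaleC intro!: cdual_eqI)

text \<open>
  The bidual is the dual of the dual, so what holds for duals carries over to it.
\<close>

lemma dual_lact_dual_ract: "dual_lact (dual_ract lact) = bidual_lact lact"
  by (simp add: fun_eq_iff dual_lact_def dual_ract_def bidual_lact_def)

lemma dual_ract_dual_lact: "dual_ract (dual_lact ract) = bidual_ract ract"
  by (simp add: fun_eq_iff dual_lact_def dual_ract_def bidual_ract_def)

lemma bidual_lact_apply:
  "cdual_apply (bidual_lact lact a z) \<phi> = cdual_apply z (dual_ract lact \<phi> a)"
  using banach_bimodule.dual_lact_apply[OF banach_bimodule_dual] by (simp add: dual_lact_dual_ract)

lemma bidual_ract_apply: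
  "cdual_apply (bidual_ract ract z a) \<phi> = cdual_apply z (dual_lact ract a \<phi>)"
  using banach_bimodule.dual_ract_apply[OF banach_bimodule_dual] by (simp add: dual_ract_dual_lact)

lemma canonical_embedding_lact:
  "canonical_embedding (lact a x) = bidual_lact lact a (canonical_embedding x)"
  by (rule cdual_eqI) (simp add: canonical_embedding_apply bidual_lact_apply dual_ract_apply)

lemma canonical_embedding_ract:
  "canonical_embedding (ract x a) = bidual_ract ract (canonical_embedding x) a"
  by (rule cdual_eqI) (simp add: canonical_embedding_apply bidual_ract_apply dual_lact_apply)

text \<open>
  This gives the product formula in (ii), in the bidual as well as in \<open>X\<close>.
\<close>

lemma perturbed_derivation_mult:
  assumes d: "derivation lact ract d" and T: "\<And>a. T a = d a + ract \<eta> a"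
  shows "T (a * b) = lact a (T b) + ract (T a) b - ract (lact a \<eta>) b"
  using d by (simp add: derivation_def T act_simps)

end

context banach_star_bimodule begin

lemma bounded_linear_invol: "bounded_linear invol"
  by (rule bounded_linear_if_conjugate_linear_continuous[OF conjugate_linear_invol continuous_invol])

sublocale invol: bounded_linear invol by (rule bounded_linear_invol)

lemma invol_scaleC: "invol (c *\<^sub>C x) = cnj c *\<^sub>C invol x"
  using conjugate_linear_invol by (simp add: conjugate_linear_def)

lemmas dual_invol_apply = dual_involution_apply[OF conjugate_linear_invol continuous_invol]

lemma banach_star_bimodule_dual:
  "banach_star_bimodule (dual_lact ract) (dual_ract lact) (dual_involution invol)"
proof -
  interpret D: banach_bimodule "dual_lact ract" "dual_ract lact" by (rule banach_bimodule_dual)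
  have cl: "conjugate_linear (dual_involution invol)"
    unfolding conjugate_linear_def
    by (auto intro!: cdual_eqI simp: dual_invol_apply cdual_rep_eq)
  obtain K where K: "K \<ge> 0" "\<And>x. norm (invol x) \<le> norm x * K"
    using invol.nonneg_bounded by blast
  have bd: "norm (dual_involution invol \<phi>) \<le> norm \<phi> * K" for \<phi>
  proof (rule norm_cdual_le)
    fix x
    have "cmod (cdual_apply \<phi> (invol x)) \<le> norm \<phi> * (norm x * K)"
      by (rule order_trans[OF norm_cdual_apply_le]) (simp add: K mult_left_mono)
    then show "cmod (cdual_apply (dual_involution invol \<phi>) x) \<le> norm \<phi> * K * norm x"
      by (simp add: dual_invol_apply mult_ac)
  qed (simp add: K)
  have "bounded_linear (dual_involution invol)"
    using cl bd by (intro bounded_linear_intro) (auto simp: conjugate_linear_def scaleC_of_real[symmetric])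
  then have "continuous_on UNIV (dual_involution invol)" by (rule linear_continuous_on)
  with cl show ?thesis
    by unfold_locales (auto intro!: cdual_eqI simp: dual_invol_apply dual_lact_apply dual_ract_apply
        invol_lact invol_ract invol_invol star_star)
qed

lemma banach_star_bimodule_bidual:
  "banach_star_bimodule (bidual_lact lact) (bidual_ract ract) (bidual_involution invol)"
  using banach_star_bimodule.banach_star_bimodule_dual[OF banach_star_bimodule_dual]
  by (simp add: dual_lact_dual_ract dual_ract_dual_lact bidual_involution_def)

lemma bidual_involution_apply:
  "cdual_apply (bidual_involution invol z) \<phi> = cnj (cdual_apply z (dual_involution invol \<phi>))"
  unfolding bidual_involution_def
  by (rule banach_star_bimodule.dual_invol_apply[OF banach_star_bimodule_dual])

lemma canonical_embedding_invol:
  "canonical_embedding (invol x) = bidual_involution invol (canonical_embedding x)"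
  by (rule cdual_eqI) (simp add: canonical_embedding_apply bidual_involution_apply dual_invol_apply invol_invol)

text \<open>
  If \<open>a\<^sup>\<star> b = 0\<close>, then \<open>b a\<^sup>\<star> = [b, a\<^sup>\<star>]\<close>, and the expression that has to vanish is the left-hand side of
  the tracial identity at this commutator.
\<close>

lemma perturbed_star_derivation_anti_derivable:
  assumes d: "star_derivation lact ract invol d" and T: "\<And>a. T a = d a + ract \<eta> a"
    and tracial: "\<And>a b. d (commutator a b) + lact (commutator a b) (invol \<eta>) + ract \<eta> (commutator a b) = 0"
  shows "l_star_anti_derivable_at_zero lact ract invol T"
  unfolding l_star_anti_derivable_at_zero_def
proof (intro allI impI)
  fix a b :: 'a assume "a\<^sup>\<star> * b = 0"
  then have c: "commutator b (a\<^sup>\<star>) = b * a\<^sup>\<star>" by (simp add: commutator_def)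
  have dm: "d (b * a\<^sup>\<star>) = ract (d b) (a\<^sup>\<star>) + lact b (d (a\<^sup>\<star>))"
    using d by (simp add: star_derivation_def derivation_def)
  have "invol (T a) = d (a\<^sup>\<star>) + lact (a\<^sup>\<star>) (invol \<eta>)"
    using d by (simp add: T invol.add invol_ract star_derivation_def)
  then show "ract (T b) (a\<^sup>\<star>) + lact b (invol (T a)) = 0"
    using tracial[of b "a\<^sup>\<star>"] unfolding c dm T by (simp add: act_simps algebra_simps)
qed

end


section \<open>Approximate identities acting on essential bimodules\<close>

lemma tendsto_identity_if_dense:
  fixes F :: "'i \<Rightarrow> 'x::real_normed_vector \<Rightarrow> 'x"
  assumes lin: "\<And>u. linear (F u)" and bd: "\<forall>\<^sub>F u in E. \<forall>x. norm (F u x) \<le> L * norm x"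
    and W: "closure W = UNIV" "\<And>x. x \<in> W \<Longrightarrow> ((\<lambda>u. F u x) \<longlongrightarrow> x) E"
  shows "((\<lambda>u. F u x) \<longlongrightarrow> x) E"
proof (rule tendstoI)
  fix e :: real assume e: "e > 0"
  define M where "M = \<bar>L\<bar> + 2"
  have M: "M > 0" by (simp add: M_def add_nonneg_pos)
  obtain w where w: "w \<in> W" "dist w x < e / M"
    using closure_approachable[of x W] W(1) e M by (metis UNIV_I divide_pos_pos)
  have "\<forall>\<^sub>F u in E. dist (F u w) w < e / M"
    using W(2)[OF w(1)] e M by (intro tendstoD) auto
  with bd show "\<forall>\<^sub>F u in E. dist (F u x) x < e"
  proof eventually_elim
    case (elim u)
    have "F u x - x = F u (x - w) + (F u w - w) + (w - x)"
      by (simp add: linear_diff[OF lin])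
    then have "norm (F u x - x) \<le> norm (F u (x - w)) + norm (F u w - w) + norm (w - x)"
      by (metis add_mono_thms_linordered_semiring(3) norm_triangle_ineq order_trans)
    also have "norm (F u (x - w)) \<le> \<bar>L\<bar> * norm (w - x)"
      using elim(1) mult_right_mono[of L "\<bar>L\<bar>" "norm (x - w)"]
      by (metis abs_ge_self norm_ge_zero norm_minus_commute order_trans)
    also have "\<bar>L\<bar> * norm (w - x) \<le> \<bar>L\<bar> * (e / M)"
      using w(2) by (intro mult_left_mono) (auto simp: dist_norm)
    finally have "norm (F u x - x) < \<bar>L\<bar> * (e / M) + e / M + e / M"
      using elim(2) w(2) by (simp add: dist_norm)
    also have "\<dots> = (\<bar>L\<bar> + 2) * (e / M)" by (simp only: distrib_right mult_2 add.assoc)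
    also have "\<dots> = e" using M by (simp add: M_def[symmetric])
    finally show "dist (F u x) x < e" by (simp add: dist_norm)
  qed
qed

lemma (in banach_bimodule) approximate_identity_acts:
  fixes E :: "'a filter"
  assumes ess: "essential_bimodule lact ract"
    and E: "\<forall>\<^sub>F u in E. norm u \<le> 1"
      "\<And>a. ((\<lambda>u. u * a) \<longlongrightarrow> a) E" "\<And>a. ((\<lambda>u. a * u) \<longlongrightarrow> a) E"
  shows "((\<lambda>u. lact u x) \<longlongrightarrow> x) E" "((\<lambda>u. ract x u) \<longlongrightarrow> x) E"
proof -
  define W where "W = complex_vector.span {ract (lact a x) b | a b x. True}"
  have W: "closure W = UNIV" using ess by (simp add: essential_bimodule_def W_def)
  obtain L where L: "L \<ge> 0" "\<And>a x. norm (lact a x) \<le> norm a * norm x * L"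
    using lact.nonneg_bounded by blast
  obtain R where R: "R \<ge> 0" "\<And>x a. norm (ract x a) \<le> norm x * norm a * R"
    using ract.nonneg_bounded by blast
  have "W \<subseteq> {x. ((\<lambda>u. lact u x) \<longlongrightarrow> x) E \<and> ((\<lambda>u. ract x u) \<longlongrightarrow> x) E}"
    unfolding W_def
  proof (rule complex_vector.span_minimal)
    have r: "ract 0 = (\<lambda>u. 0)" "ract (x + y) = (\<lambda>u. ract x u + ract y u)"
      "ract (c *\<^sub>C x) = (\<lambda>u. c *\<^sub>C ract x u)" for x y c
      by (simp_all add: fun_eq_iff ract.zero_left ract.add_left ract_scaleC)
    show "complex_vector.subspace {x. ((\<lambda>u. lact u x) \<longlongrightarrow> x) E \<and> ((\<lambda>u. ract x u) \<longlongrightarrow> x) E}"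
      unfolding complex_vector.subspace_def
      by (auto simp: lact.add_right lact.zero_right lact_scaleC r
          intro!: tendsto_add bounded_linear.tendsto[OF bounded_linear_scaleC])
    show "{ract (lact a x) b | a b x. True} \<subseteq> {x. ((\<lambda>u. lact u x) \<longlongrightarrow> x) E \<and> ((\<lambda>u. ract x u) \<longlongrightarrow> x) E}"
    proof safe
      fix a b x
      have "lact u (ract (lact a x) b) = ract (lact (u * a) x) b" for u
        by (simp add: act_simps)
      then show "((\<lambda>u. lact u (ract (lact a x) b)) \<longlongrightarrow> ract (lact a x) b) E"
        by (simp add: ract.tendsto lact.tendsto E)
      have "ract (ract (lact a x) b) u = ract (lact a x) (b * u)" for u
        by (simp add: act_simps)
      then show "((\<lambda>u. ract (ract (lact a x) b) u) \<longlongrightarrow> ract (lact a x) b) E"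
        by (simp add: ract.tendsto E)
    qed
  qed
  then have lim: "((\<lambda>u. lact u x) \<longlongrightarrow> x) E" "((\<lambda>u. ract x u) \<longlongrightarrow> x) E" if "x \<in> W" for x
    using that by auto
  show "((\<lambda>u. lact u x) \<longlongrightarrow> x) E"
  proof (rule tendsto_identity_if_dense[OF _ _ W lim(1)])
    show "linear (lact u)" for u using lact.bounded_linear_right[of u] by (rule bounded_linear.linear)
    show "\<forall>\<^sub>F u in E. \<forall>x. norm (lact u x) \<le> L * norm x"
    proof (rule eventually_mono[OF E(1)], rule allI)
      fix u :: 'a and x :: 'x assume "norm u \<le> 1"
      then have "norm u * norm x * L \<le> 1 * norm x * L" using L(1) by (intro mult_right_mono) auto
      then show "norm (lact u x) \<le> L * norm x" using L(2)[of u x] by (simp add: mult.commute)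
    qed
  qed
  show "((\<lambda>u. ract x u) \<longlongrightarrow> x) E"
  proof (rule tendsto_identity_if_dense[OF _ _ W lim(2)])
    show "linear (\<lambda>x. ract x u)" for u using ract.bounded_linear_left[of u] by (rule bounded_linear.linear)
    show "\<forall>\<^sub>F u in E. \<forall>x. norm (ract x u) \<le> R * norm x"
    proof (rule eventually_mono[OF E(1)], rule allI)
      fix u :: 'a and x :: 'x assume "norm u \<le> 1"
      then have "norm x * norm u * R \<le> norm x * 1 * R" using R(1) by (intro mult_right_mono mult_left_mono) auto
      then show "norm (ract x u) \<le> R * norm x" using R(2)[of x u] by (simp add: mult.commute)
    qed
  qed
qed


section \<open>Perturbed star-derivations\<close>

locale essential_star_bimodule_map = banach_star_bimodule lX rX sX
  for lX :: "'a::cstar_algebra \<Rightarrow> 'x::cbanach \<Rightarrow> 'x" and rX and sX +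
  fixes T :: "'a \<Rightarrow> 'x"
  assumes essential: "essential_bimodule lX rX" and bounded_clinear_T: "bounded_clinear T"
begin

abbreviation \<iota> :: "'x \<Rightarrow> 'x cdual cdual" where "\<iota> \<equiv> canonical_embedding"
abbreviation lB where "lB \<equiv> bidual_lact lX"
abbreviation rB where "rB \<equiv> bidual_ract rX"
abbreviation sB where "sB \<equiv> bidual_involution sX"

sublocale bidual: banach_star_bimodule lB rB sB
  by (rule banach_star_bimodule_bidual)

sublocale T: bounded_linear T
  using bounded_clinear_T by (simp add: bounded_clinear_iff)

lemma T_scaleC: "T (c *\<^sub>C a) = c *\<^sub>C T a"
  using bounded_clinear_T by (simp add: bounded_clinear_iff)

definition S :: "'a \<Rightarrow> 'x"
  where "S a = sX (T (a\<^sup>\<star>))"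

lemma bounded_linear_S: "bounded_linear S"
  unfolding S_def[abs_def]
  by (rule bounded_linear_compose[OF bounded_linear_invol
        bounded_linear_compose[OF T.bounded_linear_axioms bounded_linear_star]])

sublocale S: bounded_linear S by (rule bounded_linear_S)

lemma S_scaleC: "S (c *\<^sub>C a) = c *\<^sub>C S a"
  by (simp add: S_def star_scaleC T_scaleC invol_scaleC)

lemma sX_S: "sX (S a) = T (a\<^sup>\<star>)"
  by (simp add: S_def invol_invol)

definition V :: "'a \<Rightarrow> 'a \<Rightarrow> 'x"
  where "V x y = rX (T y) x + lX y (S x)"

lemma bounded_bilinear_V: "bounded_bilinear V"
proof
  obtain L where L: "L \<ge> 0" "\<And>a x. norm (lX a x) \<le> norm a * norm x * L"
    using lact.nonneg_bounded by blast
  obtain R where R: "R \<ge> 0" "\<And>x a. norm (rX x a) \<le> norm x * norm a * R"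
    using ract.nonneg_bounded by blast
  obtain K where K: "K \<ge> 0" "\<And>x. norm (T x) \<le> norm x * K" using T.nonneg_bounded by blast
  obtain M where M: "M \<ge> 0" "\<And>x. norm (S x) \<le> norm x * M" using S.nonneg_bounded by blast
  show "\<exists>K. \<forall>x y. norm (V x y) \<le> norm x * norm y * K"
  proof (intro exI allI)
    fix x y
    have "norm (rX (T y) x) \<le> (norm y * K) * norm x * R"
      using K R by (intro order_trans[OF R(2)] mult_right_mono) auto
    moreover have "norm (lX y (S x)) \<le> norm y * (norm x * M) * L"
      using M L by (intro order_trans[OF L(2)] mult_right_mono mult_left_mono) auto
    ultimately show "norm (V x y) \<le> norm x * norm y * (K * R + M * L)"
      unfolding V_def using norm_triangle_ineq[of "rX (T y) x" "lX y (S x)"]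
      by (simp add: algebra_simps)
  qed
qed (simp_all add: V_def act_simps T.add S.add T.scaleR S.scaleR lact.scaleR_left lact.scaleR_right
    ract.scaleR_left ract.scaleR_right scaleR_add_right)

lemma V_balanced:
  assumes "l_star_anti_derivable_at_zero lX rX sX T"
  shows "V (x * y) z = V x (y * z)"
proof (rule zero_product_form_balanced[OF bounded_bilinear_V])
  show "V x y = 0" if "x * y = 0" for x y
    using assms[unfolded l_star_anti_derivable_at_zero_def, rule_format, of "x\<^sup>\<star>" y] that
    by (simp add: V_def S_def star_star)
  show "V (c *\<^sub>C x) y = V x (c *\<^sub>C y)" for c x y
    by (simp add: V_def T_scaleC S_scaleC lact_scaleC ract_scaleC)
qed

definition approximate_unit :: "'a filter \<Rightarrow> bool"
  where "approximate_unit E \<longleftrightarrow> E \<noteq> bot \<and> (\<forall>\<^sub>F u in E. u\<^sup>\<star> = u \<and> norm u \<le> 1) \<and>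
    (\<forall>a. ((\<lambda>u. u * a) \<longlongrightarrow> a) E) \<and> (\<forall>a. ((\<lambda>u. a * u) \<longlongrightarrow> a) E)"

lemma ex_approximate_unit: "\<exists>E. approximate_unit E"
  unfolding approximate_unit_def by (rule approximate_identity) blast

lemma approximate_unit_acts:
  assumes "approximate_unit E"
  shows "((\<lambda>u. lX u x) \<longlongrightarrow> x) E" "((\<lambda>u. rX x u) \<longlongrightarrow> x) E"
proof -
  have "\<forall>\<^sub>F u in E. norm u \<le> 1"
    using assms unfolding approximate_unit_def by (auto elim: eventually_mono)
  then show "((\<lambda>u. lX u x) \<longlongrightarrow> x) E" "((\<lambda>u. rX x u) \<longlongrightarrow> x) E"
    using assms approximate_identity_acts[OF essential, of E x] by (simp_all add: approximate_unit_def)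
qed

text \<open>
  Both relations are limits of \<open>V (x y) z = V x (y z)\<close> along an approximate identity on which \<open>T\<close>
  converges weak-star to \<open>\<eta>\<close>. On its self-adjoint members \<open>S u\<close> is the adjoint of \<open>T u\<close> and so
  converges to the adjoint of \<open>\<eta>\<close>, because the involution of the bidual is weak-star continuous.
\<close>

lemma bidual_perturbation_relations:
  assumes anti: "l_star_anti_derivable_at_zero lX rX sX T"
  obtains \<eta> where "\<And>x y. \<iota> (V x y) = \<iota> (T (x * y)) + lB (x * y) (sB \<eta>)"
    and "\<And>w. rB \<eta> w + \<iota> (S w) = \<iota> (T w) + lB w (sB \<eta>)"
proof -
  note bal = V_balanced[OF anti, unfolded V_def]
  obtain E0 where E0: "approximate_unit E0" using ex_approximate_unit by blast
  then have E0': "E0 \<noteq> bot" "\<forall>\<^sub>F u in E0. norm u \<le> 1"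
    by (auto simp: approximate_unit_def elim: eventually_mono)
  obtain K where K: "K \<ge> 0" "\<And>x. norm (T x) \<le> norm x * K" using T.nonneg_bounded by blast
  have "\<forall>\<^sub>F u in E0. norm (T u) \<le> K"
    using E0'(2) by (rule eventually_mono) (use K mult_right_mono order_trans in fastforce)
  then obtain E \<eta> where E: "E \<noteq> bot" "E \<le> E0"
    and lim: "\<And>\<phi>. ((\<lambda>u. cdual_apply \<phi> (T u)) \<longlongrightarrow> cdual_apply \<eta> \<phi>) E"
    using weak_star_cluster_point[OF E0'(1)] by blast
  have "approximate_unit E"
    using E0 E tendsto_mono[OF E(2)] filter_leD[OF E(2)] by (auto simp: approximate_unit_def)
  note act = approximate_unit_acts[OF this]
  have ulim: "((\<lambda>u. u * a) \<longlongrightarrow> a) E" "((\<lambda>u. a * u) \<longlongrightarrow> a) E"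
    and sa: "\<forall>\<^sub>F u in E. u\<^sup>\<star> = u" for a
    using \<open>approximate_unit E\<close> by (auto simp: approximate_unit_def elim: eventually_mono)
  note \<phi>lim = bounded_linear.tendsto[OF bounded_linear_cdual_apply]
  have limS: "((\<lambda>u. cdual_apply \<phi> (lX w (S u))) \<longlongrightarrow> cdual_apply (lB w (sB \<eta>)) \<phi>) E" for w \<phi>
  proof -
    let ?\<psi> = "dual_involution sX (dual_ract lX \<phi> w)"
    have "((\<lambda>u. cnj (cdual_apply ?\<psi> (T u))) \<longlongrightarrow> cnj (cdual_apply \<eta> ?\<psi>)) E"
      by (intro tendsto_cnj lim)
    moreover have "\<forall>\<^sub>F u in E. cnj (cdual_apply ?\<psi> (T u)) = cdual_apply \<phi> (lX w (S u))"
      using sa by (rule eventually_mono) (simp add: dual_invol_apply dual_ract_apply S_def)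
    ultimately show ?thesis
      by (simp add: tendsto_cong bidual_lact_apply bidual_involution_apply)
  qed
  have limT: "((\<lambda>u. cdual_apply \<phi> (rX (T u) w)) \<longlongrightarrow> cdual_apply (rB \<eta> w) \<phi>) E" for w \<phi>
    using lim[of "dual_lact rX w \<phi>"] by (simp add: bidual_ract_apply dual_lact_apply)
  \<comment> \<open>The first factor tends to the unit: \<open>V (u x) y = V u (x y)\<close>.\<close>
  have R1: "\<iota> (V x y) = \<iota> (T (x * y)) + lB (x * y) (sB \<eta>)" for x y
  proof (rule cdual_eqI)
    fix \<phi>
    have "((\<lambda>u. cdual_apply \<phi> (rX (T y) (u * x) + lX y (S (u * x)))) \<longlongrightarrow> cdual_apply \<phi> (V x y)) E"
      unfolding V_def by (intro \<phi>lim tendsto_add ract.tendsto lact.tendsto tendsto_const S.tendsto ulim)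
    moreover have "((\<lambda>u. cdual_apply \<phi> (rX (T (x * y)) u) + cdual_apply \<phi> (lX (x * y) (S u)))
        \<longlongrightarrow> cdual_apply \<phi> (T (x * y)) + cdual_apply (lB (x * y) (sB \<eta>)) \<phi>) E"
      by (intro tendsto_add \<phi>lim act limS)
    ultimately show "cdual_apply (\<iota> (V x y)) \<phi> = cdual_apply (\<iota> (T (x * y)) + lB (x * y) (sB \<eta>)) \<phi>"
      using E(1) by (simp add: bal cdual_apply_linear cdual_rep_eq canonical_embedding_apply tendsto_unique)
  qed
  \<comment> \<open>The last factor tends to the unit: \<open>V (x y) u = V x (y u)\<close>.\<close>
  have R2: "rB \<eta> (x * y) + \<iota> (S (x * y)) = \<iota> (V x y)" for x y
  proof (rule cdual_eqI)
    fix \<phi>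
    have "((\<lambda>u. cdual_apply \<phi> (rX (T u) (x * y)) + cdual_apply \<phi> (lX u (S (x * y))))
        \<longlongrightarrow> cdual_apply (rB \<eta> (x * y)) \<phi> + cdual_apply \<phi> (S (x * y))) E"
      by (intro tendsto_add \<phi>lim act limT)
    moreover have "((\<lambda>u. cdual_apply \<phi> (rX (T (y * u)) x + lX (y * u) (S x))) \<longlongrightarrow> cdual_apply \<phi> (V x y)) E"
      unfolding V_def by (intro \<phi>lim tendsto_add ract.tendsto lact.tendsto tendsto_const T.tendsto ulim)
    ultimately show "cdual_apply (rB \<eta> (x * y) + \<iota> (S (x * y))) \<phi> = cdual_apply (\<iota> (V x y)) \<phi>"
      using E(1)
      by (simp add: bal[symmetric] cdual_apply_linear cdual_rep_eq canonical_embedding_apply tendsto_unique)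
  qed
  have R3: "rB \<eta> w + \<iota> (S w) = \<iota> (T w) + lB w (sB \<eta>)" for w
  proof -
    have eq: "rB \<eta> (u * w) + \<iota> (S (u * w)) = \<iota> (T (u * w)) + lB (u * w) (sB \<eta>)" for u
      unfolding R2 by (rule R1)
    note \<iota>lim = bounded_linear.tendsto[OF bounded_linear_canonical_embedding]
    have "((\<lambda>u. rB \<eta> (u * w) + \<iota> (S (u * w))) \<longlongrightarrow> rB \<eta> w + \<iota> (S w)) E"
      by (intro tendsto_add \<iota>lim bidual.ract.tendsto tendsto_const S.tendsto ulim)
    moreover have "((\<lambda>u. \<iota> (T (u * w)) + lB (u * w) (sB \<eta>)) \<longlongrightarrow> \<iota> (T w) + lB w (sB \<eta>)) E"
      by (intro tendsto_add \<iota>lim bidual.lact.tendsto tendsto_const T.tendsto ulim)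
    ultimately show ?thesis using E(1) unfolding eq by (rule tendsto_unique[rotated])
  qed
  from R1 R3 show ?thesis by (rule that)
qed

text \<open>
  The conditions in (b); the product formula among them is \<open>perturbed_derivation_mult\<close>.
\<close>

definition bidual_star_perturbation :: "('a \<Rightarrow> 'x cdual cdual) \<Rightarrow> 'x cdual cdual \<Rightarrow> bool"
  where "bidual_star_perturbation d \<eta> \<longleftrightarrow> star_derivation lB rB sB d \<and>
    (\<forall>a b. d (commutator a b) + lB (commutator a b) (sB \<eta>) + rB \<eta> (commutator a b) = 0) \<and>
    (\<forall>a. \<iota> (T a) = d a + rB \<eta> a)"

definition star_perturbation :: "('a \<Rightarrow> 'x) \<Rightarrow> 'x \<Rightarrow> bool"
  where "star_perturbation d \<eta> \<longleftrightarrow> star_derivation lX rX sX d \<and>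
    (\<forall>a b. d (commutator a b) + lX (commutator a b) (sX \<eta>) + rX \<eta> (commutator a b) = 0) \<and>
    (\<forall>a. T a = d a + rX \<eta> a)"

theorem anti_derivable_imp_bidual_star_perturbation:
  assumes anti: "l_star_anti_derivable_at_zero lX rX sX T"
  shows "\<exists>d \<eta>. bidual_star_perturbation d \<eta>"
proof -
  obtain \<eta> where R1: "\<And>x y. \<iota> (V x y) = \<iota> (T (x * y)) + lB (x * y) (sB \<eta>)"
    and R3: "\<And>w. rB \<eta> w + \<iota> (S w) = \<iota> (T w) + lB w (sB \<eta>)"
    using bidual_perturbation_relations[OF anti] by blast
  define d where "d w = \<iota> (T w) - rB \<eta> w" for w
  have dS: "d w = \<iota> (S w) - lB w (sB \<eta>)" for w
    using R3[of w] by (simp add: d_def algebra_simps)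
  have "bounded_linear d"
    unfolding d_def[abs_def]
    by (intro bounded_linear_sub bounded_linear_compose[OF bounded_linear_canonical_embedding]
        T.bounded_linear_axioms bidual.ract.bounded_linear_right)
  then have bd: "bounded_clinear d"
    by (simp add: bounded_clinear_iff d_def T_scaleC canonical_embedding_scaleC bidual.ract_scaleC
        scaleC_diff_right)
  interpret twisted_derivation lB rB d \<eta> "sB \<eta>"
  proof unfold_locales
    fix x y
    have "rB (d x) y + lB x (d y)
        = \<iota> (V y x) - rB \<eta> (x * y) - lB (x * y) (sB \<eta>)"
      unfolding d_def[of x] dS[of y]
      by (simp add: V_def bidual.act_simps canonical_embedding_linear canonical_embedding_ract
          canonical_embedding_lact algebra_simps)
    also have "\<dots> = d (y * x) + rB \<eta> (commutator y x) + lB (commutator y x) (sB \<eta>)"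
      unfolding R1 d_def commutator_def
      by (simp add: bidual.ract.diff_right bidual.lact.diff_left)
    finally show "rB (d x) y + lB x (d y)
      = d (y * x) + rB \<eta> (commutator y x) + lB (commutator y x) (sB \<eta>)" .
  qed (rule bd)
  have "d (a\<^sup>\<star>) = sB (d a)" for a
    unfolding dS[of a] d_def[of "a\<^sup>\<star>"]
    by (simp add: bidual.invol.diff canonical_embedding_invol[symmetric] sX_S bidual.invol_lact
        bidual.invol_invol)
  then have "star_derivation lB rB sB d" by (simp add: star_derivation_def derivation_d)
  moreover have "d (commutator a b) + lB (commutator a b) (sB \<eta>) + rB \<eta> (commutator a b) = 0" for a b
    using g_eq_0[of a b] by (simp add: g_def G_def add_ac)
  ultimately show ?thesis
    unfolding bidual_star_perturbation_def by (intro exI[of _ d] exI[of _ \<eta>]) (simp add: d_def)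
qed

lemma bidual_star_perturbation_imp_anti_derivable:
  assumes "bidual_star_perturbation d \<eta>"
  shows "l_star_anti_derivable_at_zero lX rX sX T"
proof -
  have "l_star_anti_derivable_at_zero lB rB sB (\<lambda>a. \<iota> (T a))"
    by (rule bidual.perturbed_star_derivation_anti_derivable)
      (use assms in \<open>auto simp: bidual_star_perturbation_def\<close>)
  then have "\<iota> (rX (T b) (a\<^sup>\<star>) + lX b (sX (T a))) = 0" if "a\<^sup>\<star> * b = 0" for a b
    using that unfolding l_star_anti_derivable_at_zero_def
    by (simp add: canonical_embedding_ract canonical_embedding_lact canonical_embedding_invol
        canonical_embedding_linear)
  then show ?thesis
    using canonical_embedding_eq_0 unfolding l_star_anti_derivable_at_zero_def by blast
qed

lemma star_perturbation_imp_anti_derivable: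
  assumes "star_perturbation d \<eta>"
  shows "l_star_anti_derivable_at_zero lX rX sX T"
  by (rule perturbed_star_derivation_anti_derivable)
    (use assms in \<open>auto simp: star_perturbation_def\<close>)

text \<open>
  Then \<open>d'\<close> takes its values in \<open>X\<close>, and all identities can be read in \<open>X\<close> as the embedding is
  injective. The identity for \<open>a \<eta>'\<^sup>\<star>\<close> needed in (i) is the adjoint of the assumption.
\<close>

lemma star_perturbation_if_implemented:
  assumes B: "bidual_star_perturbation d' \<eta>'" and \<eta>: "\<And>a. rB \<eta>' a = \<iota> (rX \<eta> a)"
  shows "\<exists>d. star_perturbation d \<eta>"
proof -
  define d where "d a = T a - rX \<eta> a" for a
  have d: "\<iota> (d a) = d' a" for a
    using B by (simp add: d_def canonical_embedding_linear bidual_star_perturbation_def \<eta>)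
  have l: "lB a (sB \<eta>') = \<iota> (lX a (sX \<eta>))" for a
  proof -
    have "lB a (sB \<eta>') = sB (rB \<eta>' (a\<^sup>\<star>))" by (simp add: bidual.invol_ract star_star)
    then show ?thesis by (simp add: \<eta> canonical_embedding_invol[symmetric] invol_ract star_star)
  qed
  have "clinear d"
    by (simp add: clinear_iff d_def T.add T_scaleC act_simps ract_scaleC scaleC_diff_right)
  moreover have "d (a * b) = rX (d a) b + lX a (d b)" for a b
    by (rule canonical_embedding_inject[THEN iffD1])
      (use B in \<open>simp add: canonical_embedding_linear canonical_embedding_lact
        canonical_embedding_ract d bidual_star_perturbation_def star_derivation_def derivation_def\<close>)
  moreover have "d (a\<^sup>\<star>) = sX (d a)" for a
    by (rule canonical_embedding_inject[THEN iffD1])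
      (use B in \<open>simp add: canonical_embedding_invol d bidual_star_perturbation_def
        star_derivation_def\<close>)
  moreover have "d (commutator a b) + lX (commutator a b) (sX \<eta>) + rX \<eta> (commutator a b) = 0" for a b
    by (rule canonical_embedding_inject[THEN iffD1])
      (use B in \<open>simp add: canonical_embedding_linear d l[symmetric] \<eta>[symmetric]
        bidual_star_perturbation_def\<close>)
  ultimately show ?thesis
    unfolding star_perturbation_def star_derivation_def derivation_def
    by (intro exI[of _ d]) (simp add: d_def)
qed

text \<open>
  Since \<open>X\<close> is essential, \<open>e\<close> acts as the identity on \<open>X\<close> and hence on the bidual. So \<open>d e = 0\<close>, and
  \<open>T e = \<eta> e = \<eta>\<close>.
\<close>

lemma implemented_if_unital:
  assumes B: "bidual_star_perturbation d \<eta>" and e: "\<And>a. e * a = a" "\<And>a. a * e = a"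
  shows "rB \<eta> a = \<iota> (rX (T e) a)"
proof -
  obtain E where E: "approximate_unit E" using ex_approximate_unit by blast
  then have nb: "E \<noteq> bot" by (simp add: approximate_unit_def)
  have le: "lX e x = x" for x
  proof -
    have "((\<lambda>u. lX e (lX u x)) \<longlongrightarrow> lX e x) E"
      by (intro lact.tendsto tendsto_const approximate_unit_acts[OF E])
    then show ?thesis
      unfolding lact_mult[symmetric] e using tendsto_unique[OF nb _ approximate_unit_acts(1)[OF E]] by blast
  qed
  have re: "rX x e = x" for x
  proof -
    have "((\<lambda>u. rX (rX x u) e) \<longlongrightarrow> rX x e) E"
      by (intro ract.tendsto tendsto_const approximate_unit_acts[OF E])
    then show ?thesis
      unfolding ract_mult[symmetric] e using tendsto_unique[OF nb _ approximate_unit_acts(2)[OF E]] by blast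
  qed
  have "lB e z = z" "rB z e = z" for z
    by (rule cdual_eqI, simp add: bidual_lact_apply bidual_ract_apply,
        rule arg_cong[of _ _ "cdual_apply z"], rule cdual_eqI,
        simp add: dual_lact_apply dual_ract_apply le re)+
  then have "d e = d e + d e"
    using B e(1)[of e] unfolding bidual_star_perturbation_def star_derivation_def derivation_def by metis
  then have "\<iota> (T e) = rB \<eta> e" using B by (simp add: bidual_star_perturbation_def)
  then show ?thesis by (simp add: canonical_embedding_ract bidual.ract_mult[symmetric] e)
qed

text \<open>
  The map \<open>P\<close> below is the bimodule projection of the bidual of a dual space onto that space.
  Applying it to \<open>T = d + \<eta> \<cdot>\<close> and to \<open>S = d + \<cdot> \<eta>\<^sup>\<star>\<close> shows that the derivation \<open>\<delta> = P d - d\<close> is both a left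
  and a right multiplication, \<open>\<delta> a = \<omega> a = a \<omega>'\<close>. Then \<open>\<delta> (a b) = \<delta> a b = a \<delta> b\<close>, while the derivation law
  makes it the sum of the last two. So \<open>\<delta> (a b) = 0\<close>, and \<open>\<omega> a = 0\<close> for all \<open>a\<close> by density of products.
\<close>

lemma implemented_if_dual:
  fixes lY :: "'a \<Rightarrow> 'y::cbanach \<Rightarrow> 'y"
  assumes B: "bidual_star_perturbation d \<eta>" and dual: "is_dual_bimodule_of lX rX lY rY"
  obtains \<eta>' where "\<And>a. rB \<eta> a = \<iota> (rX \<eta>' a)"
proof -
  interpret Y: banach_bimodule lY rY using dual by (simp add: is_dual_bimodule_of_def)
  obtain J :: "'x \<Rightarrow> 'y cdual" where J: "clinear J" "\<And>x. norm (J x) = norm x" "surj J"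
    "\<And>a x. J (lX a x) = dual_lact rY a (J x)" "\<And>a x. J (rX x a) = dual_ract lY (J x) a"
    using dual unfolding is_dual_bimodule_of_def by blast
  have bJ: "bounded_clinear J"
    using J(1,2) by (auto simp: bounded_clinear_def intro: exI[of _ 1])
  have J_add: "J (x + y) = J x + J y" and J_diff: "J (x - y) = J x - J y" for x y
    using bJ linear_add linear_diff by (auto simp: bounded_clinear_iff dest!: bounded_linear.linear)
  have injJ: "x = y" if "J x = J y" for x y
    using J(2)[of "x - y"] that by (simp add: J_diff)
  define Q where "Q z = adjoint_map canonical_embedding (adjoint_map (adjoint_map J) z)" for z
  \<comment> \<open>The functional \<open>x \<mapsto> J x y\<close> on \<open>X\<close>; \<open>Q z\<close> is the restriction of \<open>z\<close> to these functionals.\<close>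
  define \<Lambda> where "\<Lambda> y = adjoint_map J (canonical_embedding y)" for y
  have \<Lambda>: "cdual_apply (\<Lambda> y) x = cdual_apply (J x) y" for x y
    by (simp add: \<Lambda>_def adjoint_map_apply bJ canonical_embedding_apply)
  have Q: "cdual_apply (Q z) y = cdual_apply z (\<Lambda> y)" for z y
    by (simp add: Q_def \<Lambda>_def adjoint_map_apply bJ bounded_clinear_adjoint_map
        bounded_clinear_canonical_embedding)
  define P where "P z = inv J (Q z)" for z
  have JP: "J (P z) = Q z" for z by (simp add: P_def surj_f_inv_f J(3))
  have P_add: "P (y + z) = P y + P z" for y z
    by (rule injJ, rule cdual_eqI) (simp add: J_add JP cdual_rep_eq Q)
  have P_\<iota>: "P (\<iota> x) = x" for x
    by (rule injJ, rule cdual_eqI) (simp add: JP Q canonical_embedding_apply \<Lambda>)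
  have P_r: "P (rB z a) = rX (P z) a" for z a
  proof (rule injJ, rule cdual_eqI)
    fix y
    have "dual_lact rX a (\<Lambda> y) = \<Lambda> (lY a y)"
      by (rule cdual_eqI) (simp add: dual_lact_apply \<Lambda> J Y.dual_ract_apply)
    then show "cdual_apply (J (P (rB z a))) y = cdual_apply (J (rX (P z) a)) y"
      by (simp add: J JP Q Y.dual_ract_apply bidual_ract_apply)
  qed
  have P_l: "P (lB a z) = lX a (P z)" for z a
  proof (rule injJ, rule cdual_eqI)
    fix y
    have "dual_ract lX (\<Lambda> y) a = \<Lambda> (rY y a)"
      by (rule cdual_eqI) (simp add: dual_ract_apply \<Lambda> J Y.dual_lact_apply)
    then show "cdual_apply (J (P (lB a z))) y = cdual_apply (J (lX a (P z))) y"
      by (simp add: J JP Q Y.dual_lact_apply bidual_lact_apply)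
  qed
  have dmult: "d (a * b) = rB (d a) b + lB a (d b)" and dstar: "d (a\<^sup>\<star>) = sB (d a)"
    and T: "\<iota> (T a) = d a + rB \<eta> a" for a b
    using B by (simp_all add: bidual_star_perturbation_def star_derivation_def derivation_def)
  have S: "\<iota> (S a) = d a + lB a (sB \<eta>)" for a
    by (simp add: S_def canonical_embedding_invol T bidual.invol.add dstar bidual.invol_invol
        bidual.invol_ract star_star)
  define \<delta> where "\<delta> a = \<iota> (P (d a)) - d a" for a
  have \<delta>_r: "\<delta> a = rB (\<eta> - \<iota> (P \<eta>)) a" for a
  proof -
    have "T a = P (d a) + rX (P \<eta>) a" using arg_cong[OF T, of P a] by (simp add: P_\<iota> P_add P_r)
    then have "\<iota> (P (d a)) + rB (\<iota> (P \<eta>)) a = d a + rB \<eta> a"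
      using T[of a] by (simp add: canonical_embedding_linear canonical_embedding_ract)
    then show ?thesis by (simp add: \<delta>_def bidual.act_simps algebra_simps)
  qed
  have \<delta>_l: "\<delta> a = lB a (sB \<eta> - \<iota> (P (sB \<eta>)))" for a
  proof -
    have "S a = P (d a) + lX a (P (sB \<eta>))" using arg_cong[OF S, of P a] by (simp add: P_\<iota> P_add P_l)
    then have "\<iota> (P (d a)) + lB a (\<iota> (P (sB \<eta>))) = d a + lB a (sB \<eta>)"
      using S[of a] by (simp add: canonical_embedding_linear canonical_embedding_lact)
    then show ?thesis by (simp add: \<delta>_def bidual.act_simps algebra_simps)
  qed
  have "\<delta> (a * b) = 0" for a b
  proof -
    have "\<delta> (a * b) = rB (\<delta> a) b + lB a (\<delta> b)"
      unfolding \<delta>_def dmult P_add P_r P_l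
      by (simp add: canonical_embedding_linear canonical_embedding_ract canonical_embedding_lact
          bidual.act_simps algebra_simps)
    moreover have "\<delta> (a * b) = rB (\<delta> a) b" by (simp add: \<delta>_r bidual.ract_mult)
    moreover have "\<delta> (a * b) = lB a (\<delta> b)" by (simp add: \<delta>_l bidual.lact_mult)
    ultimately show ?thesis by simp
  qed
  then have r0: "rB (\<eta> - \<iota> (P \<eta>)) (u * a) = 0" for u a by (simp add: \<delta>_r)
  have "rB (\<eta> - \<iota> (P \<eta>)) a = 0" for a
  proof -
    obtain E where E: "approximate_unit E" using ex_approximate_unit by blast
    then have "((\<lambda>u. rB (\<eta> - \<iota> (P \<eta>)) (u * a)) \<longlongrightarrow> rB (\<eta> - \<iota> (P \<eta>)) a) E"
      by (intro bidual.ract.tendsto tendsto_const) (simp add: approximate_unit_def)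
    then show ?thesis
      unfolding r0 using E tendsto_unique[OF _ _ tendsto_const] by (force simp: approximate_unit_def)
  qed
  then have "rB \<eta> a = \<iota> (rX (P \<eta>) a)" for a
    by (simp add: bidual.ract.diff_left canonical_embedding_ract)
  then show ?thesis by (rule that)
qed

end

theorem theorem11:
  fixes lX :: "'a::cstar_algebra \<Rightarrow> 'x::cbanach \<Rightarrow> 'x"
    and rX :: "'x \<Rightarrow> 'a \<Rightarrow> 'x"
    and sX :: "'x \<Rightarrow> 'x"
    and T :: "'a \<Rightarrow> 'x"
    and lY :: "'a \<Rightarrow> 'y::cbanach \<Rightarrow> 'y"
    and rY :: "'y \<Rightarrow> 'a \<Rightarrow> 'y"
  assumes "banach_star_bimodule lX rX sX"
    and "essential_bimodule lX rX"
    and "bounded_clinear T"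
  shows
    "(l_star_anti_derivable_at_zero lX rX sX T \<longleftrightarrow>
       (\<exists>(d :: 'a \<Rightarrow> 'x cdual cdual) (\<eta> :: 'x cdual cdual).
          star_derivation (bidual_lact lX) (bidual_ract rX) (bidual_involution sX) d \<and>
          (\<forall>a b. d (commutator a b) + bidual_lact lX (commutator a b) (bidual_involution sX \<eta>)
                   + bidual_ract rX \<eta> (commutator a b) = 0) \<and>
          (\<forall>a b. canonical_embedding (T (a * b)) =
                   bidual_lact lX a (canonical_embedding (T b))
                   + bidual_ract rX (canonical_embedding (T a)) b
                   - bidual_ract rX (bidual_lact lX a \<eta>) b) \<and>
          (\<forall>a. canonical_embedding (T a) = d a + bidual_ract rX \<eta> a)))
     \<and>
     (unital_algebra TYPE('a) \<or> is_dual_bimodule_of lX rX lY rY \<longrightarrow>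
      (l_star_anti_derivable_at_zero lX rX sX T \<longleftrightarrow>
       (\<exists>(d :: 'a \<Rightarrow> 'x) (\<eta> :: 'x).
          star_derivation lX rX sX d \<and>
          (\<forall>a b. d (commutator a b) + lX (commutator a b) (sX \<eta>)
                   + rX \<eta> (commutator a b) = 0) \<and>
          (\<forall>a b. T (a * b) = lX a (T b) + rX (T a) b - rX (lX a \<eta>) b) \<and>
          (\<forall>a. T a = d a + rX \<eta> a))))"
    (is "(?a \<longleftrightarrow> (\<exists>d \<eta>. ?b d \<eta>)) \<and> (?unital \<or> ?dual \<longrightarrow> (?a \<longleftrightarrow> (\<exists>d \<eta>. ?b' d \<eta>)))")
proof -
  interpret essential_star_bimodule_map lX rX sX T
    using assms by (simp add: essential_star_bimodule_map_def essential_star_bimodule_map_axioms_def)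
  have b: "?b d \<eta> \<longleftrightarrow> bidual_star_perturbation d \<eta>" for d \<eta>
    using bidual.perturbed_derivation_mult[of d "\<lambda>a. \<iota> (T a)" \<eta>]
    unfolding bidual_star_perturbation_def star_derivation_def by blast
  have b': "?b' d \<eta> \<longleftrightarrow> star_perturbation d \<eta>" for d \<eta>
    using perturbed_derivation_mult[of d T \<eta>]
    unfolding star_perturbation_def star_derivation_def by blast
  have ab: "?a \<longleftrightarrow> (\<exists>d \<eta>. bidual_star_perturbation d \<eta>)"
    using anti_derivable_imp_bidual_star_perturbation bidual_star_perturbation_imp_anti_derivable
    by blast
  have "\<exists>d \<eta>. star_perturbation d \<eta>" if cond: "?unital \<or> ?dual" and a: ?a
  proof -
    obtain d \<eta> where B: "bidual_star_perturbation d \<eta>" using a ab by blast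
    have "\<exists>\<eta>'. \<forall>a. rB \<eta> a = \<iota> (rX \<eta>' a)"
      using cond
    proof
      assume ?unital
      then obtain e :: 'a where "\<And>a. e * a = a" "\<And>a. a * e = a"
        by (auto simp: unital_algebra_def)
      then show ?thesis using implemented_if_unital[OF B] by blast
    next
      assume ?dual
      then show ?thesis using implemented_if_dual[OF B] by metis
    qed
    then show ?thesis using star_perturbation_if_implemented[OF B] by blast
  qed
  then show ?thesis
    unfolding b b' using ab star_perturbation_imp_anti_derivable by blast
qed

end
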